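(* Assume the Exponential-Time Hypothesis. Then there are constants $N_0,\delta > 0$ such that for all integers $k, \ell$ with $k \geq N_0$ and $0 < \ell \leq (k-4)/2$, no algorithm computes, on input an $n$-vertex graph $G$, the number of $k$-element subsets $X\subseteq V(G)$ such that $G[X]$ is an $\ell$-scorpion, in time $O(n^{\delta \cdot \ell})$.
   Context: Here $k$ and $\ell$ are fixed and only $G$ is the input. Graphs are finite, simple and undirected. For $\ell\in\mathbb{N}=\{1,2,\dots\}$, an $\ell$-scorpion is a graph $H$ with $|V(H)|\ge \ell+4$ that admits a tuple of pairwise distinct vertices $(b,t_1,\dots,t_\ell,s)\in V(H)^{\ell+2}$ such that, writing $Q=\{b,t_1,\dots,t_\ell,s\}$ and calling the vertices in $V(H)\setminus Q$ legs: (i) $H[Q]$ is an induced path from $b$ to $s$ whose vertices in order are $b,t_1,\dots,t_\ell,s$; (ii) $b$ is adjacent to all legs; (iii) $b$ is the only vertex in $Q$ adjacent to legs. The Exponential-Time Hypothesis (ETH) asserts that there is some $\varepsilon>0$ such that satisfiability of $n$-variable $3$-CNF formulas cannot be decided in time $O(2^{\varepsilon n})$. *)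

theory Defs
  imports Complex_Main "HOL-Library.Landau_Symbols"
begin

section \<open>Algorithms and running time\<close>

text \<open>
  An algorithm is a fixed program for a unit-cost random access machine, presented as a
  structured program instead of with jumps (which changes running times by constant factors only).
  There are directly addressed registers and an indirectly addressed memory, both indexed by and
  holding natural numbers of unbounded size. There is no multiplication instruction: in \<open>t\<close> steps
  numbers grow by at most \<open>t\<close> bits beyond those in the program and the input, so running times
  are polynomially related to those of Turing machines and of word RAMs.
\<close>

type_synonym reg = nat

datatype prog =
    Const reg nat
  | Copy reg reg
  | Add reg reg reg
  | Sub reg reg reg
  | Half reg reg
  | Load reg reg
  | Store reg reg
  | Seq prog prog
  | If reg prog prog
  | While reg prog

type_synonym state = "(reg \<Rightarrow> nat) \<times> (nat \<Rightarrow> nat)"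

text \<open>
  \<open>exec p st t st'\<close>: started in \<open>st\<close>, program \<open>p\<close> halts after exactly \<open>t\<close> steps in \<open>st'\<close>.
  Subtraction is truncated at 0, and a register counts as true iff it is nonzero.
\<close>

inductive exec :: "prog \<Rightarrow> state \<Rightarrow> nat \<Rightarrow> state \<Rightarrow> bool" where
  Const: "exec (Const x c) (r, m) 1 (r(x := c), m)"
| Copy: "exec (Copy x y) (r, m) 1 (r(x := r y), m)"
| Add: "exec (Add x y z) (r, m) 1 (r(x := r y + r z), m)"
| Sub: "exec (Sub x y z) (r, m) 1 (r(x := r y - r z), m)"
| Half: "exec (Half x y) (r, m) 1 (r(x := r y div 2), m)"
| Load: "exec (Load x y) (r, m) 1 (r(x := m (r y)), m)"
| Store: "exec (Store x y) (r, m) 1 (r, m(r x := r y))"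
| Seq: "exec p st t st' \<Longrightarrow> exec q st' u st'' \<Longrightarrow> exec (Seq p q) st (t + u) st''"
| If_true: "fst st x \<noteq> 0 \<Longrightarrow> exec p st t st' \<Longrightarrow> exec (If x p q) st (Suc t) st'"
| If_false: "fst st x = 0 \<Longrightarrow> exec q st t st' \<Longrightarrow> exec (If x p q) st (Suc t) st'"
| While_done: "fst st x = 0 \<Longrightarrow> exec (While x p) st 1 st"
| While_step: "fst st x \<noteq> 0 \<Longrightarrow> exec p st t st' \<Longrightarrow> exec (While x p) st' u st'' \<Longrightarrow>
    exec (While x p) st (Suc (t + u)) st''"

text \<open>The input is written to the initial segment of the memory; the output is read from register 0.\<close>

definition init_state :: "nat list \<Rightarrow> state" where
  "init_state xs = ((\<lambda>_. 0), (\<lambda>a. if a < length xs then xs ! a else 0))"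

definition outputs_within :: "prog \<Rightarrow> nat list \<Rightarrow> nat \<Rightarrow> nat \<Rightarrow> bool" where
  "outputs_within p xs y T \<longleftrightarrow> (\<exists>t st. t \<le> T \<and> exec p (init_state xs) t st \<and> fst st 0 = y)"

text \<open>
  A problem is given by its set \<open>I\<close> of instances, the parameter \<open>sz\<close> in which running time is
  measured, the encoding \<open>enc\<close> of instances and the required output \<open>ans\<close>. It is solvable in time
  \<open>O(f)\<close> if some single program solves all instances with worst-case running time in \<open>O(f)\<close>.
\<close>

definition solvable_in_time ::
  "'i set \<Rightarrow> ('i \<Rightarrow> nat) \<Rightarrow> ('i \<Rightarrow> nat list) \<Rightarrow> ('i \<Rightarrow> nat) \<Rightarrow> (nat \<Rightarrow> real) \<Rightarrow> bool" where
  "solvable_in_time I sz enc ans f \<longleftrightarrow>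
     (\<exists>p T. (\<lambda>n. real (T n)) \<in> O(f) \<and>
        (\<forall>x\<in>I. outputs_within p (enc x) (ans x) (T (sz x))))"

section \<open>The Exponential-Time Hypothesis\<close>

text \<open>
  The literal \<open>(v, True)\<close> is the variable \<open>v\<close> and \<open>(v, False)\<close> its negation. Literals of a clause may
  be repeated, so that triples also cover clauses of one or two literals.
\<close>

type_synonym literal = "nat \<times> bool"
type_synonym clause = "literal \<times> literal \<times> literal"
type_synonym cnf = "nat \<times> clause list"

fun lits :: "clause \<Rightarrow> literal set" where
  "lits (a, b, c) = {a, b, c}"

text \<open>
  A formula \<open>(n, cs)\<close> is a conjunction of clauses over the variables \<open>0, \<dots>, n - 1\<close>. No clause is
  listed twice: otherwise the input length would not be bounded in terms of \<open>n\<close> and no time bound in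
  \<open>n\<close> could be met, for the trivial reason that the input cannot be read.
\<close>

definition cnf3 :: "cnf set" where
  "cnf3 = {(n, cs). distinct cs \<and> (\<forall>c\<in>set cs. \<forall>(v, b)\<in>lits c. v < n)}"

definition satisfiable :: "cnf \<Rightarrow> bool" where
  "satisfiable \<phi> \<longleftrightarrow> (\<exists>\<alpha> :: nat \<Rightarrow> bool. \<forall>c\<in>set (snd \<phi>). \<exists>(v, b)\<in>lits c. \<alpha> v = b)"

fun encode_literal :: "literal \<Rightarrow> nat" where
  "encode_literal (v, b) = 2 * v + of_bool b"

fun encode_clause :: "clause \<Rightarrow> nat list" where
  "encode_clause (a, b, c) = [encode_literal a, encode_literal b, encode_literal c]"

fun encode_cnf :: "cnf \<Rightarrow> nat list" where
  "encode_cnf (n, cs) = n # length cs # concat (map encode_clause cs)"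

definition ETH :: bool where
  "ETH \<longleftrightarrow> (\<exists>\<epsilon> :: real. \<epsilon> > 0 \<and>
     \<not> solvable_in_time cnf3 fst encode_cnf (\<lambda>\<phi>. of_bool (satisfiable \<phi>))
         (\<lambda>n. 2 powr (\<epsilon> * real n)))"

section \<open>Graphs and scorpions\<close>

type_synonym 'a graph = "'a set \<times> 'a set set"

abbreviation verts :: "'a graph \<Rightarrow> 'a set" where "verts \<equiv> fst"
abbreviation edges :: "'a graph \<Rightarrow> 'a set set" where "edges \<equiv> snd"

definition simple_graph :: "'a graph \<Rightarrow> bool" where
  "simple_graph G \<longleftrightarrow> finite (verts G) \<and> (\<forall>e\<in>edges G. e \<subseteq> verts G \<and> card e = 2)"

definition induced_subgraph :: "'a graph \<Rightarrow> 'a set \<Rightarrow> 'a graph" where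
  "induced_subgraph G X = (X, {e \<in> edges G. e \<subseteq> X})"

definition path_graph :: "'a list \<Rightarrow> 'a graph" where
  "path_graph vs = (set vs, {{vs ! i, vs ! Suc i} | i. Suc i < length vs})"

definition scorpion :: "nat \<Rightarrow> 'a graph \<Rightarrow> bool" where
  "scorpion l H \<longleftrightarrow> simple_graph H \<and> card (verts H) \<ge> l + 4 \<and>
     (\<exists>b ts s. length ts = l \<and> distinct (b # ts @ [s]) \<and> set (b # ts @ [s]) \<subseteq> verts H \<and>
        (let Q = set (b # ts @ [s]); legs = verts H - Q in
           induced_subgraph H Q = path_graph (b # ts @ [s]) \<and>
           (\<forall>v\<in>legs. {b, v} \<in> edges H) \<and>
           (\<forall>q\<in>Q - {b}. \<forall>v\<in>legs. {q, v} \<notin> edges H)))"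

definition count_scorpions :: "nat \<Rightarrow> nat \<Rightarrow> 'a graph \<Rightarrow> nat" where
  "count_scorpions k l G =
     card {X. X \<subseteq> verts G \<and> card X = k \<and> scorpion l (induced_subgraph G X)}"

text \<open>Input graphs have vertex set \<open>{0, \<dots>, n - 1}\<close> and are given by \<open>n\<close> and the adjacency matrix.\<close>

definition input_graphs :: "nat graph set" where
  "input_graphs = {G. simple_graph G \<and> (\<exists>n. verts G = {..<n})}"

definition num_verts :: "'a graph \<Rightarrow> nat" where
  "num_verts G = card (verts G)"

definition encode_graph :: "nat graph \<Rightarrow> nat list" where
  "encode_graph G = num_verts G #
     [of_bool ({i, j} \<in> edges G). i \<leftarrow> [0..<num_verts G], j \<leftarrow> [0..<num_verts G]]"

end

theory Submission
  imports Defs "HOL-Real_Asymp.Real_Asymp"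
begin

text \<open>
  A program counting scorpions in time \<open>O(n powr (\<delta> * l))\<close> is used to decide satisfiability in time
  \<open>2 powr (\<epsilon> * n)\<close>. Branching on many clauses with a common part, as in the sparsification lemma,
  leads to few formulas with linearly many clauses each. For such a formula build a graph with a body,
  \<open>l + 1\<close> layers of tail vertices, which are the assignments to one of \<open>l + 1\<close> blocks of variables, and
  \<open>k - l - 2\<close> classes of legs, which choose a literal in every clause of one of \<open>k - l - 2\<close> groups of
  clauses. The body is adjacent to the first layer and to all legs, consecutive layers are completely
  joined, and a leg is adjacent to a tail vertex iff that assignment makes a chosen literal false.
  So scorpions with one vertex of each kind correspond to satisfying assignments with a choice of true
  literals, and inclusion-exclusion over the kinds of vertices extracts their number from the numbers
  of scorpions in induced subgraphs. The graph has only \<open>2 ^ O(n / l)\<close> vertices, which is small enough if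
  \<open>l\<close> is large. For the remaining \<open>l\<close> the running time is sublinear, and the program cannot read its input.
\<close>

section \<open>Reasoning about programs\<close>

text \<open>One \<delta> has to serve all \<open>l\<close>, and it can because \<open>l\<close>
  cancels: time \<open>V powr (\<delta> * l)\<close> on \<open>V = 2 ^ (c * n / l)\<close> vertices
  is \<open>2 ^ (\<delta> * c * n)\<close>. For this a leg may carry only \<open>O(n / l)\<close>
  bits, hence linearly many clauses; with \<open>n ^ 3\<close> clauses the graph would be far too
  large. Writing down the adjacency matrix costs \<open>V ^ 2\<close>, which is affordable only from
  some \<open>l0\<close> on that depends on \<epsilon>. The condition
  \<open>2 * l + 4 \<le> k\<close> is used twice: it yields more than \<open>l\<close> legs, so that
  a vertex with \<open>l\<close> non-neighbours is forced to be the body, and at least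
  \<open>l\<close> groups of clauses. During the branching, complementary literals are unrelated
  atoms; consistency enters only through truth assignments at the leaves. The number of leaves is
  controlled by a potential. Algorithms are concrete programs, so the whole search is one arithmetic
  function: families of clauses are bit masks, the search stack is a single large number, and
  inclusion-exclusion compares two sums because subtraction is truncated.\<close>

definition runs :: "prog \<Rightarrow> state \<Rightarrow> nat \<Rightarrow> (state \<Rightarrow> bool) \<Rightarrow> bool" where
  "runs p st T Q \<longleftrightarrow> (\<exists>t st'. t \<le> T \<and> exec p st t st' \<and> Q st')"

lemma runs_mono: "runs p st T Q \<Longrightarrow> T \<le> T' \<Longrightarrow> (\<And>st'. Q st' \<Longrightarrow> Q' st') \<Longrightarrow> runs p st T' Q'"
  unfolding runs_def by (meson order_trans)

lemma exec_basic:
  "exec (Const x c) st 1 ((fst st)(x := c), snd st)"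
  "exec (Copy x y) st 1 ((fst st)(x := fst st y), snd st)"
  "exec (Add x y z) st 1 ((fst st)(x := fst st y + fst st z), snd st)"
  "exec (Sub x y z) st 1 ((fst st)(x := fst st y - fst st z), snd st)"
  "exec (Half x y) st 1 ((fst st)(x := fst st y div 2), snd st)"
  "exec (Load x y) st 1 ((fst st)(x := snd st (fst st y)), snd st)"
  "exec (Store x y) st 1 (fst st, (snd st)(fst st x := fst st y))"
  by (cases st; auto intro!: exec.intros[simplified])+

lemma runs_basic:
  "1 \<le> T \<Longrightarrow> Q ((fst st)(x := c), snd st) \<Longrightarrow> runs (Const x c) st T Q"
  "1 \<le> T \<Longrightarrow> Q ((fst st)(x := fst st y), snd st) \<Longrightarrow> runs (Copy x y) st T Q"
  "1 \<le> T \<Longrightarrow> Q ((fst st)(x := fst st y + fst st z), snd st) \<Longrightarrow> runs (Add x y z) st T Q"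
  "1 \<le> T \<Longrightarrow> Q ((fst st)(x := fst st y - fst st z), snd st) \<Longrightarrow> runs (Sub x y z) st T Q"
  "1 \<le> T \<Longrightarrow> Q ((fst st)(x := fst st y div 2), snd st) \<Longrightarrow> runs (Half x y) st T Q"
  "1 \<le> T \<Longrightarrow> Q ((fst st)(x := snd st (fst st y)), snd st) \<Longrightarrow> runs (Load x y) st T Q"
  "1 \<le> T \<Longrightarrow> Q (fst st, (snd st)(fst st x := fst st y)) \<Longrightarrow> runs (Store x y) st T Q"
  unfolding runs_def by (blast intro: exec_basic)+

lemma runs_Seq:
  assumes "runs p st T R" "\<And>st'. R st' \<Longrightarrow> runs q st' U Q" "T + U \<le> V"
  shows "runs (Seq p q) st V Q"
proof -
  from assms(1) obtain t st' where 1: "t \<le> T" "exec p st t st'" "R st'"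
    unfolding runs_def by blast
  from assms(2)[OF 1(3)] obtain u st'' where 2: "u \<le> U" "exec q st' u st''" "Q st''"
    unfolding runs_def by blast
  from exec.Seq[OF 1(2) 2(2)] 1 2 assms(3) show ?thesis
    unfolding runs_def by (intro exI[of _ "t + u"] exI[of _ st'']) auto
qed

lemma runs_step:
  "runs q ((fst st)(x := c), snd st) U Q \<Longrightarrow> Suc U \<le> T \<Longrightarrow> runs (Seq (Const x c) q) st T Q"
  "runs q ((fst st)(x := fst st y), snd st) U Q \<Longrightarrow> Suc U \<le> T \<Longrightarrow> runs (Seq (Copy x y) q) st T Q"
  "runs q ((fst st)(x := fst st y + fst st z), snd st) U Q \<Longrightarrow> Suc U \<le> T \<Longrightarrow> runs (Seq (Add x y z) q) st T Q"
  "runs q ((fst st)(x := fst st y - fst st z), snd st) U Q \<Longrightarrow> Suc U \<le> T \<Longrightarrow> runs (Seq (Sub x y z) q) st T Q"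
  "runs q ((fst st)(x := fst st y div 2), snd st) U Q \<Longrightarrow> Suc U \<le> T \<Longrightarrow> runs (Seq (Half x y) q) st T Q"
  "runs q ((fst st)(x := snd st (fst st y)), snd st) U Q \<Longrightarrow> Suc U \<le> T \<Longrightarrow> runs (Seq (Load x y) q) st T Q"
  "runs q (fst st, (snd st)(fst st x := fst st y)) U Q \<Longrightarrow> Suc U \<le> T \<Longrightarrow> runs (Seq (Store x y) q) st T Q"
  by (rule runs_Seq[where T = 1 and U = U and R = "\<lambda>st'. st' = X" for X], rule runs_basic, simp, rule refl, simp, simp)+

lemma runs_If:
  assumes "fst st x \<noteq> 0 \<Longrightarrow> runs p st T Q" "fst st x = 0 \<Longrightarrow> runs q st T Q" "Suc T \<le> V"
  shows "runs (If x p q) st V Q"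
proof (cases "fst st x = 0")
  case True
  with assms(2) obtain t st' where "t \<le> T" "exec q st t st'" "Q st'" unfolding runs_def by blast
  with exec.If_false[of st x q t st' p] True assms(3) show ?thesis unfolding runs_def
    by (intro exI[of _ "Suc t"] exI[of _ st']) auto
next
  case False
  with assms(1) obtain t st' where "t \<le> T" "exec p st t st'" "Q st'" unfolding runs_def by blast
  with exec.If_true[of st x p t st' q] False assms(3) show ?thesis unfolding runs_def
    by (intro exI[of _ "Suc t"] exI[of _ st']) auto
qed

text \<open>The invariant is indexed by the round, so the exact number \<open>n\<close> of rounds
  settles termination. Every round has its own bound \<open>T i\<close>, since the cost of a search
  step will depend on the formula treated in it.\<close>

lemma runs_While:
  assumes "Inv 0 st"
    and "\<And>i st. i < n \<Longrightarrow> Inv i st \<Longrightarrow> fst st x \<noteq> 0 \<and> runs p st (T i) (Inv (Suc i))"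
    and "\<And>st. Inv n st \<Longrightarrow> fst st x = 0 \<and> Q st"
    and "(\<Sum>i<n. T i + 1) + 1 \<le> V"
  shows "runs (While x p) st V Q"
proof -
  \<comment> \<open>Induction on the number \<open>j\<close> of rounds still to come.\<close>
  have "runs (While x p) st ((\<Sum>i\<in>{n - j..<n}. T i + 1) + 1) Q" if "Inv (n - j) st" "j \<le> n" for j st
    using that
  proof (induction j arbitrary: st)
    case 0
    with assms(3)[of st] exec.While_done[of st x p] show ?case
      unfolding runs_def by (intro exI[of _ 1] exI[of _ st]) auto
  next
    case (Suc j)
    let ?i = "n - Suc j"
    have i: "?i < n" "Suc ?i = n - j" using Suc.prems by auto
    from assms(2)[OF i(1) Suc.prems(1)] obtain t st' where
      1: "fst st x \<noteq> 0" "t \<le> T ?i" "exec p st t st'" "Inv (n - j) st'"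
      unfolding runs_def i(2) by blast
    from Suc.IH[OF 1(4)] Suc.prems obtain u st'' where
      2: "u \<le> (\<Sum>i\<in>{n - j..<n}. T i + 1) + 1" "exec (While x p) st' u st''" "Q st''"
      unfolding runs_def by auto
    have "{?i..<n} = insert ?i {n - j..<n}" using i by auto
    hence "(\<Sum>i\<in>{?i..<n}. T i + 1) = T ?i + 1 + (\<Sum>i\<in>{n - j..<n}. T i + 1)"
      using i by simp
    with 1 2 exec.While_step[OF 1(1) 1(3) 2(2)] show ?case
      unfolding runs_def by (intro exI[of _ "Suc (t + u)"] exI[of _ st'']) auto
  qed
  from this[of n st] assms(1,4) show ?thesis
    by (auto simp: lessThan_atLeast0 intro: runs_mono)
qed

text \<open>
  Register 0 is the current generation of the tagged memory described below, and register 1 the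
  length of the input, which is also the address where the tagged memory starts: the cell at
  address \<open>length xs + 2 * a\<close> holds a value and the next one the generation in which it was written.
\<close>

definition ready :: "nat list \<Rightarrow> state \<Rightarrow> bool" where
  "ready xs st \<longleftrightarrow> fst st 1 = length xs \<and> (\<forall>a<length xs. snd st a = xs ! a) \<and>
     (\<forall>a. snd st (length xs + 2 * a + 1) \<le> fst st 0)"

lemma ready_upd [simp]: "2 \<le> x \<Longrightarrow> ready xs (r(x := v), m) \<longleftrightarrow> ready xs (r, m)"
  by (auto simp: ready_def)

text \<open>Register discipline of a stack: variables sit in registers from 2 up to below
  \<open>d\<close>, and everything from \<open>d\<close> on is free for an evaluation and its
  result.\<close>

definition placed :: "nat \<Rightarrow> (nat \<Rightarrow> reg) \<Rightarrow> reg \<Rightarrow> bool" where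
  "placed n \<rho> d \<longleftrightarrow> 2 \<le> d \<and> (\<forall>i<n. 2 \<le> \<rho> i \<and> \<rho> i < d)"

definition holds :: "nat list \<Rightarrow> (nat \<Rightarrow> reg) \<Rightarrow> nat list \<Rightarrow> state \<Rightarrow> bool" where
  "holds xs \<rho> vs st \<longleftrightarrow> ready xs st \<and> (\<forall>i<length vs. fst st (\<rho> i) = vs ! i)"

text \<open>The flag \<open>\<pi>\<close> marks pure evaluations, which leave memory and generation
  alone. Impure ones may overwrite the tagged memory, but \<open>ready\<close> guarantees that the
  input survives.\<close>

definition result :: "bool \<Rightarrow> nat list \<Rightarrow> reg \<Rightarrow> nat \<Rightarrow> state \<Rightarrow> state \<Rightarrow> bool" where
  "result \<pi> xs d v st st' \<longleftrightarrow> ready xs st' \<and> (\<forall>i<d. 0 < i \<longrightarrow> fst st' i = fst st i) \<and> fst st' d = v \<and>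
     (\<pi> \<longrightarrow> fst st' 0 = fst st 0 \<and> snd st' = snd st)"

definition implements ::
  "bool \<Rightarrow> ('s \<Rightarrow> nat list) \<Rightarrow> ('s \<Rightarrow> nat) list \<Rightarrow> ('s \<Rightarrow> nat) \<Rightarrow> ('s \<Rightarrow> nat) \<Rightarrow> (nat \<Rightarrow> reg) \<Rightarrow> reg \<Rightarrow> prog \<Rightarrow> nat \<Rightarrow> bool" where
  "implements \<pi> inp \<Gamma> f \<tau> \<rho> d p c \<longleftrightarrow> (\<forall>s st. holds (inp s) \<rho> (map (\<lambda>g. g s) \<Gamma>) st \<longrightarrow>
     runs p st (c * (\<tau> s + 1)) (result \<pi> (inp s) d (f s) st))"

lemma implementsD:
  "implements \<pi> inp \<Gamma> f \<tau> \<rho> d p c \<Longrightarrow> holds (inp s) \<rho> (map (\<lambda>g. g s) \<Gamma>) st \<Longrightarrow>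
    runs p st (c * (\<tau> s + 1)) (result \<pi> (inp s) d (f s) st)"
  unfolding implements_def by blast

text \<open>
  \<open>s\<close> is the quantity on which all functions depend, \<open>inp s\<close> the input list in memory and \<open>\<Gamma>\<close> the
  list of those functions of \<open>s\<close> whose values are already held in registers.
\<close>

definition computable ::
  "bool \<Rightarrow> ('s \<Rightarrow> nat list) \<Rightarrow> ('s \<Rightarrow> nat) list \<Rightarrow> ('s \<Rightarrow> nat) \<Rightarrow> ('s \<Rightarrow> nat) \<Rightarrow> bool" where
  "computable \<pi> inp \<Gamma> f \<tau> \<longleftrightarrow>
     (\<forall>\<rho> d. placed (length \<Gamma>) \<rho> d \<longrightarrow> (\<exists>p c. implements \<pi> inp \<Gamma> f \<tau> \<rho> d p c))"

lemma computableE: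
  assumes "computable \<pi> inp \<Gamma> f \<tau>" "placed (length \<Gamma>) \<rho> d"
  obtains p c where "implements \<pi> inp \<Gamma> f \<tau> \<rho> d p c"
  using assms unfolding computable_def by meson

lemma placed_mono: "placed n \<rho> d \<Longrightarrow> d \<le> d' \<Longrightarrow> placed n \<rho> d'"
  unfolding placed_def by force

lemma result_holds:
  "result \<pi> xs d v st st' \<Longrightarrow> placed (length vs) \<rho> d \<Longrightarrow> holds xs \<rho> vs st \<Longrightarrow> holds xs \<rho> vs st'"
  unfolding result_def placed_def holds_def by auto

lemma computable_impure:
  assumes "computable \<pi> inp \<Gamma> f \<tau>" shows "computable False inp \<Gamma> f \<tau>"
proof -
  have *: "result False xs d v st st'" if "result \<pi> xs d v st st'" for xs d v st st'
    using that by (simp add: result_def)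
  show ?thesis
    using assms unfolding computable_def implements_def by (blast intro: runs_mono *)
qed

lemma computable_mono:
  assumes "computable \<pi> inp \<Gamma> f \<tau>" "\<And>s. \<tau> s \<le> K * (\<tau>' s + 1)"
  shows "computable \<pi> inp \<Gamma> f \<tau>'"
  unfolding computable_def
proof (intro allI impI)
  fix \<rho> d assume "placed (length \<Gamma>) \<rho> d"
  from computableE[OF assms(1) this] obtain p c where
    "implements \<pi> inp \<Gamma> f \<tau> \<rho> d p c" by blast
  note p = implementsD[OF this]
  have "c * (\<tau> s + 1) \<le> c * (K + 1) * (\<tau>' s + 1)" for s
  proof -
    have "\<tau> s + 1 \<le> (K + 1) * (\<tau>' s + 1)" using assms(2)[of s] by simp
    thus ?thesis by (metis mult.assoc mult_le_mono2)
  qed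
  with p show "\<exists>p c. implements \<pi> inp \<Gamma> f \<tau>' \<rho> d p c" unfolding implements_def
    by (intro exI[of _ p] exI[of _ "c * (K + 1)"]) (blast intro: runs_mono)
qed

section \<open>Closure of computable functions under instructions and control structures\<close>

lemma computable_var:
  assumes "f \<in> set \<Gamma>"
  shows "computable \<pi> inp \<Gamma> f \<tau>"
  unfolding computable_def
proof (intro allI impI)
  fix \<rho> d assume d: "placed (length \<Gamma>) \<rho> d"
  from assms obtain j where j: "j < length \<Gamma>" "\<Gamma> ! j = f" by (auto simp: in_set_conv_nth)
  show "\<exists>p c. implements \<pi> inp \<Gamma> f \<tau> \<rho> d p c" unfolding implements_def
    by (rule exI[of _ "Copy d (\<rho> j)"], rule exI[of _ 1])
      (use d j in \<open>auto simp: placed_def holds_def result_def intro!: runs_basic\<close>)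
qed

lemma computable_const: "computable \<pi> inp \<Gamma> (\<lambda>_. v) \<tau>"
  unfolding computable_def
proof (intro allI impI)
  fix \<rho> d assume d: "placed (length \<Gamma>) \<rho> d"
  show "\<exists>p c. implements \<pi> inp \<Gamma> (\<lambda>_. v) \<tau> \<rho> d p c" unfolding implements_def
    by (rule exI[of _ "Const d v"], rule exI[of _ 1])
      (use d in \<open>auto simp: placed_def holds_def result_def intro!: runs_basic\<close>)
qed

lemma computable_ext:
  assumes "computable \<pi> inp \<Gamma> f \<tau>"
  shows "computable \<pi> (\<lambda>x. inp (fst x)) (map (\<lambda>g x. g (fst x)) \<Gamma> @ \<Delta>) (\<lambda>x. f (fst x)) (\<lambda>x. \<tau> (fst x))"
  unfolding computable_def
proof (intro allI impI)
  let ?\<Gamma> = "map (\<lambda>g x. g (fst x)) \<Gamma> @ \<Delta>"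
  fix \<rho> d assume d: "placed (length ?\<Gamma>) \<rho> d"
  hence "placed (length \<Gamma>) \<rho> d" by (simp add: placed_def)
  from computableE[OF assms this] obtain p c where
    "implements \<pi> inp \<Gamma> f \<tau> \<rho> d p c" by blast
  note p = implementsD[OF this]
  have "holds (inp (fst x)) \<rho> (map (\<lambda>g. g (fst x)) \<Gamma>) st" 
    if "holds (inp (fst x)) \<rho> (map (\<lambda>g. g x) ?\<Gamma>) st" for x st
    using that by (auto simp: holds_def nth_append)
  with p show "\<exists>p c. implements \<pi> (\<lambda>x. inp (fst x)) ?\<Gamma> (\<lambda>x. f (fst x)) (\<lambda>x. \<tau> (fst x)) \<rho> d p c" unfolding implements_def
    by blast
qed

text \<open>The second operand is evaluated from \<open>Suc d\<close> on, so that the first one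
  survives in \<open>d\<close>.\<close>

lemma computable_op:
  assumes f: "computable \<pi> inp \<Gamma> f \<tau>" and g: "computable \<pi> inp \<Gamma> g \<tau>"
    and opr: "\<And>x y z st. exec (opr x y z) st 1 ((fst st)(x := h (fst st y) (fst st z)), snd st)"
  shows "computable \<pi> inp \<Gamma> (\<lambda>s. h (f s) (g s)) \<tau>"
  unfolding computable_def
proof (intro allI impI)
  fix \<rho> d assume d: "placed (length \<Gamma>) \<rho> d"
  from computableE[OF f d] obtain p c where
    "implements \<pi> inp \<Gamma> f \<tau> \<rho> d p c" by blast
  note p = implementsD[OF this]
  from computableE[OF g placed_mono[OF d, of "Suc d"]] obtain q c' where
    "implements \<pi> inp \<Gamma> g \<tau> \<rho> (Suc d) q c'" by auto
  note q = implementsD[OF this]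
  have "runs (Seq p (Seq q (opr d d (Suc d)))) st ((c + c' + 1) * (\<tau> s + 1)) (result \<pi> (inp s) d (h (f s) (g s)) st)"
    if st: "holds (inp s) \<rho> (map (\<lambda>g. g s) \<Gamma>) st" for s st
  proof (rule runs_Seq[OF p[OF st] runs_Seq[OF q _ order_refl]])
    fix st1 st2
    assume 1: "result \<pi> (inp s) d (f s) st st1"
    from result_holds[OF 1 _ st] d show "holds (inp s) \<rho> (map (\<lambda>g. g s) \<Gamma>) st1" by simp
    assume 2: "result \<pi> (inp s) (Suc d) (g s) st1 st2"
    have "2 \<le> d" using d by (simp add: placed_def)
    with 1 2 have "result \<pi> (inp s) d (h (f s) (g s)) st ((fst st2)(d := h (fst st2 d) (fst st2 (Suc d))), snd st2)"
      by (auto simp: result_def)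
    with opr[of d d "Suc d" st2] show "runs (opr d d (Suc d)) st2 1 (result \<pi> (inp s) d (h (f s) (g s)) st)"
      unfolding runs_def by blast
  qed (simp_all add: algebra_simps)
  thus "\<exists>p c. implements \<pi> inp \<Gamma> (\<lambda>s. h (f s) (g s)) \<tau> \<rho> d p c" unfolding implements_def by blast
qed

lemma computable_add: "computable \<pi> inp \<Gamma> f \<tau> \<Longrightarrow> computable \<pi> inp \<Gamma> g \<tau> \<Longrightarrow> computable \<pi> inp \<Gamma> (\<lambda>s. f s + g s) \<tau>"
  by (rule computable_op[where opr = Add and h = "(+)"]) (assumption, assumption, rule exec_basic)
lemma computable_sub: "computable \<pi> inp \<Gamma> f \<tau> \<Longrightarrow> computable \<pi> inp \<Gamma> g \<tau> \<Longrightarrow> computable \<pi> inp \<Gamma> (\<lambda>s. f s - g s) \<tau>"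
  by (rule computable_op[where opr = Sub and h = "(-)"]) (assumption, assumption, rule exec_basic)
lemma computable_half: "computable \<pi> inp \<Gamma> f \<tau> \<Longrightarrow> computable \<pi> inp \<Gamma> (\<lambda>s. f s div 2) \<tau>"
  by (rule computable_op[where opr = "\<lambda>x y z. Half x y" and h = "\<lambda>x y. x div 2"]) (assumption, assumption, rule exec_basic)

text \<open>Only the branch taken is charged. In the search this keeps the counting program off the
  bill of inner nodes, for which no sparsity bound holds.\<close>

lemma computable_if:
  assumes b: "computable \<pi> inp \<Gamma> (\<lambda>s. of_bool (P s)) \<tau>" and f: "computable \<pi> inp \<Gamma> f \<tau>1" and g: "computable \<pi> inp \<Gamma> g \<tau>2"
  shows "computable \<pi> inp \<Gamma> (\<lambda>s. if P s then f s else g s) (\<lambda>s. \<tau> s + (if P s then \<tau>1 s else \<tau>2 s))"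
  unfolding computable_def
proof (intro allI impI)
  fix \<rho> d assume d: "placed (length \<Gamma>) \<rho> d"
  from computableE[OF b d] obtain p c where
    "implements \<pi> inp \<Gamma> (\<lambda>s. of_bool (P s)) \<tau> \<rho> d p c" by blast
  note p = implementsD[OF this]
  from computableE[OF f d] obtain q1 c1 where
    "implements \<pi> inp \<Gamma> f \<tau>1 \<rho> d q1 c1" by blast
  note q1 = implementsD[OF this]
  from computableE[OF g d] obtain q2 c2 where
    "implements \<pi> inp \<Gamma> g \<tau>2 \<rho> d q2 c2" by blast
  note q2 = implementsD[OF this]
  let ?\<tau> = "\<lambda>s. \<tau> s + (if P s then \<tau>1 s else \<tau>2 s)"
  have "runs (Seq p (If d q1 q2)) st ((c + c1 + c2 + 1) * (?\<tau> s + 1)) (result \<pi> (inp s) d (if P s then f s else g s) st)"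
    if st: "holds (inp s) \<rho> (map (\<lambda>g. g s) \<Gamma>) st" for s st
  proof (rule runs_Seq[OF p[OF st] runs_If[where T = "if P s then c1 * (\<tau>1 s + 1) else c2 * (\<tau>2 s + 1)", OF _ _ order_refl]])
    fix st1
    assume 1: "result \<pi> (inp s) d (of_bool (P s)) st st1"
    from result_holds[OF 1 _ st] d have st1: "holds (inp s) \<rho> (map (\<lambda>g. g s) \<Gamma>) st1" by simp
    let ?T = "if P s then c1 * (\<tau>1 s + 1) else c2 * (\<tau>2 s + 1)"
    { assume "fst st1 d \<noteq> 0"
      with 1 have "P s" by (auto simp: result_def)
      with 1 show "runs q1 st1 ?T (result \<pi> (inp s) d (if P s then f s else g s) st)"
        by (intro runs_mono[OF q1[OF st1]]) (auto simp: result_def) }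
    { assume "fst st1 d = 0"
      with 1 have "\<not> P s" by (auto simp: result_def split: if_splits)
      with 1 show "runs q2 st1 ?T (result \<pi> (inp s) d (if P s then f s else g s) st)"
        by (intro runs_mono[OF q2[OF st1]]) (auto simp: result_def) }
  next
    let ?T = "if P s then c1 * (\<tau>1 s + 1) else c2 * (\<tau>2 s + 1)"
    have "c * (\<tau> s + 1) \<le> c * (?\<tau> s + 1)" by (intro mult_le_mono) auto
    moreover have "?T \<le> (if P s then c1 else c2) * (?\<tau> s + 1)"
      by (cases "P s") (simp_all add: add_mult_distrib2)
    moreover have "(if P s then c1 else c2) * (?\<tau> s + 1) \<le> (c1 + c2) * (?\<tau> s + 1)" by (intro mult_le_mono) auto
    ultimately have "c * (\<tau> s + 1) + Suc ?T \<le> c * (?\<tau> s + 1) + (c1 + c2) * (?\<tau> s + 1) + (?\<tau> s + 1)"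
      by linarith
    also have "\<dots> = (c + c1 + c2 + 1) * (?\<tau> s + 1)" by (simp add: algebra_simps)
    finally show "c * (\<tau> s + 1) + Suc ?T \<le> (c + c1 + c2 + 1) * (?\<tau> s + 1)" .
  qed
  thus "\<exists>p c. implements \<pi> inp \<Gamma> (\<lambda>s. if P s then f s else g s) ?\<tau> \<rho> d p c" unfolding implements_def by blast
qed

text \<open>The range check keeps the read out of the tagged memory, which begins directly behind
  the input.\<close>

lemma computable_input:
  assumes f: "computable \<pi> inp \<Gamma> f \<tau>"
  shows "computable \<pi> inp \<Gamma> (\<lambda>s. if f s < length (inp s) then inp s ! f s else 0) \<tau>"
  unfolding computable_def
proof (intro allI impI)
  fix \<rho> d assume d: "placed (length \<Gamma>) \<rho> d"
  from computableE[OF f d] obtain p c where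
    "implements \<pi> inp \<Gamma> f \<tau> \<rho> d p c" by blast
  note p = implementsD[OF this]
  let ?v = "\<lambda>s. if f s < length (inp s) then inp s ! f s else 0"
  have "runs (Seq p (Seq (Sub (Suc d) 1 d) (If (Suc d) (Load d d) (Const d 0)))) st 
      ((c + 3) * (\<tau> s + 1)) (result \<pi> (inp s) d (?v s) st)"
    if st: "holds (inp s) \<rho> (map (\<lambda>g. g s) \<Gamma>) st" for s st
  proof (rule runs_Seq[OF p[OF st] runs_Seq[where T = 1 and U = 2]])
    fix st1
    assume 1: "result \<pi> (inp s) d (f s) st st1"
    have d2: "2 \<le> d" using d by (simp add: placed_def)
    show "runs (Sub (Suc d) 1 d) st1 1 (\<lambda>st2. result \<pi> (inp s) d (f s) st st2 \<and> fst st2 (Suc d) = length (inp s) - f s)"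
      using 1 d2 by (auto intro!: runs_basic simp: result_def ready_def)
    fix st2 assume 2: "result \<pi> (inp s) d (f s) st st2 \<and> fst st2 (Suc d) = length (inp s) - f s"
    show "runs (If (Suc d) (Load d d) (Const d 0)) st2 2 (result \<pi> (inp s) d (?v s) st)"
      by (rule runs_If[where T = 1]; (rule runs_basic)?) 
         (use 2 d2 in \<open>auto simp: result_def ready_def\<close>)
  qed (auto simp add: algebra_simps)
  thus "\<exists>p c. implements \<pi> inp \<Gamma> ?v \<tau> \<rho> d p c" unfolding implements_def by blast
qed

text \<open>Register \<open>d\<close> counts down the remaining rounds, \<open>d + 1\<close> holds
  the index and \<open>d + 2\<close> the accumulator; the body sees the last two as extra variables.
  Its cost is summed along the accumulator values that really occur.\<close>

lemma computable_iter:
  assumes b: "computable \<pi> inp \<Gamma> b \<tau>" and e: "computable \<pi> inp \<Gamma> e \<tau>"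
    and h: "computable \<pi> (\<lambda>x. inp (fst x)) (map (\<lambda>g x. g (fst x)) \<Gamma> @ [\<lambda>x. fst (snd x), \<lambda>x. snd (snd x)])
              (\<lambda>x. h (fst x) (fst (snd x)) (snd (snd x))) \<tau>h"
  shows "computable \<pi> inp \<Gamma> (\<lambda>s. rec_nat (e s) (h s) (b s))
           (\<lambda>s. \<tau> s + (\<Sum>i<b s. \<tau>h (s, i, rec_nat (e s) (h s) i) + 1))"
  unfolding computable_def
proof (intro allI impI)
  fix \<rho> d assume d: "placed (length \<Gamma>) \<rho> d"
  hence d2: "2 \<le> d" by (simp add: placed_def)
  let ?n = "length \<Gamma>"
  let ?\<rho> = "\<lambda>i. if i < ?n then \<rho> i else d + 1 + (i - ?n)"
  let ?\<Gamma> = "map (\<lambda>g x. g (fst x)) \<Gamma> @ [\<lambda>x. fst (snd x), \<lambda>x. snd (snd x)]"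
  let ?\<tau> = "\<lambda>s. \<tau> s + (\<Sum>i<b s. \<tau>h (s, i, rec_nat (e s) (h s) i) + 1)"
  from computableE[OF b d] obtain p c where
    "implements \<pi> inp \<Gamma> b \<tau> \<rho> d p c" by blast
  note p = implementsD[OF this]
  from computableE[OF e placed_mono[OF d, of "d + 2"]] obtain q c' where
    "implements \<pi> inp \<Gamma> e \<tau> \<rho> (d + 2) q c'" by auto
  note q = implementsD[OF this]
  have "placed (length ?\<Gamma>) ?\<rho> (d + 3)"
    using d by (auto simp: placed_def less_Suc_eq_le)
  from computableE[OF h this] obtain u cu where
    "implements \<pi> (\<lambda>x. inp (fst x)) ?\<Gamma> (\<lambda>x. h (fst x) (fst (snd x)) (snd (snd x))) \<tau>h ?\<rho> (d + 3) u cu" by blast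
  note u = implementsD[OF this]
  let ?body = "Seq u (Seq (Copy (d + 2) (d + 3)) (Seq (Const (d + 4) 1) (Seq (Add (d + 1) (d + 1) (d + 4)) (Sub d d (d + 4)))))"
  let ?prog = "Seq p (Seq q (Seq (Const (d + 1) 0) (Seq (While d ?body) (Copy d (d + 2)))))"
  have "runs ?prog st ((c + c' + cu + 9) * (?\<tau> s + 1)) (result \<pi> (inp s) d (rec_nat (e s) (h s) (b s)) st)"
    if st: "holds (inp s) \<rho> (map (\<lambda>g. g s) \<Gamma>) st" for s st
  proof -
    define r where "r = rec_nat (e s) (h s)"
    define I where "I = (\<lambda>i st1. ready (inp s) st1 \<and> (\<forall>j<d. 0 < j \<longrightarrow> fst st1 j = fst st j) \<and> 
      fst st1 d = b s - i \<and> fst st1 (d + 1) = i \<and> fst st1 (d + 2) = r i \<and>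
      (\<pi> \<longrightarrow> fst st1 0 = fst st 0 \<and> snd st1 = snd st))"
    define S where "S = (\<Sum>i<b s. (cu * (\<tau>h (s, i, r i) + 1) + 4) + 1)"
    have body: "runs ?body st4 (cu * (\<tau>h (s, i, r i) + 1) + 4) (I (Suc i))"
      if i: "i < b s" and 4: "I i st4" for i st4
    proof -
      have "fst st4 (?\<rho> j) = map (\<lambda>g. g (s, i, r i)) ?\<Gamma> ! j" if j: "j < length ?\<Gamma>" for j
      proof -
        consider "j < ?n" | "j = ?n" | "j = ?n + 1"
          using j unfolding length_append length_map list.size by linarith
        thus ?thesis
        proof cases
          case 1
          with d have "\<rho> j < d" "0 < \<rho> j" by (auto simp: placed_def)
          with 1 4 st show ?thesis by (auto simp: nth_append holds_def I_def)
        qed (use 4 in \<open>auto simp: nth_append I_def\<close>)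
      qed
      hence "holds (inp (fst (s, i, r i))) ?\<rho> (map (\<lambda>g. g (s, i, r i)) ?\<Gamma>) st4"
        using 4 by (simp add: holds_def I_def)
      from u[OF this] have ru: "runs u st4 (cu * (\<tau>h (s, i, r i) + 1)) (result \<pi> (inp s) (d + 3) (r (Suc i)) st4)"
        by (simp add: r_def)
      show ?thesis
      proof (rule runs_Seq[OF ru _ order_refl])
        fix st5 assume 5: "result \<pi> (inp s) (d + 3) (r (Suc i)) st4 st5"
        show "runs (Seq (Copy (d + 2) (d + 3)) (Seq (Const (d + 4) 1) (Seq (Add (d + 1) (d + 1) (d + 4)) (Sub d d (d + 4))))) st5 4 (I (Suc i))"
          apply (rule runs_step[where U = 3], rule runs_step[where U = 2], rule runs_step[where U = 1], rule runs_basic)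
          using 4 5 d2 by (auto simp: result_def I_def)
      qed
    qed
    have W: "runs (While d ?body) st3 (S + 1) (I (b s))" if "I 0 st3" for st3
    proof (rule runs_While[where Inv = I and n = "b s" and T = "\<lambda>i. cu * (\<tau>h (s, i, r i) + 1) + 4"])
      fix i st4 assume i: "i < b s" and 4: "I i st4"
      from 4 i have "fst st4 d \<noteq> 0" by (simp add: I_def)
      with body[OF i 4] show "fst st4 d \<noteq> 0 \<and> runs ?body st4 (cu * (\<tau>h (s, i, r i) + 1) + 4) (I (Suc i))"
        by blast
    next
      fix st4 assume "I (b s) st4"
      thus "fst st4 d = 0 \<and> I (b s) st4" by (simp add: I_def)
    qed (use that S_def in simp_all)
    have C: "runs (Seq (While d ?body) (Copy d (d + 2))) st3 (S + 2) (result \<pi> (inp s) d (r (b s)) st)"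
      if "I 0 st3" for st3
      by (rule runs_Seq[OF W[OF that]], rule runs_basic)
        (use d2 in \<open>auto simp: result_def I_def\<close>)
    have C': "runs (Seq (Const (d + 1) 0) (Seq (While d ?body) (Copy d (d + 2)))) st2 (S + 3) (result \<pi> (inp s) d (r (b s)) st)"
      if "result \<pi> (inp s) d (b s) st st1" "result \<pi> (inp s) (d + 2) (e s) st1 st2" for st1 st2
      by (rule runs_Seq[where T = 1 and R = "I 0", OF _ C], rule runs_basic)
        (use d2 that in \<open>auto simp: result_def I_def r_def\<close>)
    have C'': "runs (Seq q (Seq (Const (d + 1) 0) (Seq (While d ?body) (Copy d (d + 2))))) st1 
      (c' * (\<tau> s + 1) + (S + 3)) (result \<pi> (inp s) d (r (b s)) st)"
      if "result \<pi> (inp s) d (b s) st st1" for st1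
    proof (rule runs_Seq[OF q C' order_refl])
      show "holds (inp s) \<rho> (map (\<lambda>g. g s) \<Gamma>) st1" using result_holds[OF that _ st] d by simp
    qed (use that in simp_all)
    have "S \<le> (\<Sum>i<b s. (cu + 5) * (\<tau>h (s, i, r i) + 1))"
      unfolding S_def by (intro sum_mono) auto
    also have "\<dots> = (cu + 5) * (\<Sum>i<b s. (\<tau>h (s, i, r i) + 1))"
      by (rule sum_distrib_left[symmetric])
    also have "\<dots> \<le> (cu + 5) * (?\<tau> s + 1)" by (intro mult_le_mono) (auto simp: r_def)
    finally have A: "S \<le> (cu + 5) * (?\<tau> s + 1)" .
    define U where "U = ?\<tau> s + 1"
    have "c * (\<tau> s + 1) \<le> c * U" "c' * (\<tau> s + 1) \<le> c' * U" "1 \<le> U"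
      unfolding U_def by ((intro mult_le_mono)?; simp)+
    moreover note A[folded U_def]
    moreover have "c * U + c' * U + (cu + 5) * U + 3 * U \<le> (c + c' + cu + 9) * U"
      by (simp only: add_mult_distrib)
    ultimately have "c * (\<tau> s + 1) + (c' * (\<tau> s + 1) + (S + 3)) \<le> (c + c' + cu + 9) * U" by linarith
    thus ?thesis
      unfolding r_def[symmetric] U_def by (intro runs_Seq[OF p[OF st] C'']) (simp_all only: r_def)
  qed
  thus "\<exists>p c. implements \<pi> inp \<Gamma> (\<lambda>s. rec_nat (e s) (h s) (b s)) ?\<tau> \<rho> d p c" unfolding implements_def by blast
qed

section \<open>Calling a program as a subroutine\<close>

fun reg_bound :: "prog \<Rightarrow> nat" where
  "reg_bound (Const x c) = Suc x"
| "reg_bound (Copy x y) = Suc (max x y)"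
| "reg_bound (Add x y z) = Suc (max x (max y z))"
| "reg_bound (Sub x y z) = Suc (max x (max y z))"
| "reg_bound (Half x y) = Suc (max x y)"
| "reg_bound (Load x y) = Suc (max x y)"
| "reg_bound (Store x y) = Suc (max x y)"
| "reg_bound (Seq p q) = max (reg_bound p) (reg_bound q)"
| "reg_bound (If x p q) = max (Suc x) (max (reg_bound p) (reg_bound q))"
| "reg_bound (While x p) = max (Suc x) (reg_bound p)"

text \<open>
  A simulated program keeps its registers above \<open>e + 1\<close> and its memory in the tagged memory. Cells
  that were not written in the current generation read as 0, so that raising the generation
  clears the memory between two calls.
\<close>

fun relocate :: "reg \<Rightarrow> prog \<Rightarrow> prog" where
  "relocate e (Const x c) = Const (e + 2 + x) c"
| "relocate e (Copy x y) = Copy (e + 2 + x) (e + 2 + y)"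
| "relocate e (Add x y z) = Add (e + 2 + x) (e + 2 + y) (e + 2 + z)"
| "relocate e (Sub x y z) = Sub (e + 2 + x) (e + 2 + y) (e + 2 + z)"
| "relocate e (Half x y) = Half (e + 2 + x) (e + 2 + y)"
| "relocate e (Load x y) =
     Seq (Add e 1 (e + 2 + y)) (Seq (Add e e (e + 2 + y)) (Seq (Const (e + 1) 1)
       (Seq (Add (e + 1) e (e + 1)) (Seq (Load (e + 1) (e + 1)) (Seq (Sub (e + 1) 0 (e + 1))
         (If (e + 1) (Const (e + 2 + x) 0) (Load (e + 2 + x) e)))))))"
| "relocate e (Store x y) =
     Seq (Add e 1 (e + 2 + x)) (Seq (Add e e (e + 2 + x)) (Seq (Store e (e + 2 + y))
       (Seq (Const (e + 1) 1) (Seq (Add e e (e + 1)) (Store e 0)))))"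
| "relocate e (Seq p q) = Seq (relocate e p) (relocate e q)"
| "relocate e (If x p q) = If (e + 2 + x) (relocate e p) (relocate e q)"
| "relocate e (While x p) = While (e + 2 + x) (relocate e p)"

definition tagged :: "nat list \<Rightarrow> state \<Rightarrow> nat \<Rightarrow> nat" where
  "tagged xs st a = (if snd st (length xs + 2 * a + 1) = fst st 0 then snd st (length xs + 2 * a) else 0)"

definition simulates :: "nat list \<Rightarrow> nat \<Rightarrow> reg \<Rightarrow> state \<Rightarrow> state \<Rightarrow> bool" where
  "simulates xs R e st st' \<longleftrightarrow>
     ready xs st' \<and> (\<forall>x<R. fst st' (e + 2 + x) = fst st x) \<and> (\<forall>a. tagged xs st' a = snd st a)"

lemma runs_While_step:
  assumes "fst st x \<noteq> 0" "runs p st T R" "\<And>st'. R st' \<Longrightarrow> runs (While x p) st' U Q" "Suc (T + U) \<le> V"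
  shows "runs (While x p) st V Q"
proof -
  from assms(2) obtain t st' where 1: "t \<le> T" "exec p st t st'" "R st'"
    unfolding runs_def by blast
  from assms(3)[OF 1(3)] obtain u st'' where 2: "u \<le> U" "exec (While x p) st' u st''" "Q st''"
    unfolding runs_def by blast
  from exec.While_step[OF assms(1) 1(2) 2(2)] 1 2 assms(4) show ?thesis
    unfolding runs_def by (intro exI[of _ "Suc (t + u)"] exI[of _ st'']) auto
qed

lemma runs_While_done: "fst st x = 0 \<Longrightarrow> Q st \<Longrightarrow> 1 \<le> V \<Longrightarrow> runs (While x p) st V Q"
  unfolding runs_def by (blast intro: exec.While_done)

lemma tagged_upd [simp]: "0 < x \<Longrightarrow> tagged xs (r(x := v), m) = tagged xs (r, m)"
  by (auto simp: tagged_def)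

lemma ready_store:
  assumes "ready xs (r, m)"
  shows "ready xs (r, m(length xs + 2 * a := v, Suc (length xs + 2 * a) := r 0))"
  using assms unfolding ready_def by auto

lemma tagged_store:
  "tagged xs (r, m(length xs + 2 * a := v, Suc (length xs + 2 * a) := r 0)) = (tagged xs (r, m))(a := v)"
  by (auto simp: tagged_def fun_eq_iff)

text \<open>The factor 8 is the cost of a simulated \<open>Load\<close>: six instructions for
  address and tag, the conditional, and the final load or zero.\<close>

lemma runs_relocate:
  assumes "exec p st t st1" "reg_bound p \<le> R" "simulates xs R e st st'" "2 \<le> e"
  shows "runs (relocate e p) st' (8 * t) (\<lambda>st1'. simulates xs R e st1 st1' \<and> (\<forall>i<e. fst st1' i = fst st' i))"
  using assms
proof (induction arbitrary: st' rule: exec.induct)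
  case (Load x y r m)
  obtain r' m' where st': "st' = (r', m')" by fastforce
  define l where "l = length xs"
  from Load.prems have rd: "r' 1 = l" "\<And>a. m' (Suc (l + 2 * a)) \<le> r' 0" "\<And>x. x < R \<Longrightarrow> r' (Suc (Suc (e + x))) = r x" 
     "\<And>a. tagged xs (r', m') a = m a"
    by (auto simp: simulates_def st' ready_def l_def)
  have xy: "x < R" "y < R" using Load.prems by auto
  have S: "simulates xs R e (r(x := m (r y)), m) (r'(e := u, Suc e := v, Suc (Suc (e + x)) := m (r y)), m')" for u v
    using Load.prems(2,3) rd(3) xy by (auto simp: simulates_def st')
  define a where "a = l + 2 * r y"
  have a: "l + r y + r y = a" by (simp add: a_def)
  \<comment> \<open>\<open>ready\<close> bounds all tags by the generation in register 0, so the
    truncated difference vanishes exactly for cells written in the current generation.\<close>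
  have ty: "m (r y) = (if r' 0 - m' (Suc a) = 0 then m' a else 0)"
    using rd(4)[of "r y"] rd(2)[of "r y"] by (auto simp: tagged_def l_def a_def)
  have "l = r' (Suc 0)" using rd by simp
  note rd3 = rd(3)[OF xy(1)] rd(3)[OF xy(2)] this[symmetric]
  have u: "r'(e := u, e := v) = r'(e := v)" for u v by simp
  have v: "r'(e := u, Suc e := v, Suc e := w) = r'(e := u, Suc e := w)" for u v w by simp
  define v where "v = r' 0 - m' (Suc a)"
  have "runs (If (e + 1) (Const (e + 2 + x) 0) (Load (e + 2 + x) e)) (r'(e := a, Suc e := v), m') 2
     (\<lambda>st1'. simulates xs R e (r(x := m (r y)), m) st1' \<and> (\<forall>i<e. fst st1' i = r' i))"
  proof (rule runs_If[where T = 1])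
    assume "fst (r'(e := a, Suc e := v), m') (e + 1) \<noteq> 0"
    hence "m (r y) = 0" using ty by (simp add: v_def)
    thus "runs (Const (e + 2 + x) 0) (r'(e := a, Suc e := v), m') 1
     (\<lambda>st1'. simulates xs R e (r(x := m (r y)), m) st1' \<and> (\<forall>i<e. fst st1' i = r' i))"
      using S[of a v] by (intro runs_basic) auto
  next
    assume "fst (r'(e := a, Suc e := v), m') (e + 1) = 0"
    hence "m (r y) = m' a" using ty by (simp add: v_def)
    thus "runs (Load (e + 2 + x) e) (r'(e := a, Suc e := v), m') 1
     (\<lambda>st1'. simulates xs R e (r(x := m (r y)), m) st1' \<and> (\<forall>i<e. fst st1' i = r' i))"
      using S[of a v] by (intro runs_basic) auto
  qed simp
  note fin = this
  show ?case unfolding relocate.simps st'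
    apply (rule runs_step[where U = 7])
     apply (rule runs_step[where U = 6])
      apply (rule runs_step[where U = 5])
       apply (rule runs_step[where U = 4])
        apply (rule runs_step[where U = 3])
         apply (rule runs_step[where U = 2])
    using Load.prems(3) fin
          apply (simp add: a rd3 u v v_def)
         apply simp_all
    done
next
  case (Store x y r m)
  obtain r' m' where st': "st' = (r', m')" by fastforce
  define l where "l = length xs"
  have xy: "x < R" "y < R" using Store.prems by auto
  from Store.prems have rd: "r' 1 = l" "\<And>x. x < R \<Longrightarrow> r' (Suc (Suc (e + x))) = r x" 
     and rdy: "ready xs (r', m')" and tg: "tagged xs (r', m') = m"
    by (auto simp: simulates_def st' ready_def l_def)
  note S = ready_store[OF rdy, of "r x" "r y"] tagged_store[of xs r' m' "r x" "r y"]
  define a where "a = l + 2 * r x"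
  have a: "l + r x + r x = a" by (simp add: a_def)
  have "simulates xs R e (r, m(r x := r y)) (r'(e := Suc a, Suc e := 1), m'(a := r y, Suc a := r' 0))"
    using S rd xy Store.prems unfolding simulates_def tg l_def[symmetric] a_def[symmetric]
    by (auto simp: fun_eq_iff tagged_def)
  moreover have "(r'(e := a, Suc e := Suc 0, e := Suc a)) = r'(e := Suc a, Suc e := 1)" by auto
  ultimately have fin: "simulates xs R e (r, m(r x := r y)) (r'(e := a, Suc e := Suc 0, e := Suc a), m'(a := r y, Suc a := r' 0))" by simp
  show ?case unfolding relocate.simps st'
    apply (rule runs_step[where U = 5])
     apply (rule runs_step[where U = 4])
      apply (rule runs_step[where U = 3])
       apply (rule runs_step[where U = 2])
        apply (rule runs_step[where U = 1])
         apply (rule runs_basic)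
          apply simp
    using Store.prems(3) xy rd fin
         apply (simp add: a fun_upd_twist)
        apply simp_all
    done
next
  case (Seq p st t st1 q u st2)
  show ?case unfolding relocate.simps
  proof (rule runs_Seq[OF Seq.IH(1)])
    fix st1' assume 1: "simulates xs R e st1 st1' \<and> (\<forall>i<e. fst st1' i = fst st' i)"
    with Seq.prems show "runs (relocate e q) st1' (8 * u) (\<lambda>st2'. simulates xs R e st2 st2' \<and> (\<forall>i<e. fst st2' i = fst st' i))"
      by (intro runs_mono[OF Seq.IH(2)]) auto
  qed (use Seq.prems in auto)
next
  case (If_true st x p t st1 q)
  have "fst st' (e + 2 + x) \<noteq> 0" using If_true.prems If_true.hyps by (auto simp: simulates_def)
  thus ?case unfolding relocate.simps
    by (intro runs_If[where T = "8 * t"] If_true.IH) (use If_true.prems in auto)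
next
  case (If_false st x q t st1 p)
  have "fst st' (e + 2 + x) = 0" using If_false.prems If_false.hyps by (auto simp: simulates_def)
  thus ?case unfolding relocate.simps
    by (intro runs_If[where T = "8 * t"] If_false.IH) (use If_false.prems in auto)
next
  case (While_done st x p)
  then show ?case
    by (auto intro!: runs_While_done simp: simulates_def)
next
  case (While_step st x p t st1 u st2)
  have x: "fst st' (e + 2 + x) \<noteq> 0" using While_step.prems While_step.hyps by (auto simp: simulates_def)
  show ?case unfolding relocate.simps
  proof (rule runs_While_step[OF x While_step.IH(1)])
    fix st1' assume 1: "simulates xs R e st1 st1' \<and> (\<forall>i<e. fst st1' i = fst st' i)"
    with While_step.prems show "runs (While (e + 2 + x) (relocate e p)) st1' (8 * u) (\<lambda>st2'. simulates xs R e st2 st2' \<and> (\<forall>i<e. fst st2' i = fst st' i))"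
      by (intro runs_mono[OF While_step.IH(2)[unfolded relocate.simps]]) auto
  qed (use While_step.prems in auto)
qed (auto intro!: runs_basic simp: simulates_def)

text \<open>Registers carry no generation tag and are therefore cleared one by one before a
  call.\<close>

fun zeros :: "reg \<Rightarrow> nat \<Rightarrow> prog" where
  "zeros d 0 = Const d 0"
| "zeros d (Suc n) = Seq (zeros d n) (Const (d + Suc n) 0)"

lemma runs_zeros:
  assumes "2 \<le> d"
  shows "runs (zeros d n) st (n + 1) (\<lambda>st'. (\<forall>i. fst st' i = (if d \<le> i \<and> i \<le> d + n then 0 else fst st i)) \<and> snd st' = snd st)"
proof (induction n)
  case 0
  show ?case by (auto intro!: runs_basic)
next
  case (Suc n)
  show ?case unfolding zeros.simps
    by (rule runs_Seq[OF Suc.IH, where U = 1], rule runs_basic) auto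
qed

text \<open>The input of \<open>P\<close> is produced entry by entry and written straight into the
  tagged memory. \<open>elem\<close> has to be pure because it runs between those writes. The second
  extra variable is kept at 0, which gives \<open>elem\<close> the context of a loop body.\<close>

lemma computable_call:
  assumes P: "\<And>s. outputs_within P (map (elem s) [0..<len s]) (g s) (T s)"
    and len: "computable False inp \<Gamma> len \<tau>"
    and elem: "computable True (\<lambda>x. inp (fst x)) (map (\<lambda>g x. g (fst x)) \<Gamma> @ [\<lambda>x. fst (snd x), \<lambda>x. snd (snd x)])
              (\<lambda>x. elem (fst x) (fst (snd x))) \<tau>e"
  shows "computable False inp \<Gamma> g (\<lambda>s. \<tau> s + (\<Sum>i<len s. \<tau>e (s, i, 0) + 1) + T s)"
  unfolding computable_def
proof (intro allI impI)
  fix \<rho> d assume d: "placed (length \<Gamma>) \<rho> d"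
  hence d2: "2 \<le> d" by (simp add: placed_def)
  let ?n = "length \<Gamma>"
  let ?\<rho> = "\<lambda>i. if i < ?n then \<rho> i else d + 1 + (i - ?n)"
  let ?\<Gamma> = "map (\<lambda>g x. g (fst x)) \<Gamma> @ [\<lambda>x. fst (snd x), \<lambda>x. snd (snd x)]"
  let ?\<tau> = "\<lambda>s. \<tau> s + (\<Sum>i<len s. \<tau>e (s, i, 0) + 1) + T s"
  from computableE[OF len d] obtain p c where
    "implements False inp \<Gamma> len \<tau> \<rho> d p c" by blast
  note p = implementsD[OF this]
  have "placed (length ?\<Gamma>) ?\<rho> (d + 3)"
    using d by (auto simp: placed_def less_Suc_eq_le)
  from computableE[OF elem this] obtain u cu where
    "implements True (\<lambda>x. inp (fst x)) ?\<Gamma> (\<lambda>x. elem (fst x) (fst (snd x))) \<tau>e ?\<rho> (d + 3) u cu" by blast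
  note u = implementsD[OF this]
  \<comment> \<open>At least 1, so register 0, which carries the output of \<open>P\<close>, is
    among the simulated registers.\<close>
  define R where "R = reg_bound P + 1"
  define store where "store = Seq (Add (d + 4) 1 (d + 1)) (Seq (Add (d + 4) (d + 4) (d + 1)) (Seq (Store (d + 4) (d + 3))
    (Seq (Const (d + 5) 1) (Seq (Add (d + 4) (d + 4) (d + 5)) (Seq (Store (d + 4) 0) 
    (Seq (Add (d + 1) (d + 1) (d + 5)) (Sub d d (d + 5))))))))"
  define call where "call = Seq (zeros (d + 3) R) (Seq (relocate (d + 1) P) (Copy d (d + 3)))"
  define main where "main = Seq (While d (Seq u store)) call"
  define prog where "prog = Seq p (Seq (Const (d + 1) 1) (Seq (Add 0 0 (d + 1)) (Seq (Const (d + 1) 0) (Seq (Const (d + 2) 0) main))))"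
  have "runs prog st ((c + cu + R + 40) * (?\<tau> s + 1)) (result False (inp s) d (g s) st)"
    if st: "holds (inp s) \<rho> (map (\<lambda>g. g s) \<Gamma>) st" for s st
  proof -
    define I where "I = (\<lambda>i st1. ready (inp s) st1 \<and> (\<forall>j<d. 0 < j \<longrightarrow> fst st1 j = fst st j) \<and> 
      fst st1 d = len s - i \<and> fst st1 (d + 1) = i \<and> fst st1 (d + 2) = 0 \<and>
      tagged (inp s) st1 = (\<lambda>a. if a < i then elem s a else 0))"
    define S where "S = (\<Sum>i<len s. (cu * (\<tau>e (s, i, 0) + 1) + 8) + 1)"
    have body: "runs (Seq u store) st4 (cu * (\<tau>e (s, i, 0) + 1) + 8) (I (Suc i))"
      if i: "i < len s" and 4: "I i st4" for i st4
    proof -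
      have "fst st4 (?\<rho> j) = map (\<lambda>g. g (s, i, 0)) ?\<Gamma> ! j" if j: "j < length ?\<Gamma>" for j
      proof -
        consider "j < ?n" | "j = ?n" | "j = ?n + 1"
          using j unfolding length_append length_map list.size by linarith
        thus ?thesis
        proof cases
          case 1
          with d have "\<rho> j < d" "0 < \<rho> j" by (auto simp: placed_def)
          with 1 4 st show ?thesis by (auto simp: nth_append holds_def I_def)
        qed (use 4 in \<open>auto simp: nth_append I_def\<close>)
      qed
      hence "holds (inp (fst (s, i, 0::nat))) ?\<rho> (map (\<lambda>g. g (s, i, 0)) ?\<Gamma>) st4"
        using 4 by (simp add: holds_def I_def)
      from u[OF this] have ru: "runs u st4 (cu * (\<tau>e (s, i, 0) + 1)) (result True (inp s) (d + 3) (elem s i) st4)"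
        by simp
      show ?thesis
      proof (rule runs_Seq[OF ru _ order_refl])
        fix st5 assume 5: "result True (inp s) (d + 3) (elem s i) st4 st5"
        obtain r m where st5: "st5 = (r, m)" by fastforce
        define a where "a = length (inp s) + 2 * i"
        have "ready (inp s) (r, m)" using 5 unfolding result_def st5 by blast
        note S = ready_store[OF this, of i "elem s i", folded a_def] tagged_store[of "inp s" r m i "elem s i", folded a_def]
        have "tagged (inp s) (r, m) = tagged (inp s) st4"
          using 5 by (auto simp: fun_eq_iff tagged_def result_def st5)
        with 4 have tg: "tagged (inp s) (r, m) = (\<lambda>a. if a < i then elem s a else 0)"
          by (simp add: I_def)
        have 6: "r (d + 3) = elem s i" "r 1 = length (inp s)" "r d = len s - i" "r (d + 1) = i"  "r (d + 2) = 0" "\<forall>j<d. 0 < j \<longrightarrow> r j = fst st j"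
          using 4 5 d2 by (auto simp: result_def st5 ready_def I_def)
        have a: "length (inp s) + i + i = a" by (simp add: a_def)
        have "I (Suc i) (r(d + 4 := Suc a, d + 5 := 1, d + 1 := i + 1, d := len s - i - 1), 
            m(a := elem s i, Suc a := r 0))"
          unfolding I_def using d2 S 6 tg by (auto simp: fun_eq_iff)
        moreover have "r(d + 4 := length (inp s) + i, d + 4 := a, d + 5 := 1, d + 4 := Suc a, d + 1 := i + 1, d := len s - i - 1)
          = r(d + 4 := Suc a, d + 5 := 1, d + 1 := i + 1, d := len s - i - 1)" by (auto simp: fun_eq_iff)
        ultimately have fin: "I (Suc i) (r(d + 4 := length (inp s) + i, d + 4 := a, d + 5 := 1, d + 4 := Suc a, d + 1 := i + 1, d := len s - i - 1),
          m(a := elem s i, Suc a := r 0))" by simp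
        show "runs store st5 8 (I (Suc i))" unfolding store_def st5
          apply (rule runs_step[where U = 7])
           apply (rule runs_step[where U = 6])
            apply (rule runs_step[where U = 5])
             apply (rule runs_step[where U = 4])
              apply (rule runs_step[where U = 3])
               apply (rule runs_step[where U = 2])
                apply (rule runs_step[where U = 1])
                 apply (rule runs_basic)
                  apply simp
          using fin d2 6 a apply simp
                apply simp_all
          done
      qed
    qed
    have W: "runs (While d (Seq u store)) st3 (S + 1) (I (len s))" if "I 0 st3" for st3
    proof (rule runs_While[where Inv = I and n = "len s" and T = "\<lambda>i. cu * (\<tau>e (s, i, 0) + 1) + 8"])
      fix i st4 assume i: "i < len s" and 4: "I i st4"
      from 4 i have "fst st4 d \<noteq> 0" by (simp add: I_def)
      with body[OF i 4] show "fst st4 d \<noteq> 0 \<and> runs (Seq u store) st4 (cu * (\<tau>e (s, i, 0) + 1) + 8) (I (Suc i))"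
        by blast
    next
      fix st4 assume "I (len s) st4"
      thus "fst st4 d = 0 \<and> I (len s) st4" by (simp add: I_def)
    qed (use that S_def in simp_all)
    have C: "runs call st4 (R + 8 * T s + 2) (result False (inp s) d (g s) st)" if "I (len s) st4" for st4
    proof -
      let ?xs = "map (elem s) [0..<len s]"
      from P[of s] obtain t st1 where t: "t \<le> T s" "exec P (init_state ?xs) t st1" "fst st1 0 = g s"
        unfolding outputs_within_def by blast
      show ?thesis unfolding call_def
      proof (rule runs_Seq[OF runs_zeros])
        fix st5 assume 5: "(\<forall>i. fst st5 i = (if d + 3 \<le> i \<and> i \<le> d + 3 + R then 0 else fst st4 i)) \<and> snd st5 = snd st4"
        have "tagged (inp s) st5 = tagged (inp s) st4" using 5 by (auto simp: tagged_def fun_eq_iff)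
        hence "simulates (inp s) R (d + 1) (init_state ?xs) st5"
          using that 5 d2 unfolding simulates_def I_def by (auto simp: init_state_def ready_def)
        from runs_relocate[OF t(2) _ this] have 
          "runs (relocate (d + 1) P) st5 (8 * t) (\<lambda>st1'. simulates (inp s) R (d + 1) st1 st1' \<and> (\<forall>i<d + 1. fst st1' i = fst st5 i))"
          using d2 by (simp add: R_def)
        thus "runs (Seq (relocate (d + 1) P) (Copy d (d + 3))) st5 (8 * T s + 1) (result False (inp s) d (g s) st)"
        proof (rule runs_Seq)
          fix st6 assume 6: "simulates (inp s) R (d + 1) st1 st6 \<and> (\<forall>i<d + 1. fst st6 i = fst st5 i)"
          hence "fst st6 (d + 3) = g s"
            using t(3) by (auto simp: simulates_def R_def numeral_3_eq_3 dest!: spec[of _ 0])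
          thus "runs (Copy d (d + 3)) st6 1 (result False (inp s) d (g s) st)"
            using 6 5 d2 that by (intro runs_basic) (auto simp: result_def simulates_def I_def)
        qed (use t(1) in simp)
      qed (use d2 in simp_all)
    qed
    have C1: "runs main st3 (S + R + 8 * T s + 3) (result False (inp s) d (g s) st)"
      if "I 0 st3" for st3 unfolding main_def
      by (rule runs_Seq[OF W[OF that] C]) simp_all
    have C2: "runs (Seq (Const (d + 1) 1) (Seq (Add 0 0 (d + 1)) (Seq (Const (d + 1) 0) (Seq (Const (d + 2) 0) main)))) st1 
       (S + R + 8 * T s + 7) (result False (inp s) d (g s) st)"
      if 1: "result False (inp s) d (len s) st st1" for st1
    proof -
      obtain r m where st1: "st1 = (r, m)" by fastforce
      \<comment> \<open>Every tag is at most the old generation, so after raising it no cell is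
        current and the simulated memory reads as all zeros.\<close>
      have I: "I 0 (r(d + 1 := 1, 0 := r 0 + 1, d + 1 := 0, d + 2 := 0), m)"
        using 1 d2 unfolding I_def by (auto simp: result_def st1 ready_def tagged_def fun_eq_iff le_Suc_eq) (metis Suc_n_not_le_n)
      show ?thesis unfolding st1
          apply (rule runs_step[where U = "S + R + 8 * T s + 6"])
           apply (rule runs_step[where U = "S + R + 8 * T s + 5"])
            apply (rule runs_step[where U = "S + R + 8 * T s + 4"])
             apply (rule runs_step[where U = "S + R + 8 * T s + 3"])
        using C1[OF I] d2 by auto
    qed
    have "S \<le> (\<Sum>i<len s. (cu + 9) * (\<tau>e (s, i, 0) + 1))"
      unfolding S_def by (intro sum_mono) auto
    also have "\<dots> = (cu + 9) * (\<Sum>i<len s. (\<tau>e (s, i, 0) + 1))"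
      by (rule sum_distrib_left[symmetric])
    also have "\<dots> \<le> (cu + 9) * (?\<tau> s + 1)" by (intro mult_le_mono) auto
    finally have A: "S \<le> (cu + 9) * (?\<tau> s + 1)" .
    define U where "U = ?\<tau> s + 1"
    have "c * (\<tau> s + 1) \<le> c * U" "1 \<le> U" "T s \<le> U"
      unfolding U_def by ((intro mult_le_mono)?; simp)+
    moreover note A[folded U_def]
    moreover have "R \<le> R * U" using \<open>1 \<le> U\<close> by simp
    moreover have "c * U + (cu + 9) * U + R * U + 8 * U + 7 * U \<le> (c + cu + R + 40) * U"
      by (simp only: add_mult_distrib)
    ultimately have "c * (\<tau> s + 1) + (S + R + 8 * T s + 7) \<le> (c + cu + R + 40) * U" by linarith
    thus ?thesis
      unfolding prog_def U_def by (intro runs_Seq[OF p[OF st] C2])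
  qed
  thus "\<exists>p c. implements False inp \<Gamma> g ?\<tau> \<rho> d p c" unfolding implements_def by blast
qed

section \<open>Polynomial-time functions\<close>

lemma length_concat_encode_clause: "length (concat (map encode_clause cs)) = 3 * length cs"
  by (induction cs) (auto simp: split: prod.splits)

lemma length_encode_cnf: "length (encode_cnf \<phi>) = 2 + 3 * length (snd \<phi>)"
  by (cases \<phi>) (simp add: length_concat_encode_clause)

text \<open>\<open>ready\<close> wants the input length in register 1, but a program is started with
  the input alone. The prologue reads the number \<open>m\<close> of clauses from address 1 and
  forms \<open>2 + 3 * m\<close>. Generation 0 fits the zeros behind the input.\<close>

lemma outputs_computable:
  assumes "computable \<pi> encode_cnf [] f \<tau>"
  shows "\<exists>p c. \<forall>\<phi>. outputs_within p (encode_cnf \<phi>) (f \<phi>) (c * (\<tau> \<phi> + 1))"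
proof -
  have "placed (length ([] :: (cnf \<Rightarrow> nat) list)) id 2" by (simp add: placed_def)
  from computableE[OF assms this] obtain p c where "implements \<pi> encode_cnf [] f \<tau> id 2 p c" by blast
  note p = implementsD[OF this]
  define prog where "prog = Seq (Const 2 1) (Seq (Load 3 2) (Seq (Add 1 3 3) (Seq (Add 1 1 3) (Seq (Add 1 1 2) (Seq (Add 1 1 2) (Seq p (Copy 0 2)))))))"
  have "runs prog (init_state (encode_cnf \<phi>)) ((c + 7) * (\<tau> \<phi> + 1)) (\<lambda>st. fst st 0 = f \<phi>)" for \<phi>
  proof -
    define m where "m = (snd (init_state (encode_cnf \<phi>)))"
    have m1: "m (Suc 0) = length (snd \<phi>)"
      by (cases \<phi>) (simp add: m_def init_state_def)
    have "ready (encode_cnf \<phi>) ((\<lambda>_. 0)(2 := 1, 3 := length (snd \<phi>), 1 := 2 + 3 * length (snd \<phi>)), m)"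
      by (auto simp: ready_def m_def init_state_def length_encode_cnf)
    hence 1: "runs p ((\<lambda>_. 0)(2 := 1, 3 := length (snd \<phi>), 1 := 2 + 3 * length (snd \<phi>)), m) (c * (\<tau> \<phi> + 1)) (\<lambda>st. fst st 2 = f \<phi>)"
      by (intro runs_mono[OF p]) (auto simp: holds_def result_def)
    have 2: "runs (Seq p (Copy 0 2)) ((\<lambda>_. 0)(2 := 1, 3 := length (snd \<phi>), 1 := 2 + 3 * length (snd \<phi>)), m) (c * (\<tau> \<phi> + 1) + 1) (\<lambda>st. fst st 0 = f \<phi>)"
      by (rule runs_Seq[OF 1, where U = 1]) (auto intro!: runs_basic)
    define T where "T = c * (\<tau> \<phi> + 1) + 1"
    have i: "init_state (encode_cnf \<phi>) = ((\<lambda>_. 0), m)" by (simp add: m_def init_state_def)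
    show ?thesis unfolding prog_def i
      apply (rule runs_step[where U = "T + 5"])
       apply (rule runs_step[where U = "T + 4"])
        apply (rule runs_step[where U = "T + 3"])
         apply (rule runs_step[where U = "T + 2"])
          apply (rule runs_step[where U = "T + 1"])
           apply (rule runs_step[where U = "T"])
      using 2 apply (simp add: T_def m1 fun_upd_twist algebra_simps numeral_2_eq_2 numeral_3_eq_3)
           apply (simp_all add: T_def)
      done
  qed
  thus ?thesis unfolding runs_def outputs_within_def by blast
qed

text \<open>
  A context consists of the input list, the size in which polynomial bounds are measured and the
  functions held in registers. \<open>pt C f\<close> states that \<open>f\<close> is computable in polynomial time, \<open>ptb C P\<close>
  the same for a predicate, and \<open>pb C f\<close> that the values of \<open>f\<close> are polynomially bounded, as
  required for the number of iterations of a loop. In the body of a loop the state is extended by the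
  loop index and an accumulator; the index is added to the size in \<open>loop C\<close> but not in \<open>loop0 C\<close>,
  which is meant for loops that run longer than polynomially.
\<close>

type_synonym 's ctx = "('s \<Rightarrow> nat list) \<times> ('s \<Rightarrow> nat) \<times> ('s \<Rightarrow> nat) list"

abbreviation "computable_in \<pi> C \<equiv> computable \<pi> (fst C) (snd (snd C))"
abbreviation "poly_in C e \<equiv> \<lambda>s. (fst (snd C) s + 2) ^ e"

definition pt :: "'s ctx \<Rightarrow> ('s \<Rightarrow> nat) \<Rightarrow> bool" where
  "pt C f \<longleftrightarrow> (\<exists>e. computable_in True C f (poly_in C e))"

definition pb :: "'s ctx \<Rightarrow> ('s \<Rightarrow> nat) \<Rightarrow> bool" where
  "pb C b \<longleftrightarrow> (\<exists>e. \<forall>s. b s \<le> (fst (snd C) s + 2) ^ e)"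

definition loop :: "'s ctx \<Rightarrow> ('s \<times> nat \<times> nat) ctx" where
  "loop C = (\<lambda>x. fst C (fst x), \<lambda>x. fst (snd C) (fst x) + fst (snd x),
     map (\<lambda>g x. g (fst x)) (snd (snd C)) @ [\<lambda>x. fst (snd x), \<lambda>x. snd (snd x)])"

definition loop0 :: "'s ctx \<Rightarrow> ('s \<times> nat \<times> nat) ctx" where
  "loop0 C = (\<lambda>x. fst C (fst x), \<lambda>x. fst (snd C) (fst x),
     map (\<lambda>g x. g (fst x)) (snd (snd C)) @ [\<lambda>x. fst (snd x), \<lambda>x. snd (snd x)])"

text \<open>The base of \<open>poly_in\<close> is at least 2, so constants and sums are absorbed by
  a larger exponent.\<close>

lemma pb_const: "pb C (\<lambda>_. v)"
proof -
  have "v \<le> (n + 2) ^ v" for n :: nat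
  proof -
    have "v \<le> 2 ^ v" by (simp add: less_imp_le)
    also have "\<dots> \<le> (n + 2) ^ v" by (rule power_mono) auto
    finally show ?thesis .
  qed
  thus ?thesis unfolding pb_def by blast
qed

lemma power_add_bound: "a \<le> (n + 2) ^ e1 \<Longrightarrow> b \<le> (n + 2) ^ e2 \<Longrightarrow> a + b \<le> (n + 2) ^ (e1 + e2 + 1)" for n :: nat
proof -
  assume "a \<le> (n + 2) ^ e1" "b \<le> (n + 2) ^ e2"
  moreover have "(n + 2) ^ e1 \<le> (n + 2) ^ (e1 + e2)" "(n + 2) ^ e2 \<le> (n + 2) ^ (e1 + e2)"
    by (rule power_increasing; simp)+
  moreover have "2 * (n + 2) ^ (e1 + e2) \<le> (n + 2) ^ (e1 + e2 + 1)" by simp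
  ultimately show ?thesis by linarith
qed

lemma pb_add: "pb C f \<Longrightarrow> pb C g \<Longrightarrow> pb C (\<lambda>s. f s + g s)"
  unfolding pb_def by (meson power_add_bound)

lemma pb_mult: "pb C f \<Longrightarrow> pb C g \<Longrightarrow> pb C (\<lambda>s. f s * g s)"
  unfolding pb_def
proof (elim exE)
  fix e1 e2 assume "\<forall>s. f s \<le> poly_in C e1 s" "\<forall>s. g s \<le> poly_in C e2 s"
  thus "\<exists>e. \<forall>s. f s * g s \<le> poly_in C e s"
    by (intro exI[of _ "e1 + e2"]) (simp add: power_add mult_le_mono)
qed

lemma pb_mono: "pb C g \<Longrightarrow> (\<And>s. f s \<le> g s) \<Longrightarrow> pb C f"
  unfolding pb_def by (meson order_trans)

lemma pb_power: "pb C f \<Longrightarrow> pb C (\<lambda>s. f s ^ n)"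
  by (induction n) (auto intro: pb_const pb_mult)

lemma pb_loop: "pb C f \<Longrightarrow> pb (loop C) (\<lambda>x. f (fst x))"
proof -
  assume "pb C f"
  then obtain e where e: "\<And>s. f s \<le> poly_in C e s" by (auto simp: pb_def)
  have "f (fst x) \<le> (fst (snd (loop C)) x + 2) ^ e" for x
  proof -
    have "(fst (snd C) (fst x) + 2) ^ e \<le> (fst (snd (loop C)) x + 2) ^ e"
      by (rule power_mono) (auto simp: loop_def)
    with e[of "fst x"] show ?thesis by simp
  qed
  thus ?thesis unfolding pb_def by blast
qed

lemma pb_loop0: "pb C f \<Longrightarrow> pb (loop0 C) (\<lambda>x. f (fst x))"
  unfolding pb_def loop0_def by auto

lemma pb_index: "pb (loop C) (\<lambda>x. fst (snd x))"
  unfolding pb_def loop_def by (intro exI[of _ 1]) simp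

lemma pt_computable: 
  assumes "pt C f" 
  obtains e where "computable_in True C f (poly_in C e)"
  using assms unfolding pt_def by blast

lemma pt_raise:
  assumes "computable_in True C f (poly_in C e)" "e \<le> e'"
  shows "computable_in True C f (poly_in C e')"
proof (rule computable_mono[OF assms(1), where K = 1])
  fix s 
  have "poly_in C e s \<le> poly_in C e' s" by (rule power_increasing) (use assms in auto)
  thus "poly_in C e s \<le> 1 * (poly_in C e' s + 1)" unfolding mult_1 by linarith
qed

lemma pt_computable2:
  assumes "pt C f" "pt C g"
  obtains e where "computable_in True C f (poly_in C e)"
    "computable_in True C g (poly_in C e)"
proof -
  from assms obtain e1 e2 where "computable_in True C f (poly_in C e1)"
    "computable_in True C g (poly_in C e2)" unfolding pt_def by blast
  from this[THEN pt_raise, of "max e1 e2"] show ?thesis by (intro that) auto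
qed

lemma ptI: 
  assumes "computable_in True C f \<tau>" "pb C \<tau>"
  shows "pt C f"
proof -
  from assms(2) obtain e where e: "\<And>s. \<tau> s \<le> poly_in C e s" by (auto simp: pb_def)
  have "\<tau> s \<le> 1 * (poly_in C e s + 1)" for s using e[of s] by simp
  from computable_mono[OF assms(1) this] show ?thesis unfolding pt_def by blast
qed

lemma pb_self: "pb C (fst (snd C))"
  unfolding pb_def by (intro exI[of _ 1]) simp

lemma pb_selfp: "pb C (poly_in C e)"
  by (intro pb_power pb_add pb_self pb_const)

lemma pt_const: "pt C (\<lambda>_. v)" unfolding pt_def by (blast intro: computable_const)

lemma pt_add: "pt C f \<Longrightarrow> pt C g \<Longrightarrow> pt C (\<lambda>s. f s + g s)"
  by (rule pt_computable2, assumption, assumption) (auto simp: pt_def intro: computable_add)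

lemma pt_sub: "pt C f \<Longrightarrow> pt C g \<Longrightarrow> pt C (\<lambda>s. f s - g s)"
  by (rule pt_computable2, assumption, assumption) (auto simp: pt_def intro: computable_sub)

lemma pt_half: "pt C f \<Longrightarrow> pt C (\<lambda>s. f s div 2)"
  by (auto simp: pt_def intro: computable_half)

lemma pt_input: "pt C f \<Longrightarrow> pt C (\<lambda>s. if f s < length (fst C s) then fst C s ! f s else 0)"
  by (auto simp: pt_def intro: computable_input)

lemma pt_if:
  assumes "pt C (\<lambda>s. of_bool (P s))" "pt C f" "pt C g"
  shows "pt C (\<lambda>s. if P s then f s else g s)"
proof -
  from assms obtain e1 e2 e3 where 
    "computable_in True C (\<lambda>s. of_bool (P s)) (poly_in C e1)"
    "computable_in True C f (poly_in C e2)"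
    "computable_in True C g (poly_in C e3)"
    unfolding pt_def by blast
  from computable_if[OF this] show ?thesis
  proof (rule ptI)
    have "pb C (\<lambda>s. poly_in C e1 s + (poly_in C e2 s + poly_in C e3 s))"
      by (intro pb_add pb_selfp)
    thus "pb C (\<lambda>s. poly_in C e1 s + (if P s then poly_in C e2 s else poly_in C e3 s))"
      by (rule pb_mono) auto
  qed
qed

lemma pt_loop: "pt C f \<Longrightarrow> pt (loop C) (\<lambda>x. f (fst x))"
proof (elim pt_computable)
  fix e assume "computable_in True C f (poly_in C e)"
  from computable_ext[OF this] pb_loop[OF pb_selfp] show ?thesis
    by (intro ptI) (auto simp: loop_def)
qed

lemma pt_loop0: "pt C f \<Longrightarrow> pt (loop0 C) (\<lambda>x. f (fst x))"
proof (elim pt_computable)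
  fix e assume "computable_in True C f (poly_in C e)"
  from computable_ext[OF this] pb_loop0[OF pb_selfp] show ?thesis
    by (intro ptI) (auto simp: loop0_def)
qed

lemma pt_var: "f \<in> set (snd (snd C)) \<Longrightarrow> pt C f"
  unfolding pt_def by (blast intro: computable_var)

lemma pt_index: "pt (loop C) (\<lambda>x. fst (snd x))" "pt (loop0 C) (\<lambda>x. fst (snd x))"
  by (rule pt_var; simp add: loop_def loop0_def)+

lemma pt_acc: "pt (loop C) (\<lambda>x. snd (snd x))" "pt (loop0 C) (\<lambda>x. snd (snd x))"
  by (rule pt_var; simp add: loop_def loop0_def)+

text \<open>The cost of the body depends on the size and the index but not on the accumulator, so
  polynomially many rounds stay polynomial however large the accumulated numbers become. Unit cost
  is what makes this possible.\<close>

lemma pt_iter: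
  assumes "pt C b" "pb C b" "pt C e" "pt (loop C) (\<lambda>x. h (fst x) (fst (snd x)) (snd (snd x)))"
  shows "pt C (\<lambda>s. rec_nat (e s) (h s) (b s))"
proof -
  let ?N = "fst (snd C)"
  from pt_computable2[OF assms(1,3)] obtain e1 where 
    1: "computable_in True C b (\<lambda>s. (?N s + 2) ^ e1)" "computable_in True C e (\<lambda>s. (?N s + 2) ^ e1)"
    by blast
  from pt_computable[OF assms(4)] obtain e2 where
    2: "computable True (fst (loop C)) (snd (snd (loop C))) (\<lambda>x. h (fst x) (fst (snd x)) (snd (snd x))) (\<lambda>s. (fst (snd (loop C)) s + 2) ^ e2)"
    by blast
  have "computable_in True C (\<lambda>s. rec_nat (e s) (h s) (b s))
    (\<lambda>s. (?N s + 2) ^ e1 + (\<Sum>i<b s. (?N s + i + 2) ^ e2 + 1))"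
    using computable_iter[OF 1 2[unfolded loop_def fst_conv snd_conv]] by simp
  thus ?thesis
  proof (rule ptI)
    have "pb C (\<lambda>s. (?N s + 2) ^ e1 + b s * ((?N s + b s + 2) ^ e2 + 1))"
      by (intro pb_add pb_mult pb_power pb_self pb_const assms)
    thus "pb C (\<lambda>s. (?N s + 2) ^ e1 + (\<Sum>i<b s. (?N s + i + 2) ^ e2 + 1))"
    proof (rule pb_mono)
      fix s
      have "(\<Sum>i<b s. (?N s + i + 2) ^ e2 + 1) \<le> (\<Sum>i<b s. (?N s + b s + 2) ^ e2 + 1)"
        by (intro sum_mono add_right_mono power_mono) auto
      thus "(?N s + 2) ^ e1 + (\<Sum>i<b s. (?N s + i + 2) ^ e2 + 1) \<le> (?N s + 2) ^ e1 + b s * ((?N s + b s + 2) ^ e2 + 1)"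
        by simp
    qed
  qed
qed

section \<open>Polynomial-time predicates, counting and arithmetic\<close>

definition ptb :: "'s ctx \<Rightarrow> ('s \<Rightarrow> bool) \<Rightarrow> bool" where
  "ptb C P \<longleftrightarrow> pt C (\<lambda>s. of_bool (P s))"

lemma pt_cong: "pt C f \<Longrightarrow> (\<And>s. f s = g s) \<Longrightarrow> pt C g"
proof -
  assume "pt C f" "\<And>s. f s = g s"
  moreover from this have "f = g" by blast
  ultimately show ?thesis by simp
qed

text \<open>Truncated subtraction decides the order: \<open>f s - g s\<close> is 0 iff
  \<open>f s \<le> g s\<close>. The connectives below are arithmetic on 0 and 1 in the same
  style.\<close>

lemma ptb_le: "pt C f \<Longrightarrow> pt C g \<Longrightarrow> ptb C (\<lambda>s. f s \<le> g s)"
  unfolding ptb_def by (rule pt_cong[of _ "\<lambda>s. 1 - (f s - g s)"]) (auto intro!: pt_sub pt_const)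

lemma ptb_not: "ptb C P \<Longrightarrow> ptb C (\<lambda>s. \<not> P s)"
  unfolding ptb_def by (rule pt_cong[of _ "\<lambda>s. 1 - of_bool (P s)"]) (auto intro!: pt_sub pt_const)

lemma ptb_conj: "ptb C P \<Longrightarrow> ptb C Q \<Longrightarrow> ptb C (\<lambda>s. P s \<and> Q s)"
  unfolding ptb_def by (rule pt_cong[of _ "\<lambda>s. of_bool (P s) + of_bool (Q s) - 1"]) (auto intro!: pt_sub pt_add pt_const)

lemma ptb_disj: "ptb C P \<Longrightarrow> ptb C Q \<Longrightarrow> ptb C (\<lambda>s. P s \<or> Q s)"
  unfolding ptb_def by (rule pt_cong[of _ "\<lambda>s. 1 - (1 - (of_bool (P s) + of_bool (Q s)))"]) (auto intro!: pt_sub pt_add pt_const)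

lemma ptb_imp:
  assumes "ptb C P" "ptb C Q"
  shows "ptb C (\<lambda>s. P s \<longrightarrow> Q s)"
  unfolding imp_conv_disj by (intro ptb_disj ptb_not assms)

lemma ptb_less: 
  assumes "pt C f" "pt C g"
  shows "ptb C (\<lambda>s. f s < g s)"
  unfolding not_le[symmetric] by (intro ptb_not ptb_le assms)

lemma ptb_eq:
  assumes "pt C f" "pt C g"
  shows "ptb C (\<lambda>s. f s = g s)"
  unfolding order_eq_iff by (intro ptb_conj ptb_le assms)

lemma ptb_const: "ptb C (\<lambda>_. P)"
  unfolding ptb_def by (rule pt_const)

lemma pt_If: "ptb C P \<Longrightarrow> pt C f \<Longrightarrow> pt C g \<Longrightarrow> pt C (\<lambda>s. if P s then f s else g s)"
  unfolding ptb_def by (rule pt_if)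

lemma pt_of_bool: "ptb C P \<Longrightarrow> pt C (\<lambda>s. of_bool (P s))"
  unfolding ptb_def .

lemma ptb_If: "ptb C P \<Longrightarrow> ptb C Q \<Longrightarrow> ptb C R \<Longrightarrow> ptb C (\<lambda>s. if P s then Q s else R s)"
  unfolding if_bool_eq_conj by (intro ptb_conj ptb_imp ptb_not)

lemma pt_sum:
  assumes "pt C b" "pb C b" "pt (loop C) (\<lambda>x. f (fst x) (fst (snd x)))"
  shows "pt C (\<lambda>s. \<Sum>i<b s. f s i)"
proof -
  have "rec_nat 0 (\<lambda>i a. a + f s i) n = (\<Sum>i<n. f s i)" for s n
    by (induction n) auto
  thus ?thesis
    using pt_iter[OF assms(1,2) pt_const[of C 0], of "\<lambda>s i a. a + f s i"] pt_add[OF pt_acc(1) assms(3)] by simp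
qed

lemma ptb_bex:
  assumes "pt C b" "pb C b" "ptb (loop C) (\<lambda>x. P (fst x) (fst (snd x)))"
  shows "ptb C (\<lambda>s. \<exists>i<b s. P s i)"
proof -
  have "ptb C (\<lambda>s. 0 < (\<Sum>i<b s. of_bool (P s i) :: nat))"
    by (intro ptb_less pt_const pt_sum assms(1,2)) (use assms(3) in \<open>simp add: ptb_def\<close>)
  moreover have "0 < (\<Sum>i<n. of_bool (Q i) :: nat) \<longleftrightarrow> (\<exists>i<n. Q i)" for n and Q :: "nat \<Rightarrow> bool"
    by (induction n) (auto simp: less_Suc_eq)
  ultimately show ?thesis by (simp only:)
qed

lemma ptb_ball:
  assumes "pt C b" "pb C b" "ptb (loop C) (\<lambda>x. P (fst x) (fst (snd x)))"
  shows "ptb C (\<lambda>s. \<forall>i<b s. P s i)"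
  using ptb_not[OF ptb_bex[OF assms(1,2) ptb_not[OF assms(3)]]] by simp

lemma pt_card:
  assumes "pt C b" "pb C b" "ptb (loop C) (\<lambda>x. P (fst x) (fst (snd x)))"
  shows "pt C (\<lambda>s. card {i. i < b s \<and> P s i})"
proof -
  have "card {i. i < n \<and> Q i} = (\<Sum>i<n. of_bool (Q i))" for n and Q :: "nat \<Rightarrow> bool"
  proof -
    have "(\<Sum>i<n. of_bool (Q i) :: nat) = card ({..<n} \<inter> {i. Q i})" by (simp add: sum_of_bool_eq)
    moreover have "{..<n} \<inter> {i. Q i} = {i. i < n \<and> Q i}" by auto
    ultimately show ?thesis by simp
  qed
  thus ?thesis using pt_sum[OF assms(1,2), of "\<lambda>s i. of_bool (P s i)"] assms(3) by (simp add: ptb_def)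
qed

text \<open>The machine cannot multiply, so this is repeated addition: the first factor is
  polynomially bounded while the second may be huge.\<close>

lemma pt_mult:
  assumes "pt C f" "pb C f" "pt C g"
  shows "pt C (\<lambda>s. f s * g s)"
  using pt_sum[OF assms(1,2), of "\<lambda>s _. g s"] pt_loop[OF assms(3)] by simp

text \<open>The quotient is the number of \<open>i\<close> with
  \<open>Suc i * g s \<le> f s\<close>. The conjunct \<open>0 < g s\<close> makes the count 0 for a
  zero divisor, in agreement with \<open>div\<close>.\<close>

lemma pt_div:
  assumes "pt C f" "pb C f" "pt C g"
  shows "pt C (\<lambda>s. f s div g s)"
proof -
  have "f s div g s = card {i. i < f s \<and> 0 < g s \<and> (\<Sum>_<Suc i. g s) \<le> f s}" for s
  proof (cases "g s = 0")
    case False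
    have "{i. i < f s \<and> 0 < g s \<and> (\<Sum>_<Suc i. g s) \<le> f s} = {..<f s div g s}"
    proof (intro set_eqI iffI)
      fix i assume "i \<in> {i. i < f s \<and> 0 < g s \<and> (\<Sum>_<Suc i. g s) \<le> f s}"
      hence "Suc i * g s \<le> f s" by simp
      hence "Suc i \<le> f s div g s" using False by (simp add: less_eq_div_iff_mult_less_eq)
      thus "i \<in> {..<f s div g s}" by simp
    next
      fix i assume "i \<in> {..<f s div g s}"
      hence i: "Suc i \<le> f s div g s" by simp
      hence "Suc i * g s \<le> f s" using False by (simp add: less_eq_div_iff_mult_less_eq)
      moreover have "i < f s" using i div_le_dividend[of "f s" "g s"] by linarith
      ultimately show "i \<in> {i. i < f s \<and> 0 < g s \<and> (\<Sum>_<Suc i. g s) \<le> f s}" using False by simp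
    qed
    thus ?thesis by simp
  qed simp
  moreover have "pt C (\<lambda>s. card {i. i < f s \<and> 0 < g s \<and> (\<Sum>_<Suc i. g s) \<le> f s})"
  proof (intro pt_card assms(1,2) ptb_conj ptb_less ptb_le pt_loop[OF assms(1)] pt_loop[OF assms(3)] pt_const)
    have "pt (loop C) (\<lambda>x. (fst (snd x) + 1) * g (fst x))"
      by (intro pt_mult pt_add pb_add pt_index pb_index pt_const pb_const pt_loop[OF assms(3)])
    thus "pt (loop C) (\<lambda>x. \<Sum>_<Suc (fst (snd x)). g (fst x))" by simp
  qed
  ultimately show ?thesis by simp
qed

lemma pt_mod:
  assumes "pt C f" "pb C f" "pt C g"
  shows "pt C (\<lambda>s. f s mod g s)"
proof -
  have "pt C (\<lambda>s. f s - f s div g s * g s)"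
    by (intro pt_sub assms pt_mult pt_div pb_mono[OF assms(2)]) simp
  thus ?thesis by (simp add: modulo_nat_def)
qed

text \<open>In contrast to \<open>pt_div\<close> the shifted number is unbounded and only the shift
  is small. Bit masks and the encoded stack, which are huge numbers, are taken apart in this
  way.\<close>

lemma pt_shift_right:
  assumes "pt C f" "pt C i" "pb C i"
  shows "pt C (\<lambda>s. f s div 2 ^ i s)"
proof -
  have "rec_nat a (\<lambda>_ x. x div 2) n = a div 2 ^ n" for a n :: nat
    by (induction n) (auto simp: div_mult2_eq mult.commute[of 2])
  thus ?thesis using pt_iter[OF assms(2,3,1), of "\<lambda>_ _ x. x div 2"] pt_half[OF pt_acc(1)[of C]] by simp
qed

lemma pt_shift_left:
  assumes "pt C f" "pt C i" "pb C i"
  shows "pt C (\<lambda>s. f s * 2 ^ i s)"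
proof -
  have "rec_nat a (\<lambda>_ x. x + x) n = a * 2 ^ n" for a n :: nat
    by (induction n) auto
  thus ?thesis using pt_iter[OF assms(2,3,1), of "\<lambda>_ _ x. x + x"] pt_add[OF pt_acc(1) pt_acc(1), of C] by simp
qed

lemma pt_pow2: "pt C i \<Longrightarrow> pb C i \<Longrightarrow> pt C (\<lambda>s. 2 ^ i s)"
  using pt_shift_left[OF pt_const[of C 1], of i] by simp

lemma pt_mod_pow2:
  assumes "pt C f" "pt C i" "pb C i"
  shows "pt C (\<lambda>s. f s mod 2 ^ i s)"
proof -
  have "pt C (\<lambda>s. f s - f s div 2 ^ i s * 2 ^ i s)"
    by (intro pt_sub pt_shift_left pt_shift_right assms)
  thus ?thesis by (simp add: modulo_nat_def)
qed

lemma ptb_odd: "pt C f \<Longrightarrow> ptb C (\<lambda>s. odd (f s))"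
proof -
  assume f: "pt C f"
  have "ptb C (\<lambda>s. f s \<noteq> f s div 2 + f s div 2)" by (intro ptb_not ptb_eq pt_add pt_half f)
  moreover have "n \<noteq> n div 2 + n div 2 \<longleftrightarrow> odd n" for n :: nat by presburger
  ultimately show ?thesis by simp
qed

lemma ptb_bit:
  assumes "pt C f" "pt C i" "pb C i"
  shows "ptb C (\<lambda>s. bit (f s) (i s))"
  unfolding bit_iff_odd by (intro ptb_odd pt_shift_right assms)

section \<open>Sets of numbers as bit masks\<close>

definition mask_of :: "nat \<Rightarrow> (nat \<Rightarrow> bool) \<Rightarrow> nat" where
  "mask_of b P = (\<Sum>i<b. if P i then 2 ^ i else 0)"

lemma mask_of_less: "mask_of b P < 2 ^ b"
  by (induction b) (auto simp: mask_of_def)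

lemma bit_mask_of: "bit (mask_of b P) i \<longleftrightarrow> i < b \<and> P i"
proof (induction b arbitrary: i)
  case (Suc b)
  have S: "mask_of (Suc b) P = mask_of b P + of_bool (P b) * 2 ^ b" by (simp add: mask_of_def)
  have "bit (mask_of b P + of_bool (P b) * 2 ^ b) i \<longleftrightarrow> bit (mask_of b P) i \<or> (P b \<and> i = b)"
  proof (cases "P b")
    case True
    \<comment> \<open>Bit \<open>b\<close> of \<open>mask_of b P\<close> is clear, so the addition
      has no carry.\<close>
    have "mask_of b P + 2 ^ b = or (mask_of b P) (2 ^ b)"
      by (rule disjunctive_add) (use Suc mask_of_less[of b P] in \<open>auto simp: bit_exp_iff\<close>)
    thus ?thesis using True by (auto simp: bit_or_iff bit_exp_iff)
  qed simp
  with Suc S show ?case by (auto simp: less_Suc_eq)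
qed (simp add: mask_of_def)

lemma pt_mask_of:
  assumes "pt C b" "pb C b" "ptb (loop C) (\<lambda>x. P (fst x) (fst (snd x)))"
  shows "pt C (\<lambda>s. mask_of (b s) (P s))"
  unfolding mask_of_def by (intro pt_sum pt_If assms pt_pow2 pt_index pb_index pt_const)

section \<open>Sparsification\<close>

definition mins :: "'a set set \<Rightarrow> 'a set set" where
  "mins F = {S \<in> F. \<forall>S'\<in>F. S' \<subseteq> S \<longrightarrow> S' = S}"

text \<open>What remains of minimal sets after removal of a common heart \<open>H\<close>. As in a
  sunflower the petals surround the heart, but here they may intersect one another.\<close>

definition petals :: "'a set set \<Rightarrow> 'a set \<Rightarrow> nat \<Rightarrow> 'a set set" where
  "petals F H p = {Y. finite Y \<and> Y \<inter> H = {} \<and> card Y = p \<and> H \<union> Y \<in> mins F}"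

text \<open>Monotone satisfaction over arbitrary atoms, as for hitting sets. Complementary literals
  become related only when \<open>\<alpha>\<close> is taken to be \<open>lit_true\<close> of an
  assignment.\<close>

definition sat_by :: "('a \<Rightarrow> bool) \<Rightarrow> 'a set set \<Rightarrow> bool" where
  "sat_by \<alpha> F \<longleftrightarrow> (\<forall>S\<in>F. \<exists>x\<in>S. \<alpha> x)"

definition family :: "nat \<Rightarrow> nat set set \<Rightarrow> bool" where
  "family M F \<longleftrightarrow> (\<forall>S\<in>F. S \<subseteq> {..<M} \<and> S \<noteq> {} \<and> card S \<le> 3)"

lemma family_finite: "family M F \<Longrightarrow> finite F" 
  unfolding family_def by (rule finite_subset[of _ "Pow {..<M}"]) auto

lemma family_finite_member: "family M F \<Longrightarrow> S \<in> F \<Longrightarrow> finite S" 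
  unfolding family_def by (meson finite_lessThan finite_subset)

lemma mins_subset: "mins F \<subseteq> F" by (auto simp: mins_def)

lemma ex_mins:
  assumes "finite F" "S \<in> F"
  shows "\<exists>S'\<in>mins F. S' \<subseteq> S"
proof -
  from finite_has_minimal2[OF assms] obtain S' where "S' \<in> F" "S' \<subseteq> S" "\<forall>T\<in>F. T \<subseteq> S' \<longrightarrow> T = S'"
    by metis
  thus ?thesis by (auto simp: mins_def)
qed

lemma sat_by_mins: "finite F \<Longrightarrow> sat_by \<alpha> (mins F) \<longleftrightarrow> sat_by \<alpha> F"
  unfolding sat_by_def by (metis ex_mins mins_subset subsetD)

text \<open>Either some literal of \<open>H\<close> is true, or every set that contains
  \<open>H\<close> has to be satisfied within its petal.\<close>

lemma sat_by_branch: "sat_by \<alpha> F \<longleftrightarrow> sat_by \<alpha> (insert H F) \<or> sat_by \<alpha> (F \<union> petals F H p)"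
proof -
  have "sat_by \<alpha> (insert H F) \<or> sat_by \<alpha> (F \<union> petals F H p)" if "sat_by \<alpha> F"
  proof (cases "\<exists>x\<in>H. \<alpha> x")
    case False
    have "\<exists>x\<in>Y. \<alpha> x" if "Y \<in> petals F H p" for Y
    proof -
      have "H \<union> Y \<in> F" using that mins_subset[of F] by (auto simp: petals_def)
      with \<open>sat_by \<alpha> F\<close> False show ?thesis unfolding sat_by_def by blast
    qed
    with that show ?thesis unfolding sat_by_def by blast
  qed (use that in \<open>auto simp: sat_by_def\<close>)
  thus ?thesis by (auto simp: sat_by_def)
qed

lemma mins_not_below: "S \<in> mins F \<Longrightarrow> T \<subset> S \<Longrightarrow> T' \<subseteq> T \<Longrightarrow> T' \<notin> F"
  unfolding mins_def by blast

text \<open>A petal is a proper subset of a minimal set because the heart is nonempty, so no set of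
  \<open>F\<close> can lie inside it. Branching on petals therefore adds sets that \<open>F\<close>
  lacks.\<close>

lemma petal_not_below:
  assumes "Y \<in> petals F H p" "H \<noteq> {}" "T \<subseteq> Y" shows "T \<notin> F"
  by (rule mins_not_below[of "H \<union> Y" F Y]) (use assms in \<open>auto simp: petals_def\<close>)

lemma heart_not_below:
  assumes "Y \<in> petals F H p" "0 < p" "T \<subseteq> H" shows "T \<notin> F"
proof (rule mins_not_below[of "H \<union> Y" F H])
  have "Y \<noteq> {}" using assms by (auto simp: petals_def)
  thus "H \<subset> H \<union> Y" using assms by (auto simp: petals_def)
qed (use assms in \<open>auto simp: petals_def\<close>)

lemma petal_subset:
  assumes "family M F" "Y \<in> petals F H p"
  shows "Y \<subseteq> {..<M}" "H \<subseteq> {..<M}"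
  using assms mins_subset[of F] unfolding family_def petals_def by blast+

definition pairs_at :: "nat set set \<Rightarrow> nat \<Rightarrow> nat set set" where
  "pairs_at P x = {S \<in> P. card S = 2 \<and> x \<in> S}"

text \<open>
  The parameters of the branching: a heart with one literal needs \<open>d1\<close> petals with one literal or
  \<open>d3\<close> petals with two literals, a heart with two literals needs \<open>d2\<close> petals with one literal.
\<close>

locale sparsify =
  fixes M :: nat and F0 :: "nat set set" and d1 d2 d3 :: nat and A B :: real
  assumes F0: "family M F0" and d_pos: "0 < d1" "0 < d2" "0 < d3" and B_pos: "0 < B"
    and a_pos: "0 < A - B * (d1 + d2)"
    and c1: "2 powr (- (A - B * (d1 + d2))) + 2 powr (- ((A - B * (d1 + d2)) * d1)) \<le> 1"
    and c2: "2 powr (- B) + 2 powr (- ((A - B * (d1 + d2)) * d2)) \<le> 1"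
    and c3: "2 powr (- (A - B * (d1 + d2))) + 2 powr (- (B * d3)) \<le> 1"
begin

definition units :: "nat set set \<Rightarrow> nat set" where
  "units F = {x. {x} \<in> F}"

text \<open>Pairs of \<open>F0\<close> are left out because nothing bounds their number at a
  literal, whereas the degrees of the pairs created by branching are kept at \<open>d1 + d2\<close>
  or less by \<open>inv\<close>.\<close>

definition new_pairs :: "nat set set \<Rightarrow> nat set set" where
  "new_pairs F = {S \<in> mins F - F0. card S = 2}"

text \<open>Weight \<open>A\<close> for every literal that is not a unit, minus a credit
  \<open>B\<close> for every new pair. The conditions \<open>c1\<close>, \<open>c2\<close>,
  \<open>c3\<close> of the locale say, for the three kinds of branching, that the values
  \<open>2 powr \<Phi>\<close> of the two children sum up to at most that of the parent.\<close>

definition \<Phi> :: "nat set set \<Rightarrow> real" where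
  "\<Phi> F = A * (real M - card (units F)) - B * card (new_pairs F)"

definition inv :: "nat set set \<Rightarrow> bool" where
  "inv F \<longleftrightarrow> family M F \<and> F0 \<subseteq> F \<and> (\<forall>x. card (pairs_at (new_pairs F) x) \<le> d1 + d2)"

lemma units_subset: "family M F \<Longrightarrow> units F \<subseteq> {..<M}"
  unfolding units_def family_def by blast

lemma finite_units: "family M F \<Longrightarrow> finite (units F)"
  using units_subset finite_subset by blast

lemma finite_new_pairs: "family M F \<Longrightarrow> finite (new_pairs F)"
  by (rule finite_subset[OF _ family_finite[of M F]]) (auto simp: new_pairs_def mins_def)

lemma new_pairs_no_unit: "S \<in> new_pairs F \<Longrightarrow> x \<in> S \<Longrightarrow> {x} \<notin> F"
  by (auto simp: new_pairs_def mins_def card_2_iff)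

text \<open>A minimal pair contains no unit, so every new pair can be charged to a literal that is
  not a unit. At most \<open>d1 + d2\<close> pairs are charged to the same literal, and
  \<open>B * (d1 + d2) < A\<close>.\<close>

lemma \<Phi>_nonneg: assumes "inv F" shows "0 \<le> \<Phi> F"
proof -
  have fam: "family M F" using assms by (simp add: inv_def)
  have "new_pairs F \<subseteq> (\<Union>x\<in>{..<M} - units F. pairs_at (new_pairs F) x)"
  proof
    fix S assume S: "S \<in> new_pairs F"
    then obtain x where x: "x \<in> S" by (auto simp: new_pairs_def card_2_iff)
    moreover have "x < M" using S x fam mins_subset[of F] by (auto simp: new_pairs_def family_def)
    moreover have "x \<notin> units F" using new_pairs_no_unit[OF S x] by (simp add: units_def)
    ultimately show "S \<in> (\<Union>x\<in>{..<M} - units F. pairs_at (new_pairs F) x)"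
      using S by (auto simp: pairs_at_def new_pairs_def)
  qed
  hence "card (new_pairs F) \<le> card (\<Union>x\<in>{..<M} - units F. pairs_at (new_pairs F) x)"
    by (rule card_mono[rotated]) (use finite_new_pairs[OF fam] in \<open>auto simp: pairs_at_def\<close>)
  also have "\<dots> \<le> (\<Sum>x\<in>{..<M} - units F. card (pairs_at (new_pairs F) x))"
    by (rule card_UN_le) simp
  also have "\<dots> \<le> (\<Sum>x\<in>{..<M} - units F. d1 + d2)"
    by (rule sum_mono) (use assms in \<open>auto simp: inv_def\<close>)
  also have "\<dots> = (M - card (units F)) * (d1 + d2)"
    by (simp add: card_Diff_subset[OF finite_units[OF fam] units_subset[OF fam]])
  finally have 1: "real (card (new_pairs F)) \<le> (real M - card (units F)) * real (d1 + d2)"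
    using card_mono[OF _ units_subset[OF fam]] by (metis card_lessThan finite_lessThan of_nat_diff of_nat_le_iff of_nat_mult)
  have "B * card (new_pairs F) \<le> B * ((real M - card (units F)) * real (d1 + d2))"
    using 1 B_pos by (intro mult_left_mono) auto
  also have "\<dots> = (B * (d1 + d2)) * (real M - card (units F))" by simp
  also have "\<dots> \<le> A * (real M - card (units F))"
    using a_pos card_mono[OF _ units_subset[OF fam]] by (intro mult_right_mono) auto
  finally show ?thesis by (simp add: \<Phi>_def)
qed

lemma \<Phi>_F0: "\<Phi> F0 \<le> A * M"
proof -
  have "0 \<le> B * (d1 + d2)" using B_pos by simp
  hence "0 < A" using a_pos by linarith
  moreover have "0 \<le> B * card (new_pairs F0)" using B_pos by simp
  moreover from \<open>0 < A\<close> have "0 \<le> A * card (units F0)" by simp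
  ultimately show ?thesis unfolding \<Phi>_def right_diff_distrib by linarith
qed

lemma inv_F0: "inv F0"
proof -
  have "new_pairs F0 = {}" by (auto simp: new_pairs_def mins_def)
  thus ?thesis using F0 by (simp add: inv_def pairs_at_def)
qed

text \<open>A unit lowers the potential by \<open>A\<close>, but the new pairs through its literal
  cease to be minimal. There are at most \<open>d1 + d2\<close> of them and each gives back
  \<open>B\<close>.\<close>

lemma add_units:
  assumes F: "inv F" and P: "\<And>S. S \<in> P \<Longrightarrow> card S = 1 \<and> S \<subseteq> {..<M} \<and> S \<notin> F"
  shows "inv (F \<union> P)" "\<Phi> (F \<union> P) \<le> \<Phi> F - (A - B * (d1 + d2)) * card P"
proof -
  define Z where "Z = units P"
  have P_eq: "P = (\<lambda>x. {x}) ` Z" using P by (force simp: Z_def units_def card_1_singleton_iff)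
  have fam: "family M F" using F by (simp add: inv_def)
  have fam': "family M (F \<union> P)" using fam P by (fastforce simp: family_def)
  have finZ: "finite Z" using finite_units[OF fam'] by (auto simp: Z_def units_def elim: finite_subset[rotated])
  have cP: "card P = card Z" unfolding P_eq by (rule card_image) auto
  have u: "units (F \<union> P) = units F \<union> Z" by (auto simp: units_def Z_def)
  have "units F \<inter> Z = {}" using P by (auto simp: units_def Z_def)
  hence cu: "card (units (F \<union> P)) = card (units F) + card P"
    unfolding u cP using finZ finite_units[OF fam] by (simp add: card_Un_disjoint)
  have sub: "new_pairs (F \<union> P) \<subseteq> new_pairs F"
    using P by (fastforce simp: new_pairs_def mins_def)
  have "card (pairs_at (new_pairs (F \<union> P)) x) \<le> card (pairs_at (new_pairs F) x)" for x
    by (rule card_mono) (use sub finite_new_pairs[OF fam] in \<open>auto simp: pairs_at_def\<close>)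
  with F fam' show "inv (F \<union> P)" unfolding inv_def by (meson le_supI1 order_trans)
  have "new_pairs F \<subseteq> new_pairs (F \<union> P) \<union> (\<Union>x\<in>Z. pairs_at (new_pairs F) x)"
  proof
    fix S assume S: "S \<in> new_pairs F"
    show "S \<in> new_pairs (F \<union> P) \<union> (\<Union>x\<in>Z. pairs_at (new_pairs F) x)"
    proof (cases "S \<inter> Z = {}")
      case True
      have "S' = S" if "S' \<in> F \<union> P" "S' \<subseteq> S" for S'
        using that S True unfolding P_eq new_pairs_def mins_def by auto
      with S show ?thesis by (auto simp: new_pairs_def mins_def)
    next
      case False
      with S show ?thesis by (auto simp: pairs_at_def new_pairs_def)
    qed
  qed
  hence "card (new_pairs F) \<le> card (new_pairs (F \<union> P) \<union> (\<Union>x\<in>Z. pairs_at (new_pairs F) x))"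
    by (rule card_mono[rotated]) 
       (use finite_new_pairs[OF fam] finite_new_pairs[OF fam'] finZ in \<open>auto simp: pairs_at_def\<close>)
  also have "\<dots> \<le> card (new_pairs (F \<union> P)) + card (\<Union>x\<in>Z. pairs_at (new_pairs F) x)"
    by (rule card_Un_le)
  also have "card (\<Union>x\<in>Z. pairs_at (new_pairs F) x) \<le> (\<Sum>x\<in>Z. card (pairs_at (new_pairs F) x))"
    by (rule card_UN_le[OF finZ])
  also have "\<dots> \<le> (\<Sum>x\<in>Z. d1 + d2)"
    by (rule sum_mono) (use F in \<open>auto simp: inv_def\<close>)
  also have "\<dots> = card P * (d1 + d2)" using cP by simp
  finally have "real (card (new_pairs F)) \<le> card (new_pairs (F \<union> P)) + card P * real (d1 + d2)"
    by (simp flip: of_nat_add of_nat_mult of_nat_le_iff)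
  hence "B * card (new_pairs F) \<le> B * (card (new_pairs (F \<union> P)) + card P * real (d1 + d2))"
    using B_pos by (intro mult_left_mono) auto
  thus "\<Phi> (F \<union> P) \<le> \<Phi> F - (A - B * (d1 + d2)) * card P"
    unfolding \<Phi>_def cu by (simp add: algebra_simps)
qed

text \<open>No set of \<open>F\<close> lies inside an added pair, and pairs cannot absorb each
  other. So the added pairs are minimal, the earlier new pairs persist, and each addition earns
  \<open>B\<close>.\<close>

lemma add_pairs:
  assumes F: "inv F" and P: "\<And>S. S \<in> P \<Longrightarrow> card S = 2 \<and> S \<subseteq> {..<M} \<and> (\<forall>T\<in>F. \<not> T \<subseteq> S)"
    and deg: "\<And>x. card (pairs_at P x) + card (pairs_at (new_pairs F) x) \<le> d1 + d2"
  shows "inv (F \<union> P)" "\<Phi> (F \<union> P) \<le> \<Phi> F - B * card P"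
proof -
  have fam: "family M F" using F by (simp add: inv_def)
  have fam': "family M (F \<union> P)" using fam P by (fastforce simp: family_def)
  have finP: "finite P" using family_finite[OF fam'] by simp
  have u: "units (F \<union> P) = units F" using P by (force simp: units_def)
  have eq: "S' = S" if "S' \<subseteq> S" "card S' = 2" "card S = 2" for S S' :: "nat set"
    using that by (metis card.infinite card_subset_eq zero_neq_numeral)
  have sub: "new_pairs (F \<union> P) = new_pairs F \<union> P"
  proof (intro set_eqI iffI)
    fix S assume "S \<in> new_pairs F \<union> P"
    thus "S \<in> new_pairs (F \<union> P)"
    proof
      assume S: "S \<in> new_pairs F"
      hence "S' = S" if "S' \<in> F \<union> P" "S' \<subseteq> S" for S'
        using that P[of S'] eq[of S' S] by (auto simp: new_pairs_def mins_def)
      with S show ?thesis by (auto simp: new_pairs_def mins_def)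
    next
      assume S: "S \<in> P"
      hence "S' = S" if "S' \<in> F \<union> P" "S' \<subseteq> S" for S'
        using that P[of S'] P[of S] eq[of S' S] by auto
      with S P[of S] F show ?thesis by (auto simp: new_pairs_def mins_def inv_def)
    qed
  qed (auto simp: new_pairs_def mins_def)
  have dis: "new_pairs F \<inter> P = {}" using P by (fastforce simp: new_pairs_def mins_def)
  have "pairs_at (new_pairs (F \<union> P)) x = pairs_at P x \<union> pairs_at (new_pairs F) x" for x
    unfolding sub by (auto simp: pairs_at_def)
  hence "card (pairs_at (new_pairs (F \<union> P)) x) \<le> d1 + d2" for x
    using deg[of x] card_Un_le[of "pairs_at P x" "pairs_at (new_pairs F) x"] by simp
  with F fam' show "inv (F \<union> P)" unfolding inv_def by blast
  have "card (new_pairs (F \<union> P)) = card (new_pairs F) + card P"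
    unfolding sub by (rule card_Un_disjoint[OF finite_new_pairs[OF fam] finP dis])
  thus "\<Phi> (F \<union> P) \<le> \<Phi> F - B * card P"
    unfolding \<Phi>_def u by (simp add: algebra_simps)
qed

section \<open>The three kinds of branching\<close>

definition branchable :: "nat set set \<Rightarrow> nat set \<Rightarrow> nat \<Rightarrow> bool" where
  "branchable F H p \<longleftrightarrow> card H = 1 \<and> p = 1 \<and> d1 \<le> card (petals F H 1) \<or>
     card H = 2 \<and> p = 1 \<and> d2 \<le> card (petals F H 1) \<or>
     card H = 1 \<and> p = 2 \<and> d3 \<le> card (petals F H 2)"

text \<open>The priorities bound degrees before pairs are added. If no single literal has
  \<open>d1\<close> one-literal petals, every literal lies in fewer than \<open>d1\<close> new
  pairs; if no pair has \<open>d2\<close> of them, fewer than \<open>d2\<close> of the two-literal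
  petals of a heart contain a given literal.\<close>

definition first_branchable :: "nat set set \<Rightarrow> nat set \<Rightarrow> nat \<Rightarrow> bool" where
  "first_branchable F H p \<longleftrightarrow> branchable F H p \<and> 
     (card H = 2 \<or> p = 2 \<longrightarrow> (\<forall>x. \<not> branchable F {x} 1)) \<and>
     (p = 2 \<longrightarrow> (\<forall>x y. x \<noteq> y \<longrightarrow> \<not> branchable F {x, y} 1))"

lemma finite_petals: "family M F \<Longrightarrow> finite (petals F H p)"
  by (rule finite_subset[of _ "Pow {..<M}"]) (use petal_subset(1) in blast, simp)

lemma pairs_at_mins:
  assumes "family M F"
  shows "card (pairs_at (new_pairs F) x) \<le> card (petals F {x} 1)"
proof (rule card_inj_on_le[of "\<lambda>S. S - {x}"])
  show "inj_on (\<lambda>S. S - {x}) (pairs_at (new_pairs F) x)"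
    by (auto simp: inj_on_def pairs_at_def)
  show "(\<lambda>S. S - {x}) ` pairs_at (new_pairs F) x \<subseteq> petals F {x} 1"
    by (auto simp: pairs_at_def petals_def new_pairs_def insert_absorb card_2_iff)
qed (rule finite_petals[OF assms])

text \<open>The minimal set \<open>{x, y, z}\<close> is seen once as heart \<open>{x}\<close> with
  petal \<open>{y, z}\<close> and once as heart \<open>{x, y}\<close> with petal
  \<open>{z}\<close>.\<close>

lemma pairs_at_petals:
  assumes "family M F"
  shows "card (pairs_at (petals F {x} 2) y) \<le> card (petals F {x, y} 1)"
proof (rule card_inj_on_le[of "\<lambda>S. S - {y}"])
  show "inj_on (\<lambda>S. S - {y}) (pairs_at (petals F {x} 2) y)"
    by (auto simp: inj_on_def pairs_at_def)
  show "(\<lambda>S. S - {y}) ` pairs_at (petals F {x} 2) y \<subseteq> petals F {x, y} 1"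
  proof
    fix T assume "T \<in> (\<lambda>S. S - {y}) ` pairs_at (petals F {x} 2) y"
    then obtain S where S: "S \<in> petals F {x} 2" "y \<in> S" "T = S - {y}" by (auto simp: pairs_at_def)
    moreover from this have "{x, y} \<union> T = {x} \<union> S" by auto
    ultimately show "T \<in> petals F {x, y} 1" unfolding petals_def by auto
  qed
qed (rule finite_petals[OF assms])

text \<open>Adding the heart gains only a fixed amount, but the gain on the other side grows with
  the number of petals. The case of a single heart and single petals uses \<open>c1\<close>, that of
  a pair as heart uses \<open>c2\<close>, and that of two-literal petals uses
  \<open>c3\<close>.\<close>

theorem branch:
  assumes F: "inv F" and H: "first_branchable F H p"
  shows "inv (insert H F)" "inv (F \<union> petals F H p)"
    and "2 powr \<Phi> (insert H F) + 2 powr \<Phi> (F \<union> petals F H p) \<le> 2 powr \<Phi> F"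
proof -
  define a where "a = A - B * (d1 + d2)"
  have fam: "family M F" using F by (simp add: inv_def)
  have fin: "finite (petals F H p)" by (rule finite_petals[OF fam])
  have br: "branchable F H p" using H by (simp add: first_branchable_def)
  have p: "p = 1 \<or> p = 2" and cH: "card H = 1 \<or> card H = 2" and "0 < card (petals F H p)"
    using br d_pos by (auto simp: branchable_def)
  then obtain Y0 where Y0: "Y0 \<in> petals F H p" using fin by fastforce
  have Hne: "H \<noteq> {}" using cH by auto
  have HF: "T \<notin> F" if "T \<subseteq> H" for T using heart_not_below[OF Y0 _ that] p by auto
  have YF: "T \<notin> F" if "T \<subseteq> Y" "Y \<in> petals F H p" for T Y using petal_not_below[OF that(2) Hne that(1)] .
  have HM: "H \<subseteq> {..<M}" using petal_subset[OF fam Y0] by simp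
  have YM: "Y \<subseteq> {..<M}" if "Y \<in> petals F H p" for Y using petal_subset[OF fam that] by simp
  have two: "2 powr (x - u) + 2 powr (x - v) \<le> 2 powr x" 
    if "2 powr (- u) + 2 powr (- v) \<le> (1::real)" for x u v :: real
  proof -
    have "2 powr (x - u) + 2 powr (x - v) = 2 powr x * (2 powr (- u) + 2 powr (- v))"
      by (simp add: distrib_left flip: powr_add)
    also have "\<dots> \<le> 2 powr x * 1" by (rule mult_left_mono[OF that]) simp
    finally show ?thesis by simp
  qed
  have "inv (F \<union> {H}) \<and> inv (F \<union> petals F H p) \<and> 
     2 powr \<Phi> (F \<union> {H}) + 2 powr \<Phi> (F \<union> petals F H p) \<le> 2 powr \<Phi> F"
  proof -
    have deg1: "card (pairs_at (new_pairs F) x) < d1" if "card H = 2 \<or> p = 2" for x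
      using H that pairs_at_mins[OF fam, of x] 
      by (auto simp: first_branchable_def branchable_def not_le intro: le_less_trans)
    consider (1) "card H = 1" "p = 1" | (2) "card H = 2" "p = 1" | (3) "card H = 1" "p = 2"
      using br by (auto simp: branchable_def)
    thus ?thesis
    proof cases
      case 1
      have P: "S \<in> petals F H p \<Longrightarrow> card S = 1 \<and> S \<subseteq> {..<M} \<and> S \<notin> F" for S
        using YM[of S] YF[of S S] 1 by (auto simp: petals_def)
      note U = add_units[OF F, of "{H}"] add_units[of F "petals F H p", OF F P]
      have "\<Phi> (F \<union> {H}) \<le> \<Phi> F - a" using U(2) 1 HF HM by (simp add: a_def)
      moreover have "\<Phi> (F \<union> petals F H p) \<le> \<Phi> F - a * d1"
      proof -
        have "a * d1 \<le> a * card (petals F H p)"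
          using br 1 a_pos by (intro mult_left_mono) (auto simp: branchable_def a_def)
        with U(4) show ?thesis by (simp add: a_def)
      qed
      ultimately have "2 powr \<Phi> (F \<union> {H}) + 2 powr \<Phi> (F \<union> petals F H p) \<le> 2 powr (\<Phi> F - a) + 2 powr (\<Phi> F - a * d1)"
        by (intro add_mono powr_mono) auto
      also have "\<dots> \<le> 2 powr \<Phi> F" by (rule two) (use c1 in \<open>simp add: a_def\<close>)
      finally show ?thesis using U(1,3) 1 HF HM by simp
    next
      case 2
      have P: "S \<in> petals F H p \<Longrightarrow> card S = 1 \<and> S \<subseteq> {..<M} \<and> S \<notin> F" for S
        using YM[of S] YF[of S S] 2 by (auto simp: petals_def)
      note U = add_units[of F "petals F H p", OF F P]
      have deg: "card (pairs_at {H} x) + card (pairs_at (new_pairs F) x) \<le> d1 + d2" for x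
      proof -
        have "card (pairs_at {H} x) \<le> card {H}" by (rule card_mono) (auto simp: pairs_at_def)
        thus ?thesis using deg1[of x] 2 by simp
      qed
      have PH: "S \<in> {H} \<Longrightarrow> card S = 2 \<and> S \<subseteq> {..<M} \<and> (\<forall>T\<in>F. \<not> T \<subseteq> S)" for S
        using 2 HF HM by auto
      note V = add_pairs[of F "{H}", OF F PH deg]
      have "\<Phi> (F \<union> {H}) \<le> \<Phi> F - B" using V(2) by simp
      moreover have "\<Phi> (F \<union> petals F H p) \<le> \<Phi> F - a * d2"
      proof -
        have "a * d2 \<le> a * card (petals F H p)"
          using br 2 a_pos by (intro mult_left_mono) (auto simp: branchable_def a_def)
        with U(2) show ?thesis by (simp add: a_def)
      qed
      ultimately have "2 powr \<Phi> (F \<union> {H}) + 2 powr \<Phi> (F \<union> petals F H p) \<le> 2 powr (\<Phi> F - B) + 2 powr (\<Phi> F - a * d2)"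
        by (intro add_mono powr_mono) auto
      also have "\<dots> \<le> 2 powr \<Phi> F" by (rule two) (use c2 in \<open>simp add: a_def\<close>)
      finally show ?thesis using U(1) V(1) by simp
    next
      case 3
      then obtain x where x: "H = {x}" by (auto simp: card_1_singleton_iff)
      note U = add_units[OF F, of "{H}"]
      have P: "S \<in> petals F H p \<Longrightarrow> card S = 2 \<and> S \<subseteq> {..<M} \<and> (\<forall>T\<in>F. \<not> T \<subseteq> S)" for S
        using YM[of S] YF[of _ S] 3 by (auto simp: petals_def)
      have deg: "card (pairs_at (petals F H p) y) + card (pairs_at (new_pairs F) y) \<le> d1 + d2" for y
      proof (cases "y = x")
        case True
        hence "pairs_at (petals F H p) y = {}" using x by (auto simp: pairs_at_def petals_def)
        thus ?thesis using deg1[of y] 3 by simp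
      next
        case False
        hence "card (petals F {x, y} 1) < d2"
          using H 3 by (auto simp: first_branchable_def branchable_def not_le card_2_iff)
        thus ?thesis using pairs_at_petals[OF fam, of x y] deg1[of y] 3 x by simp
      qed
      note V = add_pairs[of F "petals F H p", OF F P deg]
      have "\<Phi> (F \<union> {H}) \<le> \<Phi> F - a" using U(2) 3 HF HM by (simp add: a_def)
      moreover have "\<Phi> (F \<union> petals F H p) \<le> \<Phi> F - B * d3"
      proof -
        have "B * d3 \<le> B * card (petals F H p)"
          using br 3 B_pos by (intro mult_left_mono) (auto simp: branchable_def)
        with V(2) show ?thesis by (simp)
      qed
      ultimately have "2 powr \<Phi> (F \<union> {H}) + 2 powr \<Phi> (F \<union> petals F H p) \<le> 2 powr (\<Phi> F - a) + 2 powr (\<Phi> F - B * d3)"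
        by (intro add_mono powr_mono) auto
      also have "\<dots> \<le> 2 powr \<Phi> F" by (rule two) (use c3 in \<open>simp add: a_def\<close>)
      finally show ?thesis using U(1) V(1) 3 HF HM by simp
    qed
  qed
  thus "inv (insert H F)" "inv (F \<union> petals F H p)"
    "2 powr \<Phi> (insert H F) + 2 powr \<Phi> (F \<union> petals F H p) \<le> 2 powr \<Phi> F" by simp_all
qed

text \<open>Split off any literal \<open>x\<close> of a minimal set: what remains is empty or a
  petal of \<open>{x}\<close>, and at a leaf there are fewer than \<open>d1\<close> petals with one
  literal and fewer than \<open>d3\<close> with two.\<close>

lemma leaf_card:
  assumes fam: "family M F" and leaf: "\<And>H p. \<not> branchable F H p"
  shows "card (mins F) \<le> M * (1 + d1 + d3)"
proof -
  have fin: "finite (petals F H p)" for H p by (rule finite_petals[OF fam])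
  let ?U = "\<lambda>x. {{x}} \<union> insert x ` petals F {x} 1 \<union> insert x ` petals F {x} 2"
  have "mins F \<subseteq> (\<Union>x<M. ?U x)"
  proof
    fix S assume S: "S \<in> mins F"
    hence S': "S \<subseteq> {..<M}" "S \<noteq> {}" "card S \<le> 3" "finite S" 
      using fam mins_subset[of F] family_finite_member[OF fam] unfolding family_def by blast+
    then obtain x where x: "x \<in> S" by blast
    have "card (S - {x}) = card S - 1" using x S' by simp
    moreover have "card S - 1 = 0 \<or> card S - 1 = 1 \<or> card S - 1 = 2" using S' by linarith
    ultimately consider "S - {x} = {}" | "card (S - {x}) = 1" | "card (S - {x}) = 2" 
      using S'(4) by (metis card_0_eq finite_Diff)
    hence "S \<in> ?U x"
    proof cases
      case 1
      thus ?thesis using x by auto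
    next
      case 2
      hence "S - {x} \<in> petals F {x} 1" using S x S' by (auto simp: petals_def insert_absorb)
      moreover have "S = insert x (S - {x})" using x by auto
      ultimately show ?thesis by blast
    next
      case 3
      hence "S - {x} \<in> petals F {x} 2" using S x S' by (auto simp: petals_def insert_absorb)
      moreover have "S = insert x (S - {x})" using x by auto
      ultimately show ?thesis by blast
    qed
    thus "S \<in> (\<Union>x<M. ?U x)" using x S' by blast
  qed
  hence "card (mins F) \<le> card (\<Union>x<M. ?U x)" by (rule card_mono[rotated]) (use fin in auto)
  also have "\<dots> \<le> (\<Sum>x<M. card (?U x))" by (rule card_UN_le) simp
  also have "\<dots> \<le> (\<Sum>x<M. 1 + d1 + d3)"
  proof (rule sum_mono)
    fix x
    have "card (insert x ` petals F {x} 1) \<le> d1" "card (insert x ` petals F {x} 2) \<le> d3"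
      using card_image_le[OF fin, of "insert x" "{x}" 1] card_image_le[OF fin, of "insert x" "{x}" 2] 
        leaf[of "{x}" 1] leaf[of "{x}" 2] by (auto simp: branchable_def not_le)
    moreover have "card (?U x) \<le> card {{x}} + card (insert x ` petals F {x} 1) + card (insert x ` petals F {x} 2)"
      by (meson card_Un_le order_trans add_right_mono)
    ultimately show "card (?U x) \<le> 1 + d1 + d3" by simp
  qed
  finally show ?thesis by simp
qed

end

text \<open>Half of \<open>A\<close> is reserved for lost pairs by
  \<open>B = A / 2 / (d1 + d2)\<close>, so the net gain of a unit is \<open>A / 2\<close> whatever
  the degrees are. This breaks the circular dependence, and \<open>d1\<close>, \<open>d2\<close>,
  \<open>d3\<close> can be chosen in this order.\<close>

lemma sparsify_parameters:
  fixes A :: real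
  assumes "0 < A"
  shows "\<exists>(d1 :: nat) (d2 :: nat) (d3 :: nat) B. 0 < d1 \<and> 0 < d2 \<and> 0 < d3 \<and> 0 < B \<and> 0 < A - B * real (d1 + d2) \<and>
    2 powr (- (A - B * real (d1 + d2))) + 2 powr (- ((A - B * real (d1 + d2)) * real d1)) \<le> 1 \<and>
    2 powr (- B) + 2 powr (- ((A - B * real (d1 + d2)) * real d2)) \<le> 1 \<and>
    2 powr (- (A - B * real (d1 + d2))) + 2 powr (- (B * real d3)) \<le> 1"
proof -
  define a where "a = A / 2"
  have a: "0 < a" using assms by (simp add: a_def)
  define q where "q = 1 - 2 powr (- a)"
  have q: "0 < q" using a powr_less_mono[of "-a" 0 2] by (simp add: q_def)
  have lim: "eventually (\<lambda>d :: nat. (0::nat) < d \<and> 2 powr (- (c * d)) < q) at_top" if "0 < c" for c :: real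
  proof (intro eventually_conj eventually_gt_at_top)
    have "((\<lambda>d :: nat. 2 powr (- (c * d))) \<longlongrightarrow> 0) at_top" using that by real_asymp
    thus "\<forall>\<^sub>F d :: nat in sequentially. 2 powr (- (c * d)) < q" using q by (rule order_tendstoD)
  qed
  from eventually_happens'[OF _ lim[OF a]] obtain d1 :: nat where d1: "0 < d1" "2 powr (- (a * d1)) < q" by auto
  define c where "c = real d1"
  \<comment> \<open>For large \<open>d\<close>, \<open>1 - 2 powr (- (a / (c + d)))\<close> decays
    only like \<open>1 / d\<close>, whereas \<open>2 powr (- (a * d))\<close> decays
    exponentially.\<close>
  have "eventually (\<lambda>d :: nat. 2 powr (- (a / (c + d))) + 2 powr (- (a * d)) \<le> 1) at_top"
    using a by real_asymp
  hence "eventually (\<lambda>d :: nat. (0::nat) < d \<and> 2 powr (- (a / (c + d))) + 2 powr (- (a * d)) \<le> 1) at_top"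
    by (intro eventually_conj eventually_gt_at_top)
  from eventually_happens'[OF _ this] obtain d2 :: nat where d2: "0 < d2" "2 powr (- (a / (c + d2))) + 2 powr (- (a * d2)) \<le> 1" by auto
  define B where "B = a / (c + d2)"
  have B: "0 < B" using a d1 by (simp add: B_def c_def)
  from eventually_happens'[OF _ lim[OF B]] obtain d3 :: nat where d3: "0 < d3" "2 powr (- (B * d3)) < q" by auto
  have "real d1 + real d2 \<noteq> 0" using d1 by linarith
  hence "B * real (d1 + d2) = a" by (simp add: B_def c_def)
  hence "A - B * real (d1 + d2) = a" by (simp add: a_def)
  with d1 d2 d3 B a show ?thesis
    by (rule_tac x = d1 in exI, rule_tac x = d2 in exI, rule_tac x = d3 in exI, rule_tac x = B in exI)
      (simp add: q_def B_def)
qed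

section \<open>Scorpions with prescribed roles\<close>

lemma simple_graph_edge:
  assumes "simple_graph H" "e \<in> edges H"
  obtains u v where "e = {u, v}" "u \<noteq> v" "u \<in> verts H" "v \<in> verts H"
  using assms unfolding simple_graph_def by (metis card_2_iff insert_subset)

text \<open>Position 0 of \<open>q\<close> is the body and the last position the end of the tail.
  Stating adjacency by positions suits vertices that are given by a map such as
  \<open>vt\<close>.\<close>

definition scorpion_at :: "'a graph \<Rightarrow> 'a list \<Rightarrow> bool" where
  "scorpion_at H q \<longleftrightarrow> distinct q \<and> set q \<subseteq> verts H \<and>
     (\<forall>i j. i < j \<and> j < length q \<longrightarrow> ({q ! i, q ! j} \<in> edges H \<longleftrightarrow> j = Suc i)) \<and>
     (\<forall>v\<in>verts H - set q. {q ! 0, v} \<in> edges H) \<and>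
     (\<forall>i v. 0 < i \<and> i < length q \<and> v \<in> verts H - set q \<longrightarrow> {q ! i, v} \<notin> edges H)"

lemma induced_path_iff:
  assumes H: "simple_graph H" and q: "distinct q" "set q \<subseteq> verts H"
  shows "induced_subgraph H (set q) = path_graph q \<longleftrightarrow>
    (\<forall>i j. i < j \<and> j < length q \<longrightarrow> ({q ! i, q ! j} \<in> edges H \<longleftrightarrow> j = Suc i))" (is "?L \<longleftrightarrow> ?R")
proof
  assume ?L
  hence E: "{e \<in> edges H. e \<subseteq> set q} = {{q ! i, q ! Suc i} | i. Suc i < length q}"
    by (simp add: induced_subgraph_def path_graph_def)
  show ?R
  proof (intro allI impI)
    fix i j assume ij: "i < j \<and> j < length q"
    hence "{q ! i, q ! j} \<in> edges H \<longleftrightarrow> {q ! i, q ! j} \<in> {e \<in> edges H. e \<subseteq> set q}" by auto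
    also have "\<dots> \<longleftrightarrow> (\<exists>a. Suc a < length q \<and> {q ! i, q ! j} = {q ! a, q ! Suc a})"
      unfolding E by auto
    also have "\<dots> \<longleftrightarrow> j = Suc i"
      using ij q(1) by (auto simp: doubleton_eq_iff nth_eq_iff_index_eq)
    finally show "{q ! i, q ! j} \<in> edges H \<longleftrightarrow> j = Suc i" .
  qed
next
  assume R: ?R
  have "{e \<in> edges H. e \<subseteq> set q} = {{q ! i, q ! Suc i} | i. Suc i < length q}"
  proof (intro set_eqI iffI)
    fix e assume "e \<in> {e \<in> edges H. e \<subseteq> set q}"
    hence e: "e \<in> edges H" "e \<subseteq> set q" by auto
    from simple_graph_edge[OF H e(1)] obtain u v where uv: "e = {u, v}" "u \<noteq> v" by metis
    with e(2) obtain i j where ij: "i < length q" "j < length q" "u = q ! i" "v = q ! j"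
      by (auto simp: in_set_conv_nth)
    with uv have "i \<noteq> j" by auto
    hence "i < j \<or> j < i" by linarith
    thus "e \<in> {{q ! i, q ! Suc i} | i. Suc i < length q}"
    proof
      assume "i < j"
      with R ij e uv have "j = Suc i" by auto
      with ij uv show ?thesis by auto
    next
      assume "j < i"
      have "{q ! j, q ! i} \<in> edges H" using e(1) uv(1) ij(3,4) by (simp add: insert_commute)
      with R \<open>j < i\<close> ij(1) have "i = Suc j" by blast
      with ij uv show ?thesis by (auto simp: insert_commute)
    qed
  next
    fix e assume "e \<in> {{q ! i, q ! Suc i} | i. Suc i < length q}"
    then obtain i where i: "Suc i < length q" "e = {q ! i, q ! Suc i}" by auto
    with R have "e \<in> edges H" by auto
    with i show "e \<in> {e \<in> edges H. e \<subseteq> set q}" by auto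
  qed
  thus ?L by (simp add: induced_subgraph_def path_graph_def)
qed

lemma scorpion_iff:
  "scorpion l H \<longleftrightarrow> simple_graph H \<and> l + 4 \<le> card (verts H) \<and> (\<exists>q. length q = l + 2 \<and> scorpion_at H q)"
proof -
  have 1: "(length ts = l \<and> distinct (b # ts @ [s]) \<and> set (b # ts @ [s]) \<subseteq> verts H \<and>
        (let Q = set (b # ts @ [s]); legs = verts H - Q in
           induced_subgraph H Q = path_graph (b # ts @ [s]) \<and>
           (\<forall>v\<in>legs. {b, v} \<in> edges H) \<and>
           (\<forall>q\<in>Q - {b}. \<forall>v\<in>legs. {q, v} \<notin> edges H))) \<longleftrightarrow> 
     length ts = l \<and> scorpion_at H (b # ts @ [s])" (is "?L \<longleftrightarrow> ?R") if H: "simple_graph H" for b ts s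
  proof -
    define q where "q = b # ts @ [s]"
    have b: "b = q ! 0" by (simp add: q_def)
    have len: "0 < length q" by (simp add: q_def)
    have B: "(\<forall>x\<in>set q - {b}. \<forall>v\<in>verts H - set q. {x, v} \<notin> edges H) \<longleftrightarrow>
      (\<forall>i v. 0 < i \<and> i < length q \<and> v \<in> verts H - set q \<longrightarrow> {q ! i, v} \<notin> edges H)" if "distinct q"
    proof -
      have "set q - {b} = {q ! i | i. 0 < i \<and> i < length q}"
      proof (intro set_eqI iffI)
        fix x assume "x \<in> set q - {b}"
        then obtain i where "i < length q" "x = q ! i" "x \<noteq> q ! 0" by (auto simp: in_set_conv_nth b)
        thus "x \<in> {q ! i | i. 0 < i \<and> i < length q}" by (cases i) auto
      next
        fix x assume "x \<in> {q ! i | i. 0 < i \<and> i < length q}"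
        then obtain i where i: "0 < i" "i < length q" "x = q ! i" by auto
        moreover have "x \<noteq> q ! 0" using i len that nth_eq_iff_index_eq by force
        ultimately show "x \<in> set q - {b}" by (simp add: b)
      qed
      moreover have "(\<forall>x\<in>{q ! i | i. 0 < i \<and> i < length q}. P x) \<longleftrightarrow> (\<forall>i. 0 < i \<and> i < length q \<longrightarrow> P (q ! i))" for P
        by auto
      ultimately show ?thesis by (simp, blast)
    qed
    show ?thesis
    proof (cases "distinct q \<and> set q \<subseteq> verts H")
      case True
      show ?thesis unfolding scorpion_at_def q_def[symmetric] Let_def
        by (simp only: True B induced_path_iff[OF H] b[symmetric] simp_thms)
    next
      case False
      thus ?thesis unfolding scorpion_at_def q_def[symmetric] by argo
    qed
  qed
  have 2: "(\<exists>b ts s. length ts = l \<and> P (b # ts @ [s])) \<longleftrightarrow> (\<exists>q. length q = l + 2 \<and> P q)" for P :: "'a list \<Rightarrow> bool"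
  proof
    assume "\<exists>b ts s. length ts = l \<and> P (b # ts @ [s])"
    then obtain b ts s where "length ts = l" "P (b # ts @ [s])" by blast
    thus "\<exists>q. length q = l + 2 \<and> P q" by (intro exI[of _ "b # ts @ [s]"]) simp
  next
    assume "\<exists>q. length q = l + 2 \<and> P q"
    then obtain q where q: "length q = l + 2" "P q" by blast
    then obtain b r where r: "q = b # r" "length r = l + 1" by (cases q) auto
    then obtain ts s where "r = ts @ [s]" by (cases r rule: rev_cases) auto
    with q r show "\<exists>b ts s. length ts = l \<and> P (b # ts @ [s])" by auto
  qed
  show ?thesis unfolding scorpion_def 2[symmetric] using 1 by blast
qed

lemma scorpion_no_isolated:
  assumes "scorpion l H" "v \<in> verts H"
  shows "\<exists>e\<in>edges H. v \<in> e"
proof -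
  from assms(1) obtain q where q: "length q = l + 2" "scorpion_at H q" by (auto simp: scorpion_iff)
  show ?thesis
  proof (cases "v \<in> set q")
    case True
    then obtain i where i: "i < length q" "v = q ! i" by (auto simp: in_set_conv_nth)
    show ?thesis
    proof (cases i)
      case 0
      hence "{q ! i, q ! Suc i} \<in> edges H" using q by (auto simp: scorpion_at_def)
      thus ?thesis using i by blast
    next
      case (Suc j)
      hence "{q ! j, q ! Suc j} \<in> edges H" using q i by (auto simp: scorpion_at_def)
      thus ?thesis using i Suc by blast
    qed
  next
    case False
    hence "{q ! 0, v} \<in> edges H" using q assms(2) by (auto simp: scorpion_at_def)
    thus ?thesis by blast
  qed
qed

text \<open>
  A graph on \<open>k\<close> vertices \<open>vt 0, \<dots>, vt (k - 1)\<close> that can only be a scorpion with body \<open>vt 0\<close>, tail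
  \<open>vt 1, \<dots>, vt (l + 1)\<close> and the remaining vertices as legs: since \<open>vt 0\<close> has only \<open>l\<close>
  non-neighbours, it can be neither a leg nor in the tail of a scorpion.
\<close>

locale tagged_vertices =
  fixes k l :: nat and vt :: "nat \<Rightarrow> 'a" and H :: "'a graph"
  assumes kl: "0 < l" "2 * l + 4 \<le> k"
    and H: "simple_graph H" and vt: "inj_on vt {..<k}" "verts H = vt ` {..<k}"
    and body: "\<And>c. 0 < c \<Longrightarrow> c < k \<Longrightarrow> {vt 0, vt c} \<in> edges H \<longleftrightarrow> c = 1 \<or> l + 2 \<le> c"
    and tail: "\<And>c c'. 0 < c \<Longrightarrow> c < c' \<Longrightarrow> c' < l + 2 \<Longrightarrow> {vt c, vt c'} \<in> edges H \<longleftrightarrow> c' = Suc c"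
begin

lemma scorpionI:
  assumes legs: "\<And>c c'. 0 < c \<Longrightarrow> c < l + 2 \<Longrightarrow> l + 2 \<le> c' \<Longrightarrow> c' < k \<Longrightarrow> {vt c, vt c'} \<notin> edges H"
  shows "scorpion l H"
proof -
  define q where "q = map vt [0..<l + 2]"
  have len: "length q = l + 2" by (simp add: q_def)
  have nth: "q ! i = vt i" if "i < l + 2" for i using that by (simp add: q_def del: upt_Suc)
  have set: "set q = vt ` {..<l + 2}" by (simp only: q_def set_map set_upt lessThan_atLeast0)
  have rest: "verts H - set q = vt ` {l + 2..<k}"
  proof -
    have "vt ` {..<k} - vt ` {..<l + 2} = vt ` ({..<k} - {..<l + 2})"
      using kl by (intro inj_on_image_set_diff[OF vt(1), symmetric]) auto
    also have "{..<k} - {..<l + 2} = {l + 2..<k}" by auto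
    finally show ?thesis by (simp add: set vt(2))
  qed
  have "scorpion_at H q"
    unfolding scorpion_at_def
  proof (intro conjI allI ballI impI)
    have "inj_on vt (set [0..<l + 2])" by (rule inj_on_subset[OF vt(1)]) (use kl in auto)
    thus "distinct q" by (simp only: q_def distinct_map distinct_upt simp_thms)
    show "set q \<subseteq> verts H" unfolding set vt(2) using kl by auto
  next
    fix i j assume "i < j \<and> j < length q"
    hence ij: "i < j" "j < l + 2" by (auto simp: len)
    show "{q ! i, q ! j} \<in> edges H \<longleftrightarrow> j = Suc i"
      using ij kl tail[of i j] body[of j] by (cases "i = 0") (auto simp: nth)
  next
    fix v assume "v \<in> verts H - set q"
    thus "{q ! 0, v} \<in> edges H" unfolding rest using body by (auto simp: nth)
  next
    fix i v assume "0 < i \<and> i < length q \<and> v \<in> verts H - set q"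
    thus "{q ! i, v} \<notin> edges H" unfolding rest using legs by (auto simp: nth len)
  qed
  moreover have "card (verts H) = k" using vt by (simp add: card_image)
  ultimately show ?thesis unfolding scorpion_iff using H kl len by auto
qed

lemma scorpionD:
  assumes "scorpion l H"
  shows "0 < c \<Longrightarrow> c < l + 2 \<Longrightarrow> l + 2 \<le> c' \<Longrightarrow> c' < k \<Longrightarrow> {vt c, vt c'} \<notin> edges H"
proof -
  from assms obtain q where len: "length q = l + 2" and sc: "scorpion_at H q" by (auto simp: scorpion_iff)
  have dq: "distinct q" and sq: "set q \<subseteq> verts H" using sc by (auto simp: scorpion_at_def)
  have path: "{q ! i, q ! j} \<in> edges H \<longleftrightarrow> j = Suc i" if "i < j" "j < l + 2" for i j
    using sc that len by (auto simp: scorpion_at_def)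
  have leg0: "{q ! 0, v} \<in> edges H" if "v \<in> verts H - set q" for v
    using sc that by (auto simp: scorpion_at_def)
  have leg: "{q ! i, v} \<notin> edges H" if "v \<in> verts H - set q" "0 < i" "i < l + 2" for v i
  proof -
    have "\<forall>i v. 0 < i \<and> i < length q \<and> v \<in> verts H - set q \<longrightarrow> {q ! i, v} \<notin> edges H"
      using sc unfolding scorpion_at_def by (elim conjE)
    thus ?thesis using that len by simp
  qed
  have cH: "card (verts H) = k" using vt by (simp add: card_image)
  have fH: "finite (verts H)" using vt by simp
  have cq: "card (set q) = l + 2" using dq len by (simp add: distinct_card)
  \<comment> \<open>The non-neighbours of \<open>vt 0\<close>; there are exactly \<open>l\<close> of
    them.\<close>
  define N where "N = {v \<in> verts H. v \<noteq> vt 0 \<and> {vt 0, v} \<notin> edges H}"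
  have N: "N = vt ` {2..<l + 2}"
  proof -
    have "N = vt ` {c \<in> {..<k}. vt c \<noteq> vt 0 \<and> {vt 0, vt c} \<notin> edges H}"
      unfolding N_def vt(2) by auto
    also have "{c \<in> {..<k}. vt c \<noteq> vt 0 \<and> {vt 0, vt c} \<notin> edges H} = {c \<in> {..<k}. c \<noteq> 0 \<and> \<not> (c = 1 \<or> l + 2 \<le> c)}"
      using body inj_on_eq_iff[OF vt(1)] kl by fastforce
    also have "\<dots> = {2..<l + 2}" using kl by auto
    finally show ?thesis .
  qed
  have cN: "card N = l" unfolding N 
    by (subst card_image) (use kl in \<open>auto intro: inj_on_subset[OF vt(1)]\<close>)
  have fN: "finite N" by (simp add: N)
  have drop: "set (drop m q) = {q ! i | i. m \<le> i \<and> i < l + 2}" for m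
  proof -
    have "x \<in> set (drop m q) \<longleftrightarrow> (\<exists>i. x = q ! i \<and> m \<le> i \<and> i < l + 2)" for x
    proof
      assume "x \<in> set (drop m q)"
      then obtain i where "i < length (drop m q)" "x = drop m q ! i" by (auto simp: in_set_conv_nth)
      thus "\<exists>i. x = q ! i \<and> m \<le> i \<and> i < l + 2" using len by (intro exI[of _ "m + i"]) auto
    next
      assume "\<exists>i. x = q ! i \<and> m \<le> i \<and> i < l + 2"
      then obtain i where "x = q ! i" "m \<le> i" "i < l + 2" by blast
      hence "i - m < length (drop m q)" "x = drop m q ! (i - m)" using len by auto
      thus "x \<in> set (drop m q)" using nth_mem by metis
    qed
    thus ?thesis by auto
  qed
  have cdrop: "card (set (drop m q)) = l + 2 - m" for m
    using dq len by (simp add: distinct_card)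
  have "vt 0 \<in> verts H" using vt kl by auto
  have v0: "vt 0 = q ! 0"
  proof (rule ccontr)
    assume neq: "vt 0 \<noteq> q ! 0"
    show False
    proof (cases "vt 0 \<in> set q")
      case False
      \<comment> \<open>As a leg, \<open>vt 0\<close> would be non-adjacent to all
        \<open>l + 1\<close> vertices behind the body.\<close>
      have "set (drop 1 q) \<subseteq> N"
      proof
        fix v assume "v \<in> set (drop 1 q)"
        then obtain i where i: "v = q ! i" "1 \<le> i" "i < l + 2" unfolding drop by auto
        hence "v \<in> set q" using len by simp
        moreover from this have "v \<noteq> vt 0" using False by auto
        moreover have "{q ! i, vt 0} \<notin> edges H" using leg[of "vt 0" i] i False \<open>vt 0 \<in> verts H\<close> by simp
        ultimately show "v \<in> N" using sq i(1) unfolding N_def by (auto simp: insert_commute)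
      qed
      hence "card (set (drop 1 q)) \<le> card N" by (intro card_mono fN)
      thus False using cdrop[of 1] cN by simp
    next
      case True
      then obtain i where i: "i < l + 2" "vt 0 = q ! i" by (auto simp: in_set_conv_nth len)
      with neq have "0 < i" by (cases i) auto
      \<comment> \<open>As a tail vertex, \<open>vt 0\<close> would be non-adjacent to all
        \<open>k - l - 2\<close> legs, which are more than \<open>l\<close>.\<close>
      hence "verts H - set q \<subseteq> N" using leg i True unfolding N_def by auto
      hence "card (verts H - set q) \<le> card N" by (intro card_mono fN)
      moreover have "card (verts H - set q) = k - (l + 2)"
        using card_Diff_subset[OF _ sq] cH cq by simp
      ultimately show False using cN kl by simp
    qed
  qed
  have "set (drop 2 q) \<subseteq> N"
  proof
    fix v assume "v \<in> set (drop 2 q)"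
    then obtain i where i: "v = q ! i" "2 \<le> i" "i < l + 2" unfolding drop by auto
    with path[of 0 i] have "{q ! 0, v} \<notin> edges H" by auto
    moreover have "v \<noteq> q ! 0" using i dq len by (simp add: nth_eq_iff_index_eq)
    moreover have "v \<in> verts H" using i sq len by (metis nth_mem subsetD)
    ultimately show "v \<in> N" unfolding N_def v0 by simp
  qed
  hence N_eq: "set (drop 2 q) = N" using cdrop[of 2] cN fN by (intro card_subset_eq) auto
  \<comment> \<open>The positions from 2 on are filled by \<open>N\<close>, so \<open>vt 1\<close>
    is at position 1 or a leg. A leg it cannot be, since it is adjacent to \<open>vt 2\<close>,
    which belongs to the tail because of \<open>0 < l\<close>.\<close>
  have v1: "vt 1 = q ! 1"
  proof (rule ccontr)
    assume neq: "vt 1 \<noteq> q ! 1"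
    have "vt 1 \<in> verts H" using vt kl by auto
    have "vt 1 \<notin> set q"
    proof
      assume "vt 1 \<in> set q"
      then obtain i where i: "i < l + 2" "vt 1 = q ! i" by (auto simp: in_set_conv_nth len)
      have "vt 1 \<noteq> vt 0" using inj_on_eq_iff[OF vt(1), of 1 0] kl by auto
      hence "i \<noteq> 0" using i v0 by metis
      moreover have "i \<noteq> 1" using i neq by metis
      ultimately have "vt 1 \<in> N" using i unfolding N_eq[symmetric] drop by auto
      thus False unfolding N_def using body[of 1] kl by auto
    qed
    have "vt 2 \<in> N" unfolding N using kl by auto
    then obtain i where i: "vt 2 = q ! i" "2 \<le> i" "i < l + 2" unfolding N_eq[symmetric] drop by auto
    have "{vt 1, vt 2} \<in> edges H" using tail[of 1 2] kl by auto
    thus False using leg[of "vt 1" i] i \<open>vt 1 \<notin> set q\<close> \<open>vt 1 \<in> verts H\<close> by (auto simp: insert_commute)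
  qed
  have q_eq: "set q = vt ` {..<l + 2}"
  proof -
    have "set q = {q ! i | i. i < l + 2}" using len by (auto simp: set_conv_nth)
    also have "\<dots> = insert (q ! 0) (insert (q ! 1) (set (drop 2 q)))"
    proof -
      have "{..<l + 2} = insert 0 (insert 1 {2..<l + 2})" by auto
      hence "(\<lambda>i. q ! i) ` {..<l + 2} = insert (q ! 0) (insert (q ! 1) ((\<lambda>i. q ! i) ` {2..<l + 2}))" by (simp only: image_insert)
      moreover have "{q ! i | i. i < l + 2} = (\<lambda>i. q ! i) ` {..<l + 2}" by auto
      moreover have "set (drop 2 q) = (\<lambda>i. q ! i) ` {2..<l + 2}" unfolding drop by auto
      ultimately show ?thesis by (simp only:)
    qed
    also have "\<dots> = vt ` (insert 0 (insert 1 {2..<l + 2}))" unfolding N_eq N v0[symmetric] v1[symmetric] by auto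
    also have "insert 0 (insert 1 {2..<l + 2}) = {..<l + 2}" by auto
    finally show ?thesis .
  qed
  assume c: "0 < c" "c < l + 2" "l + 2 \<le> c'" "c' < k"
  have "vt c \<in> set q" using q_eq c by auto
  then obtain i where i: "i < l + 2" "vt c = q ! i" by (auto simp: in_set_conv_nth len)
  have "vt c \<noteq> vt 0" using inj_on_eq_iff[OF vt(1), of c 0] kl c by auto
  hence "0 < i" using i v0 by (metis neq0_conv)
  have "vt c' \<notin> set q"
  proof
    assume "vt c' \<in> set q"
    then obtain x where x: "x < l + 2" "vt c' = vt x" unfolding q_eq by auto
    with inj_on_eq_iff[OF vt(1), of c' x] c kl show False by auto
  qed
  moreover have "vt c' \<in> verts H" using c vt by auto
  ultimately show "{vt c, vt c'} \<notin> edges H" using leg[of "vt c'" i] i \<open>0 < i\<close> by auto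
qed

end

text \<open>Inclusion-exclusion without negative numbers: an element with \<open>c x = K\<close> is
  counted for the set \<open>K\<close> only, any other one equally often for even and for odd
  sets.\<close>

lemma even_odd_subsets_sum:
  fixes c :: "'x \<Rightarrow> 'c set"
  assumes X: "finite X" and K: "finite K"
  shows "(\<Sum>S | S \<subseteq> K \<and> even (card S). card {x \<in> X. c x \<subseteq> S}) \<noteq> (\<Sum>S | S \<subseteq> K \<and> odd (card S). card {x \<in> X. c x \<subseteq> S})
     \<longleftrightarrow> (\<exists>x\<in>X. c x = K)"
proof -
  have swap: "(\<Sum>S\<in>\<S>. card {x \<in> X. c x \<subseteq> S}) = (\<Sum>x\<in>X. card {S \<in> \<S>. c x \<subseteq> S})" if "finite \<S>" for \<S>
  proof -
    have "(\<Sum>S\<in>\<S>. card {x \<in> X. c x \<subseteq> S}) = (\<Sum>S\<in>\<S>. \<Sum>x\<in>X. of_bool (c x \<subseteq> S))"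
      using X by (simp add: sum_of_bool_eq Int_def)
    also have "\<dots> = (\<Sum>x\<in>X. \<Sum>S\<in>\<S>. of_bool (c x \<subseteq> S))" by (rule sum.swap)
    also have "\<dots> = (\<Sum>x\<in>X. card {S \<in> \<S>. c x \<subseteq> S})"
      using that by (simp add: sum_of_bool_eq Int_def)
    finally show ?thesis .
  qed
  define f where "f b x = card {S. (S \<subseteq> K \<and> even (card S) = b) \<and> c x \<subseteq> S}" for b x
  have f: "(\<Sum>S | S \<subseteq> K \<and> even (card S) = b. card {x \<in> X. c x \<subseteq> S}) = (\<Sum>x\<in>X. f b x)" for b
    unfolding f_def by (subst swap) (use K in auto)
  have eq: "f True x = f False x" if "c x \<noteq> K" for x
  proof (cases "c x \<subseteq> K")
    case True
    with that have "c x \<subset> K" by auto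
    from card_subsupersets_even_odd[OF K this] show ?thesis
      unfolding f_def by (simp add: conj_ac)
  next
    case False
    hence "{S. (S \<subseteq> K \<and> even (card S) = b) \<and> c x \<subseteq> S} = {}" for b by blast
    hence "f b x = 0" for b unfolding f_def by (simp only: card.empty)
    thus ?thesis by simp
  qed
  have top: "f b x = of_bool (even (card K) = b)" if "c x = K" for b x
  proof -
    have "{S. (S \<subseteq> K \<and> even (card S) = b) \<and> c x \<subseteq> S} = (if even (card K) = b then {K} else {})"
      using that by auto
    thus ?thesis unfolding f_def by auto
  qed
  have split: "(\<Sum>x\<in>X. f b x) = (\<Sum>x | x \<in> X \<and> c x \<noteq> K. f True x) + of_bool (even (card K) = b) * card {x \<in> X. c x = K}" for b
  proof -
    have "X = {x \<in> X. c x \<noteq> K} \<union> {x \<in> X. c x = K}" by auto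
    hence "(\<Sum>x\<in>X. f b x) = (\<Sum>x | x \<in> X \<and> c x \<noteq> K. f b x) + (\<Sum>x | x \<in> X \<and> c x = K. f b x)"
      using X by (subst sum.union_disjoint[symmetric]) auto
    also have "(\<Sum>x | x \<in> X \<and> c x \<noteq> K. f b x) = (\<Sum>x | x \<in> X \<and> c x \<noteq> K. f True x)"
      using eq by (cases b) (auto intro!: sum.cong)
    also have "(\<Sum>x | x \<in> X \<and> c x = K. f b x) = (\<Sum>x | x \<in> X \<and> c x = K. of_bool (even (card K) = b))"
      by (rule sum.cong) (use top in auto)
    finally show ?thesis by (simp add: mult.commute)
  qed
  have "card {x \<in> X. c x = K} = 0 \<longleftrightarrow> \<not> (\<exists>x\<in>X. c x = K)" using X by auto
  thus ?thesis using f[of True] f[of False] split[of True] split[of False] by auto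
qed

section \<open>The graph of a sparse formula\<close>

text \<open>Restriction to the colours in \<open>S\<close> deletes edges instead of vertices. The
  vertex set remains \<open>{..<V}\<close>, as \<open>input_graphs\<close> demands, and isolated
  vertices lie in no scorpion.\<close>

definition colour_graph :: "nat \<Rightarrow> (nat \<Rightarrow> nat \<Rightarrow> bool) \<Rightarrow> (nat \<Rightarrow> nat) \<Rightarrow> nat set \<Rightarrow> nat graph" where
  "colour_graph V adj col S = ({..<V}, {{u, v} | u v. u < V \<and> v < V \<and> adj u v \<and> col u \<in> S \<and> col v \<in> S})"

lemma edges_colour_graph:
  assumes "\<And>u v. adj u v \<Longrightarrow> adj v u"
  shows "{u, v} \<in> edges (colour_graph V adj col S) \<longleftrightarrow> u < V \<and> v < V \<and> adj u v \<and> col u \<in> S \<and> col v \<in> S"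
  using assms by (auto simp: colour_graph_def doubleton_eq_iff)

lemma colour_graph_input:
  assumes "\<And>u. \<not> adj u u"
  shows "colour_graph V adj col S \<in> input_graphs"
proof -
  have "u \<noteq> v" if "adj u v" for u v using assms[of u] that by auto
  thus ?thesis by (fastforce simp: input_graphs_def simple_graph_def colour_graph_def card_2_iff)
qed

lemma num_verts_colour_graph [simp]: "num_verts (colour_graph V adj col S) = V"
  by (simp add: num_verts_def colour_graph_def)

lemma simple_graph_induced: "simple_graph G \<Longrightarrow> X \<subseteq> verts G \<Longrightarrow> simple_graph (induced_subgraph G X)"
  by (auto simp: simple_graph_def induced_subgraph_def intro: finite_subset)

lemma count_scorpions_colour_graph:
  "count_scorpions k l (colour_graph V adj col S) = card {X \<in> {X. X \<subseteq> {..<V} \<and> card X = k \<and>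
     scorpion l (induced_subgraph (colour_graph V adj col UNIV) X)}. col ` X \<subseteq> S}"
proof -
  have 1: "induced_subgraph (colour_graph V adj col S) X = induced_subgraph (colour_graph V adj col UNIV) X"
    if "col ` X \<subseteq> S" for X
    using that by (auto simp: induced_subgraph_def colour_graph_def) blast
  have 2: "col ` X \<subseteq> S" if "scorpion l (induced_subgraph (colour_graph V adj col S) X)" for X
  proof
    fix c assume "c \<in> col ` X"
    then obtain v where v: "v \<in> X" "c = col v" by blast
    with scorpion_no_isolated[OF that, of v] show "c \<in> S"
      by (auto simp: induced_subgraph_def colour_graph_def)
  qed
  have "scorpion l (induced_subgraph (colour_graph V adj col S) X) \<longleftrightarrow>
    scorpion l (induced_subgraph (colour_graph V adj col UNIV) X) \<and> col ` X \<subseteq> S" for X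
    using 1[of X] 2[of X] by metis
  thus ?thesis by (simp add: count_scorpions_def colour_graph_def conj_ac)
qed

lemma colourful_scorpion:
  assumes "\<And>u. \<not> adj u u"
  shows "(\<Sum>S | S \<subseteq> {..<k} \<and> even (card S). count_scorpions k l (colour_graph V adj col S)) \<noteq>
     (\<Sum>S | S \<subseteq> {..<k} \<and> odd (card S). count_scorpions k l (colour_graph V adj col S)) \<longleftrightarrow>
     (\<exists>X. X \<subseteq> {..<V} \<and> card X = k \<and> scorpion l (induced_subgraph (colour_graph V adj col UNIV) X) \<and> col ` X = {..<k})"
proof -
  have "finite {X. X \<subseteq> {..<V} \<and> card X = k \<and> scorpion l (induced_subgraph (colour_graph V adj col UNIV) X)}"
    by (rule finite_subset[of _ "Pow {..<V}"]) auto
  from even_odd_subsets_sum[OF this, of "{..<k}" "\<lambda>X. col ` X"] show ?thesis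
    unfolding count_scorpions_colour_graph by auto
qed

text \<open>A set of \<open>k\<close> vertices that meets all \<open>k\<close> colours has one
  vertex of each. Adjacency to the body and within the tail depends on colours alone, so every such
  set induces \<open>tagged_vertices\<close> and only the pairs of a tail vertex and a leg
  decide.\<close>

lemma colourful_scorpion_iff:
  assumes kl: "0 < l" "2 * l + 4 \<le> k"
    and adj: "\<And>u v. adj u v \<Longrightarrow> adj v u" "\<And>u. \<not> adj u u"
    and body: "\<And>u v. col u = 0 \<Longrightarrow> 0 < col v \<Longrightarrow> col v < k \<Longrightarrow> adj u v \<longleftrightarrow> col v = 1 \<or> l + 2 \<le> col v"
    and tail: "\<And>u v. 0 < col u \<Longrightarrow> col u < col v \<Longrightarrow> col v < l + 2 \<Longrightarrow> adj u v \<longleftrightarrow> col v = Suc (col u)"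
  shows "(\<exists>X. X \<subseteq> {..<V} \<and> card X = k \<and> scorpion l (induced_subgraph (colour_graph V adj col UNIV) X) \<and> col ` X = {..<k})
    \<longleftrightarrow> (\<exists>vt. (\<forall>c<k. vt c < V \<and> col (vt c) = c) \<and> (\<forall>c c'. 0 < c \<and> c < l + 2 \<and> l + 2 \<le> c' \<and> c' < k \<longrightarrow> \<not> adj (vt c) (vt c')))"
proof -
  let ?G = "colour_graph V adj col UNIV"
  have simple: "simple_graph ?G" using colour_graph_input[of adj V col UNIV] adj(2) by (simp add: input_graphs_def)
  have tv: "tagged_vertices k l vt (induced_subgraph ?G (vt ` {..<k}))"
    and inj: "inj_on vt {..<k}"
    and E: "\<And>c c'. c < k \<Longrightarrow> c' < k \<Longrightarrow> {vt c, vt c'} \<in> edges (induced_subgraph ?G (vt ` {..<k})) \<longleftrightarrow> adj (vt c) (vt c')"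
    if vt: "\<And>c. c < k \<Longrightarrow> vt c < V \<and> col (vt c) = c" for vt
  proof -
    have sub: "vt ` {..<k} \<subseteq> {..<V}" using vt by auto
    show "inj_on vt {..<k}" by (rule inj_onI) (metis lessThan_iff vt)
    show E: "{vt c, vt c'} \<in> edges (induced_subgraph ?G (vt ` {..<k})) \<longleftrightarrow> adj (vt c) (vt c')" if "c < k" "c' < k" for c c'
      using that vt edges_colour_graph[of adj "vt c" "vt c'" V col UNIV, OF adj(1)] by (auto simp: induced_subgraph_def)
    show "tagged_vertices k l vt (induced_subgraph ?G (vt ` {..<k}))"
    proof
      show "simple_graph (induced_subgraph ?G (vt ` {..<k}))"
        by (rule simple_graph_induced[OF simple]) (use sub in \<open>simp add: colour_graph_def\<close>)
      show "inj_on vt {..<k}" by fact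
      show "verts (induced_subgraph ?G (vt ` {..<k})) = vt ` {..<k}" by (simp add: induced_subgraph_def)
    next
      fix c assume "0 < c" "c < k"
      thus "{vt 0, vt c} \<in> edges (induced_subgraph ?G (vt ` {..<k})) \<longleftrightarrow> c = 1 \<or> l + 2 \<le> c"
        using E[of 0 c] body[of "vt 0" "vt c"] vt[of 0] vt[of c] by auto
    next
      fix c c' assume "0 < c" "c < c'" "c' < l + 2"
      thus "{vt c, vt c'} \<in> edges (induced_subgraph ?G (vt ` {..<k})) \<longleftrightarrow> c' = Suc c"
        using E[of c c'] tail[of "vt c" "vt c'"] vt[of c] vt[of c'] kl by auto
    qed (use kl in auto)
  qed
  show ?thesis
  proof
    assume "\<exists>X. X \<subseteq> {..<V} \<and> card X = k \<and> scorpion l (induced_subgraph ?G X) \<and> col ` X = {..<k}"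
    then obtain X where X: "X \<subseteq> {..<V}" "card X = k" "scorpion l (induced_subgraph ?G X)" "col ` X = {..<k}" by blast
    have "finite X" using X(1) finite_subset by blast
    hence inj: "inj_on col X" using X by (intro eq_card_imp_inj_on) auto
    define vt where "vt = the_inv_into X col"
    have vt: "vt c \<in> X" "col (vt c) = c" if "c < k" for c
      using the_inv_into_into[OF inj, of c X] f_the_inv_into_f[OF inj, of c] X(4) that by (auto simp: vt_def)
    have X_eq: "X = vt ` {..<k}"
    proof -
      have "vt ` col ` X = X" by (simp add: vt_def image_image the_inv_into_f_f[OF inj])
      thus ?thesis using X(4) by simp
    qed
    have vt': "vt c < V \<and> col (vt c) = c" if "c < k" for c using vt[OF that] X(1) by auto
    from tv[OF vt'] interpret tagged_vertices k l vt "induced_subgraph ?G (vt ` {..<k})" by blast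
    show "\<exists>vt. (\<forall>c<k. vt c < V \<and> col (vt c) = c) \<and> (\<forall>c c'. 0 < c \<and> c < l + 2 \<and> l + 2 \<le> c' \<and> c' < k \<longrightarrow> \<not> adj (vt c) (vt c'))"
      using vt' scorpionD[OF X(3)[unfolded X_eq]] E[OF vt'] by (intro exI[of _ vt]) auto
  next
    assume "\<exists>vt. (\<forall>c<k. vt c < V \<and> col (vt c) = c) \<and> (\<forall>c c'. 0 < c \<and> c < l + 2 \<and> l + 2 \<le> c' \<and> c' < k \<longrightarrow> \<not> adj (vt c) (vt c'))"
    then obtain vt where vt: "\<And>c. c < k \<Longrightarrow> vt c < V \<and> col (vt c) = c" 
      and na: "\<And>c c'. 0 < c \<Longrightarrow> c < l + 2 \<Longrightarrow> l + 2 \<le> c' \<Longrightarrow> c' < k \<Longrightarrow> \<not> adj (vt c) (vt c')" by blast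
    note vt' = vt
    from tv[OF vt] interpret tagged_vertices k l vt "induced_subgraph ?G (vt ` {..<k})" by blast
    have "scorpion l (induced_subgraph ?G (vt ` {..<k}))"
      by (rule scorpionI) (use na E[OF vt'] in auto)
    moreover have "card (vt ` {..<k}) = k" using inj[OF vt'] by (simp add: card_image)
    moreover have "col ` vt ` {..<k} = {..<k}" using vt' by (force simp: image_image)
    moreover have "vt ` {..<k} \<subseteq> {..<V}" using vt' by auto
    ultimately show "\<exists>X. X \<subseteq> {..<V} \<and> card X = k \<and> scorpion l (induced_subgraph ?G X) \<and> col ` X = {..<k}" by blast
  qed
qed

section \<open>Assignments and choices of literals as numbers\<close>

lemma ex_digits:
  fixes f :: "nat \<Rightarrow> nat"
  assumes "\<And>q. f q < B"
  shows "\<exists>x<B ^ Q. \<forall>q<Q. x div B ^ q mod B = f q"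
proof (induction Q)
  case (Suc Q)
  then obtain x where x: "x < B ^ Q" "\<forall>q<Q. x div B ^ q mod B = f q" by blast
  have B: "0 < B" using assms[of 0] by simp
  let ?y = "x + f Q * B ^ Q"
  have "?y < B ^ Q + f Q * B ^ Q" using x(1) by simp
  also have "\<dots> \<le> B ^ Suc Q" using assms[of Q] mult_le_mono1[of "Suc (f Q)" B "B ^ Q"] by simp
  finally have "?y < B ^ Suc Q" .
  moreover have "?y div B ^ q mod B = f q" if "q < Suc Q" for q
  proof (cases "q = Q")
    case True
    thus ?thesis using x(1) B assms[of Q] by (simp add: div_mult_self1)
  next
    case False
    with that have q: "q < Q" by simp
    then obtain j where j: "Q = Suc (q + j)" using less_imp_Suc_add by blast
    have "?y = x + (f Q * B ^ j * B) * B ^ q" by (simp add: j power_add mult_ac)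
    hence "?y div B ^ q = x div B ^ q + f Q * B ^ j * B" by (simp only:) (use B in simp)
    thus ?thesis using x(2) q by simp
  qed
  ultimately show ?case by blast
qed simp

text \<open>Literals are numbers as produced by \<open>encode_literal\<close>: the half is the
  variable, the parity the sign.\<close>

definition lit_true :: "(nat \<Rightarrow> bool) \<Rightarrow> nat \<Rightarrow> bool" where
  "lit_true \<alpha> y \<longleftrightarrow> \<alpha> (y div 2) = odd y"

text \<open>
  The clauses \<open>E\<close> are distributed over \<open>L\<close> groups by \<open>rank\<close> modulo \<open>L\<close>, and a leg of group \<open>j\<close> chooses
  with its base-4 digits one of the literals \<open>lit e 0\<close>, \<open>lit e 1\<close>, \<open>lit e 2\<close> in every clause \<open>e\<close> of the group.
  The variables are distributed over \<open>r\<close> blocks by \<open>v mod r\<close>, and the binary digits of \<open>a\<close> are the truth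
  values in block \<open>i\<close>.
\<close>

definition chosen :: "(nat \<Rightarrow> nat \<Rightarrow> nat) \<Rightarrow> nat \<Rightarrow> nat \<Rightarrow> nat \<Rightarrow> nat" where
  "chosen lit e q x = lit e (min 2 (x div 4 ^ q mod 4))"

definition conflict :: "nat set \<Rightarrow> (nat \<Rightarrow> nat) \<Rightarrow> (nat \<Rightarrow> nat \<Rightarrow> nat) \<Rightarrow> nat \<Rightarrow> nat \<Rightarrow> nat \<Rightarrow> nat \<Rightarrow> nat \<Rightarrow> nat \<Rightarrow> bool" where
  "conflict E rank lit r L i a j x \<longleftrightarrow> (\<exists>e\<in>E. rank e mod L = j \<and>
     chosen lit e (rank e div L) x div 2 mod r = i \<and>
     bit a (chosen lit e (rank e div L) x div 2 div r) \<noteq> odd (chosen lit e (rank e div L) x))"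

text \<open>Every clause belongs to one group and every variable to one block, so a consistent
  choice is checked by looking at each pair of block and group. The width \<open>w\<close> has to
  offer one bit per variable of a block and two bits per clause of a group.\<close>

lemma conflict_free_iff:
  assumes rank: "inj_on rank E" "\<And>e. e \<in> E \<Longrightarrow> rank e div L < Q" and lit: "\<And>e d. e \<in> E \<Longrightarrow> lit e d < 2 * n"
    and r: "0 < r" and L: "0 < L" and W: "n div r < w" "2 * Q \<le> w"
  shows "(\<exists>a x. (\<forall>i<r. a i < 2 ^ w) \<and> (\<forall>j<L. x j < 2 ^ w) \<and> (\<forall>i<r. \<forall>j<L. \<not> conflict E rank lit r L i (a i) j (x j)))
    \<longleftrightarrow> (\<exists>\<alpha>. \<forall>e\<in>E. \<exists>d<3. lit_true \<alpha> (lit e d))" (is "?L \<longleftrightarrow> ?R")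
proof
  assume ?L
  then obtain a x where ax: "\<And>i j. i < r \<Longrightarrow> j < L \<Longrightarrow> \<not> conflict E rank lit r L i (a i) j (x j)" by blast
  define \<alpha> where "\<alpha> v = bit (a (v mod r)) (v div r)" for v
  have "\<exists>d<3. lit_true \<alpha> (lit e d)" if e: "e \<in> E" for e
  proof -
    define d where "d = min 2 (x (rank e mod L) div 4 ^ (rank e div L) mod 4)"
    have ch: "chosen lit e (rank e div L) (x (rank e mod L)) = lit e d" by (simp add: chosen_def d_def)
    from ax[of "lit e d div 2 mod r" "rank e mod L"] have "bit (a (lit e d div 2 mod r)) (lit e d div 2 div r) = odd (lit e d)"
      using r L e ch unfolding conflict_def by fastforce
    hence "lit_true \<alpha> (lit e d)" by (simp add: lit_true_def \<alpha>_def)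
    moreover have "d < 3" by (simp add: d_def)
    ultimately show ?thesis by blast
  qed
  thus ?R by blast
next
  assume ?R
  then obtain \<alpha> where "\<forall>e\<in>E. \<exists>d<3. lit_true \<alpha> (lit e d)" by blast
  then obtain d where d: "\<And>e. e \<in> E \<Longrightarrow> d e < 3 \<and> lit_true \<alpha> (lit e (d e))" by metis
  have "\<exists>y<(2::nat) ^ w. \<forall>t<w. y div 2 ^ t mod 2 = of_bool (\<alpha> (t * r + i))" for i
    by (rule ex_digits) simp
  hence "\<forall>i. \<exists>y<(2::nat) ^ w. \<forall>t<w. y div 2 ^ t mod 2 = of_bool (\<alpha> (t * r + i))" by blast
  hence "\<exists>a. \<forall>i. a i < (2::nat) ^ w \<and> (\<forall>t<w. a i div 2 ^ t mod 2 = of_bool (\<alpha> (t * r + i)))"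
    by (rule choice)
  then obtain a :: "nat \<Rightarrow> nat" where a: "\<And>i. a i < 2 ^ w" "\<And>i t. t < w \<Longrightarrow> a i div 2 ^ t mod 2 = of_bool (\<alpha> (t * r + i))"
    by blast
  have bit_a: "bit (a i) t = \<alpha> (t * r + i)" if "t < w" for i t
    using a(2)[OF that, of i] by (auto simp: bit_iff_odd odd_iff_mod_2_eq_one)
  \<comment> \<open>Positions of a group that belong to no clause get the default digit 0.\<close>
  define ch where "ch j q = (if \<exists>e\<in>E. rank e = q * L + j then d (the_inv_into E rank (q * L + j)) else 0)" for j q
  have ch: "ch (rank e mod L) (rank e div L) = d e" if "e \<in> E" for e
    using that the_inv_into_f_f[OF rank(1)] by (auto simp: ch_def)
  have "ch j q < 3" for j q
  proof (cases "\<exists>e\<in>E. rank e = q * L + j")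
    case True
    then obtain e where "e \<in> E" "rank e = q * L + j" by blast
    thus ?thesis using d[of e] the_inv_into_f_f[OF rank(1), of e] unfolding ch_def by auto
  qed (simp add: ch_def)
  hence c3: "ch j q < 3" for j q by blast
  have "ch j q < 4" for j q using c3[of j q] less_trans[of "ch j q" 3 4] by simp
  hence "\<exists>y<4 ^ Q. \<forall>q<Q. y div 4 ^ q mod 4 = ch j q" for j by (intro ex_digits)
  hence "\<forall>j. \<exists>y<4 ^ Q. \<forall>q<Q. y div 4 ^ q mod 4 = ch j q" by blast
  hence "\<exists>x. \<forall>j. x j < 4 ^ Q \<and> (\<forall>q<Q. x j div 4 ^ q mod 4 = ch j q)" by (rule choice)
  then obtain x :: "nat \<Rightarrow> nat" where x: "\<And>j. x j < 4 ^ Q" "\<And>j q. q < Q \<Longrightarrow> x j div 4 ^ q mod 4 = ch j q" by blast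
  have "(4::nat) ^ Q = 2 ^ (2 * Q)" by (simp add: power_mult)
  also have "\<dots> \<le> 2 ^ w" by (rule power_increasing[OF W(2)]) simp
  finally have "x j < 2 ^ w" for j using x(1)[of j] by simp
  moreover have "\<not> conflict E rank lit r L i (a i) j (x j)" if "i < r" "j < L" for i j
  proof
    assume "conflict E rank lit r L i (a i) j (x j)"
    then obtain e where e: "e \<in> E" "rank e mod L = j" "chosen lit e (rank e div L) (x j) div 2 mod r = i"
      "bit (a i) (chosen lit e (rank e div L) (x j) div 2 div r) \<noteq> odd (chosen lit e (rank e div L) (x j))"
      unfolding conflict_def by blast
    define y where "y = lit e (d e)"
    have "x j div 4 ^ (rank e div L) mod 4 = d e" using x(2)[OF rank(2)[OF e(1)], of j] ch[OF e(1)] e(2) by simp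
    hence y: "chosen lit e (rank e div L) (x j) = y" using d[OF e(1)] by (simp add: chosen_def y_def)
    have "y div 2 < n" using lit[OF e(1), of "d e"] by (simp add: y_def)
    hence "y div 2 div r \<le> n div r" by (intro div_le_mono) simp
    hence "y div 2 div r < w" using W by simp
    hence "bit (a i) (y div 2 div r) = \<alpha> (y div 2)" using bit_a[of "y div 2 div r" i] e(3) y div_mult_mod_eq[of "y div 2" r] by metis
    with e(4) y d[OF e(1)] show False by (simp add: lit_true_def y_def)
  qed
  ultimately show ?L using a(1) by blast
qed

text \<open>Colour 0 is the body, colours 1 to \<open>l + 1\<close> are the blocks of the tail, and
  colours from \<open>l + 2\<close> on are the groups of legs; hence the shifted arguments of
  \<open>conf\<close>. Two legs are never adjacent.\<close>

definition half_adj :: "nat \<Rightarrow> (nat \<Rightarrow> nat \<Rightarrow> nat \<Rightarrow> nat \<Rightarrow> bool) \<Rightarrow> nat \<Rightarrow> nat \<Rightarrow> nat \<Rightarrow> nat \<Rightarrow> bool" where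
  "half_adj l conf c a c' a' \<longleftrightarrow> c < c' \<and>
     (if c = 0 then c' = 1 \<or> l + 2 \<le> c' else if c' < l + 2 then c' = Suc c 
      else c < l + 2 \<and> conf (c - 1) a (c' - (l + 2)) a')"

definition vertex_adj :: "nat \<Rightarrow> nat \<Rightarrow> (nat \<Rightarrow> nat \<Rightarrow> nat \<Rightarrow> nat \<Rightarrow> bool) \<Rightarrow> nat \<Rightarrow> nat \<Rightarrow> bool" where
  "vertex_adj l w conf u v \<longleftrightarrow>
     half_adj l conf (u div 2 ^ w) (u mod 2 ^ w) (v div 2 ^ w) (v mod 2 ^ w) \<or>
     half_adj l conf (v div 2 ^ w) (v mod 2 ^ w) (u div 2 ^ w) (u mod 2 ^ w)"

text \<open>A vertex is its colour followed by \<open>w\<close> bits. \<open>V\<close> may exceed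
  \<open>k * 2 ^ w\<close>: surplus vertices have colours from \<open>k\<close> on and are isolated
  for \<open>S \<subseteq> {..<k}\<close>. This allows \<open>V\<close> to be rounded up to a power
  of two.\<close>

lemma vertex_adj_iff:
  assumes kl: "0 < l" "2 * l + 4 \<le> k" and V: "k * 2 ^ w \<le> V"
  shows "(\<Sum>S | S \<subseteq> {..<k} \<and> even (card S). count_scorpions k l (colour_graph V (vertex_adj l w conf) (\<lambda>v. v div 2 ^ w) S)) \<noteq>
     (\<Sum>S | S \<subseteq> {..<k} \<and> odd (card S). count_scorpions k l (colour_graph V (vertex_adj l w conf) (\<lambda>v. v div 2 ^ w) S)) \<longleftrightarrow>
    (\<exists>a x. (\<forall>i<l + 1. a i < 2 ^ w) \<and> (\<forall>j<k - l - 2. x j < 2 ^ w) \<and> (\<forall>i<l + 1. \<forall>j<k - l - 2. \<not> conf i (a i) j (x j)))"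
proof -
  let ?adj = "vertex_adj l w conf" and ?col = "\<lambda>v. v div 2 ^ w"
  have sym: "?adj u v \<Longrightarrow> ?adj v u" and irr: "\<not> ?adj u u" for u v by (auto simp: vertex_adj_def half_adj_def)
  have "(\<exists>vt. (\<forall>c<k. vt c < V \<and> ?col (vt c) = c) \<and> (\<forall>c c'. 0 < c \<and> c < l + 2 \<and> l + 2 \<le> c' \<and> c' < k \<longrightarrow> \<not> ?adj (vt c) (vt c')))
    \<longleftrightarrow> (\<exists>a x. (\<forall>i<l + 1. a i < 2 ^ w) \<and> (\<forall>j<k - l - 2. x j < 2 ^ w) \<and> (\<forall>i<l + 1. \<forall>j<k - l - 2. \<not> conf i (a i) j (x j)))"
    (is "?L \<longleftrightarrow> ?R")
  proof
    assume ?L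
    then obtain vt where vt: "\<And>c. c < k \<Longrightarrow> vt c < V \<and> ?col (vt c) = c" 
      and na: "\<And>c c'. 0 < c \<Longrightarrow> c < l + 2 \<Longrightarrow> l + 2 \<le> c' \<Longrightarrow> c' < k \<Longrightarrow> \<not> ?adj (vt c) (vt c')" by blast
    have "\<not> conf i (vt (i + 1) mod 2 ^ w) j (vt (j + l + 2) mod 2 ^ w)" if "i < l + 1" "j < k - l - 2" for i j
      using that na[of "i + 1" "j + l + 2"] vt[of "i + 1"] vt[of "j + l + 2"] by (auto simp: vertex_adj_def half_adj_def)
    thus ?R by (intro exI[of _ "\<lambda>i. vt (i + 1) mod 2 ^ w"] exI[of _ "\<lambda>j. vt (j + l + 2) mod 2 ^ w"]) auto
  next
    assume ?R
    then obtain a x where ax: "\<And>i. i < l + 1 \<Longrightarrow> a i < 2 ^ w" "\<And>j. j < k - l - 2 \<Longrightarrow> x j < 2 ^ w"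
      "\<And>i j. i < l + 1 \<Longrightarrow> j < k - l - 2 \<Longrightarrow> \<not> conf i (a i) j (x j)" by blast
    define g where "g c = (if c = 0 then 0 else if c < l + 2 then a (c - 1) else x (c - (l + 2)))" for c
    define vt where "vt c = c * 2 ^ w + g c" for c
    have g: "g c < 2 ^ w" if "c < k" for c using ax(1)[of "c - 1"] ax(2)[of "c - (l + 2)"] that kl by (auto simp: g_def)
    have vt1: "vt c div 2 ^ w = c" "vt c mod 2 ^ w = g c" if "c < k" for c
      using g[OF that] by (simp_all add: vt_def)
    have vt2: "vt c < V" if "c < k" for c
    proof -
      have "vt c < Suc c * 2 ^ w" using g[OF that] by (simp add: vt_def)
      also have "\<dots> \<le> k * 2 ^ w" using that by (intro mult_le_mono1) simp
      finally show ?thesis using V by simp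
    qed
    have "\<not> ?adj (vt c) (vt c')" if "0 < c" "c < l + 2" "l + 2 \<le> c'" "c' < k" for c c'
      using that vt1[of c] vt1[of c'] ax(3)[of "c - 1" "c' - (l + 2)"] 
      by (auto simp: vertex_adj_def half_adj_def g_def)
    thus ?L using vt1 vt2 by (intro exI[of _ vt]) auto
  qed
  moreover have "(\<exists>X. X \<subseteq> {..<V} \<and> card X = k \<and> scorpion l (induced_subgraph (colour_graph V ?adj ?col UNIV) X) \<and> ?col ` X = {..<k})
    \<longleftrightarrow> ?L"
    by (rule colourful_scorpion_iff[OF kl sym irr]) (auto simp: vertex_adj_def half_adj_def)
  ultimately show ?thesis using colourful_scorpion[of ?adj k l V ?col, OF irr] by simp
qed

lemma concat_map_upt:
  "concat (map (\<lambda>i. map (f i) [0..<n]) [0..<m]) = map (\<lambda>e. f (e div n) (e mod n)) [0..<m * n]"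
proof (induction m)
  case (Suc m)
  have "[0..<Suc m * n] = [0..<m * n] @ map (\<lambda>j. m * n + j) [0..<n]"
    using upt_add_eq_append[of 0 "m * n" n] by (simp add: add.commute map_add_upt)
  with Suc show ?case by auto
qed simp

text \<open>Access by address is the form in which \<open>computable_call\<close> can supply a
  matrix on demand.\<close>

lemma encode_graph_eq:
  "encode_graph G = map (\<lambda>e. if e = 0 then num_verts G else
     of_bool ({(e - 1) div num_verts G, (e - 1) mod num_verts G} \<in> edges G)) [0..<Suc (num_verts G * num_verts G)]"
proof -
  let ?n = "num_verts G"
  have "[0..<Suc (?n * ?n)] = 0 # map Suc [0..<?n * ?n]" by (simp add: map_Suc_upt upt_conv_Cons)
  hence "map (\<lambda>e. if e = 0 then ?n else of_bool ({(e - 1) div ?n, (e - 1) mod ?n} \<in> edges G)) [0..<Suc (?n * ?n)]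
    = ?n # map (\<lambda>e. of_bool ({e div ?n, e mod ?n} \<in> edges G)) [0..<?n * ?n]"
    by (simp add: comp_def)
  also have "\<dots> = encode_graph G" unfolding encode_graph_def 
    by (simp only: concat_map_upt)
  finally show ?thesis by simp
qed

section \<open>Sublinear running time\<close>

text \<open>Allows the run transferred to the planted graph to be identified with the run that the
  algorithm promises there.\<close>

lemma exec_deterministic:
  "exec p st t st' \<Longrightarrow> exec p st u st'' \<Longrightarrow> t = u \<and> st' = st''"
proof (induction arbitrary: u st'' rule: exec.induct)
  case (Seq p st t st' q u' st3)
  from Seq.prems obtain t1 u1 st1 where "u = t1 + u1" "exec p st t1 st1" "exec q st1 u1 st''"
    by (cases rule: exec.cases) auto
  with Seq.IH show ?case by blast
next
  case (If_true st x p t st' q)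
  from If_true.prems If_true.hyps obtain u1 where "u = Suc u1" "exec p st u1 st''"
    by (cases rule: exec.cases) auto
  with If_true.IH show ?case by blast
next
  case (If_false st x q t st' p)
  from If_false.prems If_false.hyps obtain u1 where "u = Suc u1" "exec q st u1 st''"
    by (cases rule: exec.cases) auto
  with If_false.IH show ?case by blast
next
  case (While_done st x p)
  from While_done.prems While_done.hyps show ?case by (cases rule: exec.cases) auto
next
  case (While_step st x p t st' u' st3)
  from While_step.prems While_step.hyps(1) obtain t1 u1 st1 where
    "u = Suc (t1 + u1)" "exec p st t1 st1" "exec (While x p) st1 u1 st''"
    by (cases rule: exec.cases) auto
  with While_step.IH show ?case by blast
qed (erule exec.cases; simp)+

text \<open>\<open>R\<close> contains all addresses whose initial contents can influence the run;
  one step reads at most one. The final clause, that agreement at single addresses survives the run,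
  makes the property compose along \<open>Seq\<close> and \<open>While\<close>.\<close>

definition reads_only :: "prog \<Rightarrow> state \<Rightarrow> nat \<Rightarrow> state \<Rightarrow> nat set \<Rightarrow> bool" where
  "reads_only p st t st' R \<longleftrightarrow> finite R \<and> card R \<le> t \<and> (\<forall>m. (\<forall>a\<in>R. m a = snd st a) \<longrightarrow>
     (\<exists>m'. exec p (fst st, m) t (fst st', m') \<and> (\<forall>a. m a = snd st a \<longrightarrow> m' a = snd st' a)))"

lemma exec_reads_only: "exec p st t st' \<Longrightarrow> \<exists>R. reads_only p st t st' R"
proof (induction rule: exec.induct)
  case (Const x c r m)
  show ?case by (rule exI[of _ "{}"]) (auto simp: reads_only_def intro: exec.Const[simplified])
next
  case (Copy x y r m)
  show ?case by (rule exI[of _ "{}"]) (auto simp: reads_only_def intro: exec.Copy[simplified])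
next
  case (Add x y z r m)
  show ?case by (rule exI[of _ "{}"]) (auto simp: reads_only_def intro: exec.Add[simplified])
next
  case (Sub x y z r m)
  show ?case by (rule exI[of _ "{}"]) (auto simp: reads_only_def intro: exec.Sub[simplified])
next
  case (Half x y r m)
  show ?case by (rule exI[of _ "{}"]) (auto simp: reads_only_def intro: exec.Half[simplified])
next
  case (Load x y r m)
  have "exec (Load x y) (r, m') 1 (r(x := m (r y)), m')" if "m' (r y) = m (r y)" for m'
    using exec.Load[of x y r m'] that by simp
  thus ?case by (intro exI[of _ "{r y}"]) (auto simp: reads_only_def)
next
  case (Store x y r m)
  have "\<exists>m''. exec (Store x y) (r, m') 1 (r, m'') \<and>
     (\<forall>a. m' a = m a \<longrightarrow> m'' a = (m(r x := r y)) a)" for m'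
    using exec.Store[of x y r m'] by (intro exI[of _ "m'(r x := r y)"]) simp
  hence "reads_only (Store x y) (r, m) 1 (r, m(r x := r y)) {}"
    unfolding reads_only_def fst_conv snd_conv by (simp only: finite.emptyI card.empty zero_le simp_thms)
  thus ?case by (rule exI)
next
  case (Seq p st t st' q u st'')
  then obtain R S where R: "reads_only p st t st' R" and S: "reads_only q st' u st'' S" by blast
  have "reads_only (Seq p q) st (t + u) st'' (R \<union> S)"
    unfolding reads_only_def
  proof (intro conjI allI impI)
    show "finite (R \<union> S)" using R S by (simp add: reads_only_def)
    show "card (R \<union> S) \<le> t + u" using R S card_Un_le[of R S] by (simp add: reads_only_def)
    fix m assume m: "\<forall>a\<in>R \<union> S. m a = snd st a"
    with R obtain m1 where 1: "exec p (fst st, m) t (fst st', m1)" "\<forall>a. m a = snd st a \<longrightarrow> m1 a = snd st' a"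
      unfolding reads_only_def by blast
    with m have "\<forall>a\<in>S. m1 a = snd st' a" by blast
    with S obtain m2 where 2: "exec q (fst st', m1) u (fst st'', m2)" "\<forall>a. m1 a = snd st' a \<longrightarrow> m2 a = snd st'' a"
      unfolding reads_only_def by blast
    from exec.Seq[OF 1(1) 2(1)] 1(2) 2(2) show "\<exists>m'. exec (Seq p q) (fst st, m) (t + u) (fst st'', m') \<and> (\<forall>a. m a = snd st a \<longrightarrow> m' a = snd st'' a)"
      by blast
  qed
  thus ?case by blast
next
  case (If_true st x p t st' q)
  then obtain R where R: "reads_only p st t st' R" by blast
  have "exec (If x p q) (fst st, m) (Suc t) s'" if "exec p (fst st, m) t s'" for m s'
    by (rule exec.If_true) (use If_true.hyps that in auto)
  with R have "reads_only (If x p q) st (Suc t) st' R" unfolding reads_only_def by (meson le_SucI)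
  thus ?case by blast
next
  case (If_false st x q t st' p)
  then obtain R where R: "reads_only q st t st' R" by blast
  have "exec (If x p q) (fst st, m) (Suc t) s'" if "exec q (fst st, m) t s'" for m s'
    by (rule exec.If_false) (use If_false.hyps that in auto)
  with R have "reads_only (If x p q) st (Suc t) st' R" unfolding reads_only_def by (meson le_SucI)
  thus ?case by blast
next
  case (While_done st x p)
  have "exec (While x p) (fst st, m) 1 (fst st, m)" for m by (rule exec.While_done) (use While_done in simp)
  thus ?case by (intro exI[of _ "{}"]) (auto simp: reads_only_def)
next
  case (While_step st x p t st' u st'')
  then obtain R S where R: "reads_only p st t st' R" and S: "reads_only (While x p) st' u st'' S" by blast
  have "reads_only (While x p) st (Suc (t + u)) st'' (R \<union> S)"
    unfolding reads_only_def
  proof (intro conjI allI impI)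
    show "finite (R \<union> S)" using R S by (simp add: reads_only_def)
    show "card (R \<union> S) \<le> Suc (t + u)" using R S card_Un_le[of R S] by (simp add: reads_only_def)
    fix m assume m: "\<forall>a\<in>R \<union> S. m a = snd st a"
    with R obtain m1 where 1: "exec p (fst st, m) t (fst st', m1)" "\<forall>a. m a = snd st a \<longrightarrow> m1 a = snd st' a"
      unfolding reads_only_def by blast
    with m have "\<forall>a\<in>S. m1 a = snd st' a" by blast
    with S obtain m2 where 2: "exec (While x p) (fst st', m1) u (fst st'', m2)" "\<forall>a. m1 a = snd st' a \<longrightarrow> m2 a = snd st'' a"
      unfolding reads_only_def by blast
    have "exec (While x p) (fst st, m) (Suc (t + u)) (fst st'', m2)"
      by (rule exec.While_step[OF _ 1(1) 2(1)]) (use While_step.hyps in simp)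
    with 1(2) 2(2) show "\<exists>m'. exec (While x p) (fst st, m) (Suc (t + u)) (fst st'', m') \<and> (\<forall>a. m a = snd st a \<longrightarrow> m' a = snd st'' a)"
      by blast
  qed
  thus ?case by blast
qed

text \<open>A single scorpion on the vertices from \<open>s\<close> to \<open>s + k - 1\<close>. All
  its edges are matrix entries whose row and column lie in this block.\<close>

definition planted :: "nat \<Rightarrow> nat \<Rightarrow> nat \<Rightarrow> nat \<Rightarrow> nat graph" where
  "planted k l n s = ({..<n}, {{s + a, s + b} | a b. a < b \<and> b < k \<and> (if a = 0 then b = 1 \<or> l + 2 \<le> b else b < l + 2 \<and> b = Suc a)})"

lemma edge_planted:
  assumes "a < b" "b < k"
  shows "{s + a, s + b} \<in> edges (planted k l n s) \<longleftrightarrow> (if a = 0 then b = 1 \<or> l + 2 \<le> b else b < l + 2 \<and> b = Suc a)"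
  using assms by (auto simp: planted_def doubleton_eq_iff)

lemma planted_input: "s + k \<le> n \<Longrightarrow> planted k l n s \<in> input_graphs"
  by (auto simp: input_graphs_def simple_graph_def planted_def card_insert_if)

lemma count_planted:
  assumes kl: "0 < l" "2 * l + 4 \<le> k" and n: "s + k \<le> n"
  shows "count_scorpions k l (planted k l n s) \<noteq> 0"
proof -
  let ?G = "planted k l n s" and ?vt = "\<lambda>c. s + c"
  let ?X = "?vt ` {..<k}"
  have X: "?X \<subseteq> {..<n}" using n by auto
  have E: "{s + c, s + c'} \<in> edges (induced_subgraph ?G ?X) \<longleftrightarrow> (if c = 0 then c' = 1 \<or> l + 2 \<le> c' else c' < l + 2 \<and> c' = Suc c)"
    if "c < c'" "c' < k" for c c'
    using edge_planted[OF that, of s l n] that by (simp add: induced_subgraph_def)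
  interpret tagged_vertices k l ?vt "induced_subgraph ?G ?X"
  proof
    show "simple_graph (induced_subgraph ?G ?X)"
      by (rule simple_graph_induced) (use planted_input[OF n, of l] X in \<open>auto simp: input_graphs_def planted_def\<close>)
    show "inj_on ?vt {..<k}" by (auto simp: inj_on_def)
    show "verts (induced_subgraph ?G ?X) = ?X" by (simp add: induced_subgraph_def)
  next
    fix c assume "0 < c" "c < k"
    thus "{s + 0, s + c} \<in> edges (induced_subgraph ?G ?X) \<longleftrightarrow> c = 1 \<or> l + 2 \<le> c" using E[of 0 c] by simp
  next
    fix c c' assume "0 < c" "c < c'" "c' < l + 2"
    thus "{s + c, s + c'} \<in> edges (induced_subgraph ?G ?X) \<longleftrightarrow> c' = Suc c" using E[of c c'] kl by simp
  qed (use kl in auto)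
  have "scorpion l (induced_subgraph ?G ?X)"
    by (rule scorpionI) (use E in auto)
  hence "?X \<in> {X. X \<subseteq> verts ?G \<and> card X = k \<and> scorpion l (induced_subgraph ?G X)}"
    using X by (simp add: planted_def card_image inj_on_def)
  moreover have "finite {X. X \<subseteq> verts ?G \<and> card X = k \<and> scorpion l (induced_subgraph ?G X)}"
    by (rule finite_subset[of _ "Pow {..<n}"]) (auto simp: planted_def)
  ultimately show ?thesis unfolding count_scorpions_def by (metis card_0_eq empty_iff)
qed

lemma count_empty: "0 < k \<Longrightarrow> count_scorpions k l ({..<n :: nat}, {}) = 0"
proof -
  assume "0 < k"
  have "\<not> scorpion l (induced_subgraph ({..<n :: nat}, {}) X)" if "card X = k" for X :: "nat set"
  proof
    assume "scorpion l (induced_subgraph ({..<n :: nat}, {}) X)"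
    moreover have "X \<noteq> {}" using \<open>card X = k\<close> \<open>0 < k\<close> by auto
    then obtain v where "v \<in> X" by blast
    ultimately show False using scorpion_no_isolated[of l _ v] by (fastforce simp: induced_subgraph_def)
  qed
  thus ?thesis by (simp add: count_scorpions_def)
qed

lemma encode_graph_nth:
  "length (encode_graph G) = Suc (num_verts G * num_verts G)"
  "a < Suc (num_verts G * num_verts G) \<Longrightarrow> encode_graph G ! a = (if a = 0 then num_verts G else
     of_bool ({(a - 1) div num_verts G, (a - 1) mod num_verts G} \<in> edges G))"
  unfolding encode_graph_eq by (simp_all del: upt_Suc)

text \<open>
  With fewer than \<open>n div k\<close> steps some block of \<open>k\<close> consecutive vertices stays unread, so that the
  program cannot tell the empty graph from a graph with a scorpion planted in this block.
\<close>

theorem sublinear_impossible: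
  assumes kl: "0 < l" "2 * l + 4 \<le> k"
    and P: "\<And>G. G \<in> input_graphs \<Longrightarrow> outputs_within P (encode_graph G) (count_scorpions k l G) (T (num_verts G))"
  shows "n div k \<le> T n"
proof (rule ccontr)
  assume "\<not> n div k \<le> T n"
  hence T: "T n < n div k" by simp
  let ?G0 = "({..<n}, {}) :: nat graph"
  have "?G0 \<in> input_graphs" by (auto simp: input_graphs_def simple_graph_def)
  from P[OF this] obtain t st where t: "t \<le> T n" "exec P (init_state (encode_graph ?G0)) t st" "fst st 0 = 0"
    using count_empty[of k l n] kl by (auto simp: outputs_within_def num_verts_def)
  from exec_reads_only[OF t(2)] obtain R where R: "reads_only P (init_state (encode_graph ?G0)) t st R" by blast
  have fR: "finite R" and cR: "card R < n div k" using R t(1) T by (auto simp: reads_only_def)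
  \<comment> \<open>The block of the matrix row to which address \<open>a\<close> belongs; the
    offset skips the header cell. Looking at rows is enough, as both ends of a planted edge lie in
    the same block.\<close>
  define block where "block a = (a - 1) div n div k" for a
  have "card (block ` R) < card {..<n div k}" using card_image_le[OF fR, of block] cR by simp
  hence "\<not> {..<n div k} \<subseteq> block ` R" using card_mono[of "block ` R" "{..<n div k}"] fR by auto
  then obtain j where j: "j < n div k" "j \<notin> block ` R" by blast
  have "Suc j * k \<le> n div k * k" using j(1) by (intro mult_le_mono1) simp
  also have "\<dots> \<le> n" by (rule div_times_less_eq_dividend)
  finally have jk: "j * k + k \<le> n" by simp
  let ?G1 = "planted k l n (j * k)"
  have nv: "num_verts ?G0 = n" "num_verts ?G1 = n" by (simp_all add: num_verts_def planted_def)
  have agree: "snd (init_state (encode_graph ?G1)) a = snd (init_state (encode_graph ?G0)) a" if "a \<in> R" for a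
  \<comment> \<open>The header and the cells behind the matrix depend on \<open>n\<close>
    only.\<close>
  proof (cases "a = 0 \<or> \<not> a < Suc (n * n)")
    case True
    thus ?thesis by (auto simp: init_state_def encode_graph_nth nv)
  next
    case False
    have "{(a - 1) div n, (a - 1) mod n} \<notin> edges ?G1"
    proof
      assume "{(a - 1) div n, (a - 1) mod n} \<in> edges ?G1"
      then obtain c where "(a - 1) div n = j * k + c" "c < k" by (auto simp: planted_def doubleton_eq_iff)
      hence "block a = j" by (simp add: block_def)
      with j(2) that show False by blast
    qed
    thus ?thesis using False by (simp add: init_state_def encode_graph_nth nv)
  qed
  have "fst (init_state (encode_graph ?G1)) = fst (init_state (encode_graph ?G0))" by (simp add: init_state_def)
  then obtain m' where e1: "exec P (init_state (encode_graph ?G1)) t (fst st, m')"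
    using R agree unfolding reads_only_def by (metis prod.collapse)
  from P[OF planted_input[OF jk, of l]] obtain t' st' where
    "exec P (init_state (encode_graph ?G1)) t' st'" "fst st' 0 = count_scorpions k l ?G1"
    unfolding outputs_within_def by blast
  with exec_deterministic[OF e1 this(1)] t(3) count_planted[OF kl jk] show False by auto
qed

section \<open>Formulas as numbers\<close>

lemma pb_diff: "pb C f \<Longrightarrow> pb C (\<lambda>s. f s - g s)"
  by (erule pb_mono) simp

lemma pb_div: "pb C f \<Longrightarrow> pb C (\<lambda>s. f s div g s)"
  by (erule pb_mono) simp

lemma pb_mod: "pb C f \<Longrightarrow> pb C (\<lambda>s. f s mod g s)"
  by (erule pb_mono) simp

lemma pb_If: 
  assumes "pb C f" "pb C g" shows "pb C (\<lambda>s. if P s then f s else g s)"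
  by (rule pb_mono[OF pb_add[OF assms]]) auto

lemma pb_card: "pb C b \<Longrightarrow> pb C (\<lambda>s. card {i. i < b s \<and> P s i})"
proof (erule pb_mono)
  fix s
  have "card {i. i < b s \<and> P s i} \<le> card {..<b s}" by (rule card_mono) auto
  thus "card {i. i < b s \<and> P s i} \<le> b s" by simp
qed

lemma pt_power:
  assumes "pt C f" "pb C f" shows "pt C (\<lambda>s. f s ^ n)"
  by (induction n) (auto intro!: pt_const pt_mult assms)

lemma pt_Suc: "pt C f \<Longrightarrow> pt C (\<lambda>s. Suc (f s))"
  using pt_add[of C f "\<lambda>_. 1"] pt_const[of C 1] by simp

lemma pb_Suc: "pb C f \<Longrightarrow> pb C (\<lambda>s. Suc (f s))"
  using pb_add[of C f "\<lambda>_. 1"] pb_const[of C 1] by simp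

lemmas pt_rules = pt_const pt_add pt_sub pt_mult pt_div pt_mod pt_If pt_of_bool pt_power pt_Suc
  pt_index pt_card pt_sum pt_mask_of
  ptb_le ptb_less ptb_eq ptb_not ptb_conj ptb_disj ptb_imp ptb_const ptb_If ptb_bex ptb_ball ptb_bit ptb_odd
  pb_const pb_add pb_mult pb_power pb_diff pb_div pb_mod pb_If pb_card pb_Suc pb_index
  pt_loop pb_loop

text \<open>A clause is coded by its three literals as digits in base \<open>M\<close>, where
  \<open>M\<close> is the number of literals. Shorter clauses repeat a digit, so a clause can have
  several codes.\<close>

definition lit :: "nat \<Rightarrow> nat \<Rightarrow> nat \<Rightarrow> nat" where
  "lit M e d = (if d = 0 then e div (M * M) else if d = 1 then e div M mod M else e mod M)"

definition clause :: "nat \<Rightarrow> nat \<Rightarrow> nat set" where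
  "clause M e = {lit M e 0, lit M e 1, lit M e 2}"

definition fam :: "nat \<Rightarrow> nat \<Rightarrow> nat set set" where
  "fam M F = clause M ` {e. e < M ^ 3 \<and> bit F e}"

lemma lit_less: "e < M ^ 3 \<Longrightarrow> lit M e d < M"
proof -
  assume e: "e < M ^ 3"
  hence "0 < M" by (cases M) auto
  moreover have "e div (M * M) < M" using e by (intro less_mult_imp_div_less) (simp add: power3_eq_cube)
  ultimately show ?thesis by (simp add: lit_def)
qed

lemma lit_code:
  assumes "a < M" "b < M" "c < M"
  shows "(a * M + b) * M + c < M ^ 3" "lit M ((a * M + b) * M + c) 0 = a" "lit M ((a * M + b) * M + c) 1 = b" "lit M ((a * M + b) * M + c) 2 = c"
proof -
  have M: "0 < M" using assms by simp
  have 1: "((a * M + b) * M + c) div M = a * M + b" using assms by simp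
  hence "((a * M + b) * M + c) div (M * M) = a" using assms by (simp add: div_mult2_eq)
  with 1 show "lit M ((a * M + b) * M + c) 0 = a" "lit M ((a * M + b) * M + c) 1 = b" "lit M ((a * M + b) * M + c) 2 = c"
    using assms by (simp_all add: lit_def)
  have "a * M + b < Suc a * M" using assms by simp
  also have "\<dots> \<le> M * M" using assms by (intro mult_le_mono1) simp
  finally have "Suc (a * M + b) * M \<le> M * M * M" by (intro mult_le_mono1) simp
  thus "(a * M + b) * M + c < M ^ 3" using assms by (simp add: power3_eq_cube)
qed

lemma ex_clause:
  assumes "S \<subseteq> {..<M}" "S \<noteq> {}" "card S \<le> 3"
  shows "\<exists>e<M ^ 3. clause M e = S"
proof -
  have fin: "finite S" using assms(1) finite_subset by blast
  hence "0 < card S" using assms(2) by (simp add: card_gt_0_iff)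
  with assms(3) consider "card S = 1" | "card S = 2" | "card S = 3" by linarith
  hence "\<exists>a b c. S = {a, b, c}"
  proof cases
    case 1
    then obtain a where "S = {a, a, a}" by (auto simp: card_1_singleton_iff)
    thus ?thesis by blast
  next
    case 2
    then obtain a b where "S = {a, a, b}" by (auto simp: card_2_iff)
    thus ?thesis by blast
  next
    case 3
    then obtain a b c where "S = {a, b, c}" by (auto simp: card_3_iff)
    thus ?thesis by blast
  qed
  then obtain a b c where abc: "S = {a, b, c}" by blast
  with assms(1) have "a < M" "b < M" "c < M" by auto
  from lit_code[OF this] show ?thesis by (intro exI[of _ "(a * M + b) * M + c"]) (simp add: clause_def abc)
qed

lemma clause_family: "e < M ^ 3 \<Longrightarrow> clause M e \<subseteq> {..<M} \<and> clause M e \<noteq> {} \<and> card (clause M e) \<le> 3"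
  using lit_less[of e M] by (auto simp: clause_def card_insert_if)

lemma family_fam: "family M (fam M F)"
  using clause_family by (auto simp: family_def fam_def)

lemma fam_mask_of:
  assumes "family M \<S>"
  shows "fam M (mask_of (M ^ 3) (\<lambda>e. clause M e \<in> \<S>)) = \<S>"
proof (intro set_eqI iffI)
  fix S assume S: "S \<in> \<S>"
  with assms ex_clause[of S M] obtain e where "e < M ^ 3" "clause M e = S" by (auto simp: family_def)
  with S show "S \<in> fam M (mask_of (M ^ 3) (\<lambda>e. clause M e \<in> \<S>))" by (auto simp: fam_def bit_mask_of)
qed (auto simp: fam_def bit_mask_of)

lemma pt_lit:
  assumes "pt C M" "pb C M" "pt C e" "pb C e" "pt C d"
  shows "pt C (\<lambda>s. lit (M s) (e s) (d s))"
  unfolding lit_def by (intro pt_rules assms)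

lemma pb_lit:
  assumes "pb C M" "pb C e" 
  shows "pb C (\<lambda>s. lit (M s) (e s) (d s))"
  unfolding lit_def by (intro pt_rules assms)

lemma ptb_in3:
  assumes "pt C x" "pt C a" "pt C b" "pt C c"
  shows "ptb C (\<lambda>s. x s \<in> {a s, b s, c s})"
  unfolding insert_iff empty_iff by (intro pt_rules assms)

lemma ptb_subset3:
  assumes "pt C x" "pt C y" "pt C z" "pt C a" "pt C b" "pt C c"
  shows "ptb C (\<lambda>s. {x s, y s, z s} \<subseteq> {a s, b s, c s})"
proof -
  have "ptb C (\<lambda>s. x s \<in> {a s, b s, c s} \<and> y s \<in> {a s, b s, c s} \<and> z s \<in> {a s, b s, c s})"
    by (intro ptb_conj ptb_in3 assms)
  thus ?thesis by simp
qed

lemma ptb_eq3: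
  assumes "pt C x" "pt C y" "pt C z" "pt C a" "pt C b" "pt C c"
  shows "ptb C (\<lambda>s. {x s, y s, z s} = {a s, b s, c s})"
  unfolding set_eq_subset by (intro ptb_conj ptb_subset3 assms)

lemma ptb_mins:
  assumes "pt C M" "pb C M" "pt C F" "pt C a" "pt C b" "pt C c"
  shows "ptb C (\<lambda>s. {a s, b s, c s} \<in> mins (fam (M s) (F s)))"
proof -
  have "ptb C (\<lambda>s. (\<exists>e<M s ^ 3. bit (F s) e \<and> {lit (M s) e 0, lit (M s) e 1, lit (M s) e 2} = {a s, b s, c s}) \<and>
    (\<forall>e<M s ^ 3. bit (F s) e \<longrightarrow> {lit (M s) e 0, lit (M s) e 1, lit (M s) e 2} \<subseteq> {a s, b s, c s} \<longrightarrow>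
       {lit (M s) e 0, lit (M s) e 1, lit (M s) e 2} = {a s, b s, c s}))"
    by (intro pt_rules ptb_eq3 ptb_subset3 pt_lit assms)
  moreover have "S \<in> mins (fam m f) \<longleftrightarrow> (\<exists>e<m ^ 3. bit f e \<and> clause m e = S) \<and>
    (\<forall>e<m ^ 3. bit f e \<longrightarrow> clause m e \<subseteq> S \<longrightarrow> clause m e = S)" for S m f
    unfolding mins_def fam_def by blast
  ultimately show ?thesis by (simp add: clause_def)
qed

lemma ptb_fam:
  assumes "pt C M" "pb C M" "pt C F" "pt C a" "pt C b" "pt C c"
  shows "ptb C (\<lambda>s. {a s, b s, c s} \<in> fam (M s) (F s))"
proof -
  have "ptb C (\<lambda>s. (\<exists>e<M s ^ 3. bit (F s) e \<and> {lit (M s) e 0, lit (M s) e 1, lit (M s) e 2} = {a s, b s, c s}))"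
    by (intro pt_rules ptb_eq3 pt_lit assms)
  moreover have "S \<in> fam m f \<longleftrightarrow> (\<exists>e<m ^ 3. bit f e \<and> clause m e = S)" for S m f
    unfolding fam_def by blast
  ultimately show ?thesis by (simp add: clause_def)
qed

text \<open>
  The numbers below \<open>2 * M + M * M\<close> enumerate the possible hearts and petal sizes, in the order of
  priority required by \<open>first_branchable\<close>.
\<close>

definition heart_x :: "nat \<Rightarrow> nat \<Rightarrow> nat" where
  "heart_x M t = (if t < M then t else if t < M + M * M then (t - M) div M else t - (M + M * M))"

definition heart_y :: "nat \<Rightarrow> nat \<Rightarrow> nat" where
  "heart_y M t = (if t < M then t else if t < M + M * M then (t - M) mod M else t - (M + M * M))"

definition petal_size :: "nat \<Rightarrow> nat \<Rightarrow> nat" where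
  "petal_size M t = (if t < M + M * M then 1 else 2)"

abbreviation heart :: "nat \<Rightarrow> nat \<Rightarrow> nat set" where
  "heart M t \<equiv> {heart_x M t, heart_y M t}"

lemma pt_heart:
  assumes "pt C M" "pb C M" "pt C t" "pb C t"
  shows "pt C (\<lambda>s. heart_x (M s) (t s))" "pt C (\<lambda>s. heart_y (M s) (t s))" "pt C (\<lambda>s. petal_size (M s) (t s))"
  unfolding heart_x_def heart_y_def petal_size_def by (intro pt_rules assms)+

lemma card_petals_1:
  "card (petals (fam M F) {x, y} 1) = card {z. z < M \<and> z \<noteq> x \<and> z \<noteq> y \<and> {x, y, z} \<in> mins (fam M F)}"
proof -
  have "petals (fam M F) {x, y} 1 = (\<lambda>z. {z}) ` {z. z < M \<and> z \<noteq> x \<and> z \<noteq> y \<and> {x, y, z} \<in> mins (fam M F)}"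
  proof (intro set_eqI iffI)
    fix Y assume Y: "Y \<in> petals (fam M F) {x, y} 1"
    then obtain z where z: "Y = {z}" by (auto simp: petals_def card_1_singleton_iff)
    with Y petal_subset[OF family_fam Y] have "z < M \<and> z \<noteq> x \<and> z \<noteq> y \<and> {x, y, z} \<in> mins (fam M F)"
      by (auto simp: petals_def insert_commute)
    with z show "Y \<in> (\<lambda>z. {z}) ` {z. z < M \<and> z \<noteq> x \<and> z \<noteq> y \<and> {x, y, z} \<in> mins (fam M F)}" by blast
  qed (auto simp: petals_def insert_commute)
  thus ?thesis by (simp add: card_image)
qed

text \<open>Requiring \<open>p div M < p mod M\<close> counts every unordered pair once.\<close>

lemma card_petals_2:
  "card (petals (fam M F) {x} 2) = card {p. p < M * M \<and> p div M < p mod M \<and> p div M \<noteq> x \<and> p mod M \<noteq> x \<and> {x, p div M, p mod M} \<in> mins (fam M F)}"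
    (is "_ = card ?P")
proof -
  have "bij_betw (\<lambda>p. {p div M, p mod M}) ?P (petals (fam M F) {x} 2)"
  proof (rule bij_betw_imageI)
    show "inj_on (\<lambda>p. {p div M, p mod M}) ?P"
    proof (rule inj_onI)
      fix p q assume "p \<in> ?P" "q \<in> ?P" "{p div M, p mod M} = {q div M, q mod M}"
      hence "p div M = q div M" "p mod M = q mod M" by (auto simp: doubleton_eq_iff)
      thus "p = q" by (metis div_mult_mod_eq)
    qed
    show "(\<lambda>p. {p div M, p mod M}) ` ?P = petals (fam M F) {x} 2"
    proof (intro set_eqI iffI)
      fix Y assume Y: "Y \<in> petals (fam M F) {x} 2"
      then obtain y z where yz: "Y = {y, z}" "y < z" 
        unfolding petals_def by (auto simp: card_2_iff) (metis insert_commute linorder_neqE_nat)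
      with petal_subset[OF family_fam Y] have "y < M" "z < M" by auto
      hence p: "(y * M + z) div M = y" "(y * M + z) mod M = z" by auto
      have "y * M + z < Suc y * M" using \<open>z < M\<close> by simp
      also have "\<dots> \<le> M * M" using \<open>y < M\<close> by (intro mult_le_mono1) simp
      finally have "y * M + z \<in> ?P" using Y yz \<open>z < M\<close> by (auto simp: p petals_def)
      thus "Y \<in> (\<lambda>p. {p div M, p mod M}) ` ?P" using p yz \<open>z < M\<close> by (intro image_eqI[of _ _ "y * M + z"]) auto
    qed (auto simp: petals_def card_insert_if)
  qed
  from bij_betw_same_card[OF this] show ?thesis by (rule sym)
qed

lemma pt_card_petals_1:
  assumes "pt C M" "pb C M" "pt C F" "pt C x" "pt C y"
  shows "pt C (\<lambda>s. card (petals (fam (M s) (F s)) {x s, y s} 1))"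
  unfolding card_petals_1 by (intro pt_rules ptb_mins assms)

lemma pt_card_petals_2:
  assumes "pt C M" "pb C M" "pt C F" "pt C x"
  shows "pt C (\<lambda>s. card (petals (fam (M s) (F s)) {x s} 2))"
  unfolding card_petals_2 by (intro pt_rules ptb_mins assms)

definition rule_applies :: "nat \<Rightarrow> nat \<Rightarrow> nat \<Rightarrow> nat \<Rightarrow> nat \<Rightarrow> nat \<Rightarrow> bool" where
  "rule_applies d1 d2 d3 M F t \<longleftrightarrow> (if t < M + M * M then 
     (if heart_x M t = heart_y M t then d1 else d2) \<le> card (petals (fam M F) {heart_x M t, heart_y M t} 1)
     else d3 \<le> card (petals (fam M F) {heart_x M t} 2))"

text \<open>The number of indices up to which no rule applies equals the least index of an
  applicable rule, or the number of all rules if none applies. Minimisation thus becomes counting,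
  which \<open>pt_card\<close> provides.\<close>

definition first_rule :: "nat \<Rightarrow> nat \<Rightarrow> nat \<Rightarrow> nat \<Rightarrow> nat \<Rightarrow> nat" where
  "first_rule d1 d2 d3 M F = card {i. i < 2 * M + M * M \<and> (\<forall>j<Suc i. \<not> rule_applies d1 d2 d3 M F j)}"

lemma ptb_rule_applies:
  assumes "pt C M" "pb C M" "pt C F" "pt C t" "pb C t"
  shows "ptb C (\<lambda>s. rule_applies d1 d2 d3 (M s) (F s) (t s))"
  unfolding rule_applies_def by (intro pt_rules pt_card_petals_1 pt_card_petals_2 pt_heart assms)

lemma pt_first_rule:
  assumes "pt C M" "pb C M" "pt C F"
  shows "pt C (\<lambda>s. first_rule d1 d2 d3 (M s) (F s))"
  unfolding first_rule_def by (intro pt_rules ptb_rule_applies assms)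

lemma pb_first_rule:
  assumes "pb C M"
  shows "pb C (\<lambda>s. first_rule d1 d2 d3 (M s) (F s))"
  unfolding first_rule_def by (intro pt_rules assms)

definition child1 :: "nat \<Rightarrow> nat \<Rightarrow> nat \<Rightarrow> nat" where
  "child1 M F t = mask_of (M ^ 3) (\<lambda>e. clause M e \<in> insert (heart M t) (fam M F))"

definition child2 :: "nat \<Rightarrow> nat \<Rightarrow> nat \<Rightarrow> nat" where
  "child2 M F t = mask_of (M ^ 3) (\<lambda>e. clause M e \<in> fam M F \<union> petals (fam M F) (heart M t) (petal_size M t))"

lemma pt_child1:
  assumes "pt C M" "pb C M" "pt C F" "pt C t" "pb C t"
  shows "pt C (\<lambda>s. child1 (M s) (F s) (t s))"
proof -
  have "pt C (\<lambda>s. mask_of (M s ^ 3) (\<lambda>e. {lit (M s) e 0, lit (M s) e 1, lit (M s) e 2} = {heart_x (M s) (t s), heart_y (M s) (t s), heart_y (M s) (t s)} \<or>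
     {lit (M s) e 0, lit (M s) e 1, lit (M s) e 2} \<in> fam (M s) (F s)))"
    by (intro pt_rules ptb_eq3 ptb_fam pt_lit pb_lit pt_heart assms)
  thus ?thesis by (simp add: child1_def clause_def)
qed

text \<open>The triple may repeat entries. For \<open>p = 2\<close> it must consist of exactly two
  literals, and \<open>if a = b then c else b\<close> is the one different from
  \<open>a\<close>.\<close>

lemma clause_in_petals:
  assumes H: "H = {x, y}" and p: "p = 1 \<or> p = 2 \<and> x = y"
  shows "{a, b, c} \<in> petals G H p \<longleftrightarrow>
    (if p = 1 then a = b \<and> b = c \<and> a \<noteq> x \<and> a \<noteq> y \<and> {x, y, a} \<in> mins G
     else (if a = b then a \<noteq> c else c = a \<or> c = b) \<and> a \<noteq> x \<and> b \<noteq> x \<and> c \<noteq> x \<and> {x, a, if a = b then c else b} \<in> mins G)"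
proof (cases "p = 1")
  case True
  have "card {a, b, c} = 1 \<longleftrightarrow> a = b \<and> b = c" by (auto simp: card_insert_if)
  thus ?thesis using True H by (auto simp: petals_def insert_commute)
next
  case False
  with p have "p = 2" "x = y" by auto
  moreover have "card {a, b, c} = 2 \<longleftrightarrow> (if a = b then a \<noteq> c else c = a \<or> c = b)"
    by (auto simp: card_insert_if)
  ultimately show ?thesis using H by (auto simp: petals_def insert_commute)
qed

lemma petal_size_cases: "petal_size M t = 1 \<or> petal_size M t = 2 \<and> heart_x M t = heart_y M t"
  by (auto simp: petal_size_def heart_x_def heart_y_def)

lemma pt_child2:
  assumes "pt C M" "pb C M" "pt C F" "pt C t" "pb C t"
  shows "pt C (\<lambda>s. child2 (M s) (F s) (t s))"
  unfolding child2_def clause_def Un_iff clause_in_petals[OF refl petal_size_cases]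
  by (intro pt_rules ptb_fam ptb_mins pt_lit pt_heart assms)

section \<open>The counting test for one formula\<close>

definition act_codes :: "nat \<Rightarrow> nat \<Rightarrow> nat set" where
  "act_codes M F = {e. e < M ^ 3 \<and> clause M e \<in> mins (fam M F)}"

definition rank :: "nat \<Rightarrow> nat \<Rightarrow> nat \<Rightarrow> nat" where
  "rank M F e = card {e'. e' < e \<and> clause M e' \<in> mins (fam M F)}"

text \<open>Bits for the variables of a block plus two bits for every clause of a group; the sum
  serves both kinds of vertices. \<open>rank\<close> at \<open>(2 * n) ^ 3\<close> is the number of
  all active codes.\<close>

definition code_width :: "nat \<Rightarrow> nat \<Rightarrow> nat \<Rightarrow> nat \<Rightarrow> nat" where
  "code_width k l n F = n div (l + 1) + 1 + 2 * (rank (2 * n) F ((2 * n) ^ 3) div (k - l - 2) + 1)"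

definition leaf_adj :: "nat \<Rightarrow> nat \<Rightarrow> nat \<Rightarrow> nat \<Rightarrow> nat \<Rightarrow> nat \<Rightarrow> bool" where
  "leaf_adj k l n F = vertex_adj l (code_width k l n F)
     (conflict (act_codes (2 * n) F) (rank (2 * n) F) (lit (2 * n)) (l + 1) (k - l - 2))"

text \<open>Adding \<open>k\<close> to the exponent gives a power of two that is at least
  \<open>k * 2 ^ code_width k l n F\<close>, so rows and columns of the matrix can be separated by
  shifts.\<close>

definition leaf_graph :: "nat \<Rightarrow> nat \<Rightarrow> nat \<Rightarrow> nat \<Rightarrow> nat set \<Rightarrow> nat graph" where
  "leaf_graph k l n F S =
     colour_graph (2 ^ (code_width k l n F + k)) (leaf_adj k l n F) (\<lambda>v. v div 2 ^ code_width k l n F) S"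

definition leaf_test :: "nat \<Rightarrow> nat \<Rightarrow> nat \<Rightarrow> nat \<Rightarrow> bool" where
  "leaf_test k l n F \<longleftrightarrow>
     (\<Sum>S | S \<subseteq> {..<k} \<and> even (card S). count_scorpions k l (leaf_graph k l n F S)) \<noteq>
     (\<Sum>S | S \<subseteq> {..<k} \<and> odd (card S). count_scorpions k l (leaf_graph k l n F S))"

lemma card_act_codes: "card (act_codes M F) = rank M F (M ^ 3)"
  by (simp add: act_codes_def rank_def)

lemma rank_less:
  assumes "e \<in> act_codes M F" "e < e'" shows "rank M F e < rank M F e'"
  unfolding rank_def
proof (rule psubset_card_mono)
  show "{e'. e' < e \<and> clause M e' \<in> mins (fam M F)} \<subset> {e. e < e' \<and> clause M e \<in> mins (fam M F)}"
    using assms by (auto simp: act_codes_def)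
qed simp

lemma inj_on_rank: "inj_on (rank M F) (act_codes M F)"
  by (rule inj_onI) (metis rank_less linorder_neqE_nat less_irrefl)

lemma sat_by_act_codes:
  "sat_by \<alpha> (fam M F) \<longleftrightarrow> (\<forall>e\<in>act_codes M F. \<exists>d<3. \<alpha> (lit M e d))"
proof -
  have "mins (fam M F) = clause M ` act_codes M F"
    using mins_subset[of "fam M F"] by (auto simp: act_codes_def fam_def)
  moreover have "(\<exists>x\<in>clause M e. \<alpha> x) \<longleftrightarrow> (\<exists>d<3. \<alpha> (lit M e d))" for e
    unfolding clause_def numeral_3_eq_3 less_Suc_eq by (auto simp: numeral_2_eq_2)
  ultimately show ?thesis
    using sat_by_mins[OF family_finite[OF family_fam], of \<alpha> M F] by (simp add: sat_by_def)
qed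

text \<open>This holds for every family, sparse or not; sparsity will enter through the size of the
  graph.\<close>

theorem leaf_test_iff:
  assumes kl: "0 < l" "2 * l + 4 \<le> k"
  shows "leaf_test k l n F \<longleftrightarrow> (\<exists>\<alpha>. sat_by (lit_true \<alpha>) (fam (2 * n) F))"
proof -
  let ?E = "act_codes (2 * n) F" and ?rk = "rank (2 * n) F" and ?w = "code_width k l n F" and ?L = "k - l - 2"
  have "k * 2 ^ ?w \<le> 2 ^ k * 2 ^ ?w" by (intro mult_le_mono1) (simp add: less_imp_le)
  hence V: "k * 2 ^ ?w \<le> 2 ^ (?w + k)" by (simp add: power_add mult.commute)
  have L: "0 < ?L" using kl by simp
  have Q: "?rk e div ?L < ?rk ((2 * n) ^ 3) div ?L + 1" if "e \<in> ?E" for e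
  proof -
    have "?rk e < ?rk ((2 * n) ^ 3)" using rank_less[OF that] that by (simp add: act_codes_def)
    hence "?rk e div ?L \<le> ?rk ((2 * n) ^ 3) div ?L" by (intro div_le_mono) simp
    thus ?thesis by simp
  qed
  have "leaf_test k l n F \<longleftrightarrow> (\<exists>a x. (\<forall>i<l + 1. a i < 2 ^ ?w) \<and> (\<forall>j<?L. x j < 2 ^ ?w) \<and>
     (\<forall>i<l + 1. \<forall>j<?L. \<not> conflict ?E ?rk (lit (2 * n)) (l + 1) ?L i (a i) j (x j)))"
    unfolding leaf_test_def leaf_graph_def leaf_adj_def by (rule vertex_adj_iff[OF kl V])
  also have "\<dots> \<longleftrightarrow> (\<exists>\<alpha>. \<forall>e\<in>?E. \<exists>d<3. lit_true \<alpha> (lit (2 * n) e d))"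
    by (rule conflict_free_iff[where n = n, OF inj_on_rank Q _ _ L])
      (simp_all add: act_codes_def lit_less code_width_def)
  also have "\<dots> \<longleftrightarrow> (\<exists>\<alpha>. sat_by (lit_true \<alpha>) (fam (2 * n) F))"
    by (simp add: sat_by_act_codes)
  finally show ?thesis .
qed

lemma leaf_adj_irrefl: "\<not> leaf_adj k l n F u u"
  by (simp add: leaf_adj_def vertex_adj_def half_adj_def)

lemma leaf_adj_sym: "leaf_adj k l n F u v \<Longrightarrow> leaf_adj k l n F v u"
  by (auto simp: leaf_adj_def vertex_adj_def)

lemma pt_rank:
  assumes "pt C M" "pb C M" "pt C F" "pt C e" "pb C e"
  shows "pt C (\<lambda>s. rank (M s) (F s) (e s))"
  unfolding rank_def clause_def by (intro pt_rules ptb_mins pt_lit assms)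

lemma pb_rank: "pb C e \<Longrightarrow> pb C (\<lambda>s. rank (M s) (F s) (e s))"
  unfolding rank_def by (intro pb_card)

lemma pt_code_width:
  assumes "pt C n" "pb C n" "pt C F"
  shows "pt C (\<lambda>s. code_width k l (n s) (F s))" "pb C (\<lambda>s. code_width k l (n s) (F s))"
  unfolding code_width_def by (intro pt_rules pt_rank pb_rank assms)+

text \<open>Base 4 instead of 3 turns digits into pairs of bits that are extracted by shifts; the
  spare digit 3 is read as 2.\<close>

lemma chosen_eq: "chosen lt e q x = lt e (if 2 \<le> x div 2 ^ (2 * q) mod 2 ^ 2 then 2 else x div 2 ^ (2 * q) mod 2 ^ 2)"
proof -
  have "x div 4 ^ q mod 4 = x div 2 ^ (2 * q) mod 2 ^ 2" by (simp add: power_mult)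
  thus ?thesis unfolding chosen_def min_def by simp
qed

lemma pt_chosen:
  assumes "pt C M" "pb C M" "pt C e" "pb C e" "pt C q" "pb C q" "pt C x"
  shows "pt C (\<lambda>s. chosen (lit (M s)) (e s) (q s) (x s))"
  unfolding chosen_eq by (intro pt_lit pt_rules pt_mod_pow2 pt_shift_right assms)

lemma pb_chosen:
  assumes "pb C M" "pb C e"
  shows "pb C (\<lambda>s. chosen (lit (M s)) (e s) (q s) (x s))"
  unfolding chosen_def by (intro pb_lit assms)

lemma ptb_iff:
  assumes "ptb C P" "ptb C Q"
  shows "ptb C (\<lambda>s. P s = Q s)"
proof -
  have "ptb C (\<lambda>s. of_bool (P s) = (of_bool (Q s) :: nat))" using assms unfolding ptb_def[of C P] ptb_def[of C Q] by (rule ptb_eq)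
  thus ?thesis by (simp only: of_bool_eq_iff)
qed

lemma ptb_conflict:
  assumes "pt C M" "pb C M" "pt C F" "pt C i" "pt C a" "pt C j" "pt C x"
  shows "ptb C (\<lambda>s. conflict (act_codes (M s) (F s)) (rank (M s) (F s)) (lit (M s)) r L (i s) (a s) (j s) (x s))"
proof -
  have "ptb C (\<lambda>s. \<exists>e<M s ^ 3. {lit (M s) e 0, lit (M s) e 1, lit (M s) e 2} \<in> mins (fam (M s) (F s)) \<and> rank (M s) (F s) e mod L = j s \<and>
     chosen (lit (M s)) e (rank (M s) (F s) e div L) (x s) div 2 mod r = i s \<and>
     (bit (a s) (chosen (lit (M s)) e (rank (M s) (F s) e div L) (x s) div 2 div r) \<longleftrightarrow>
          \<not> odd (chosen (lit (M s)) e (rank (M s) (F s) e div L) (x s))))"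
    by (intro ptb_bex ptb_conj ptb_iff ptb_eq ptb_mins ptb_bit ptb_not ptb_odd pt_chosen pb_chosen pt_lit pt_rank pb_rank pt_rules assms)
  thus ?thesis unfolding conflict_def act_codes_def clause_def by (simp add: conj_ac Bex_def)
qed

lemma ptb_finite_set:
  assumes "finite S" "pt C f" shows "ptb C (\<lambda>s. f s \<in> S)"
  using assms(1)
proof (induction S rule: finite_induct)
  case (insert x S)
  thus ?case unfolding insert_iff by (intro pt_rules assms)
qed (simp add: ptb_const)

lemma ptb_half_adj:
  assumes "\<And>i j. pt C i \<Longrightarrow> pt C j \<Longrightarrow> ptb C (\<lambda>s. conf s (i s) (a s) (j s) (a' s))" "pt C c" "pt C c'" 
  shows "ptb C (\<lambda>s. half_adj l (conf s) (c s) (a s) (c' s) (a' s))"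
  unfolding half_adj_def by (intro pt_rules assms)

lemma ptb_leaf_adj:
  assumes "pt C n" "pb C n" "pt C F" "pt C u" "pt C v"
  shows "ptb C (\<lambda>s. leaf_adj k l (n s) (F s) (u s) (v s))"
  unfolding leaf_adj_def vertex_adj_def
  by (intro ptb_disj ptb_half_adj ptb_conflict pt_shift_right pt_mod_pow2 pt_code_width pt_rules assms)

definition leaf_elem :: "nat \<Rightarrow> nat \<Rightarrow> nat \<Rightarrow> nat \<Rightarrow> nat set \<Rightarrow> nat \<Rightarrow> nat" where
  "leaf_elem k l n F S e = (let w = code_width k l n F; V = 2 ^ (w + k); u = (e - 1) div 2 ^ (w + k); v = (e - 1) mod 2 ^ (w + k) in
     if e = 0 then V else of_bool (u < V \<and> v < V \<and> leaf_adj k l n F u v \<and> u div 2 ^ w \<in> S \<and> v div 2 ^ w \<in> S))"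

lemma encode_leaf_graph:
  "encode_graph (leaf_graph k l n F S) = map (leaf_elem k l n F S)
     [0..<Suc (2 ^ (code_width k l n F + k) * 2 ^ (code_width k l n F + k))]"
proof -
  have "{u, v} \<in> edges (colour_graph V (leaf_adj k l n F) col S) \<longleftrightarrow> u < V \<and> v < V \<and> leaf_adj k l n F u v \<and> col u \<in> S \<and> col v \<in> S" for u v V col
    by (rule edges_colour_graph) (rule leaf_adj_sym)
  thus ?thesis
    by (simp only: encode_graph_eq leaf_elem_def[abs_def] Let_def leaf_graph_def num_verts_colour_graph)
qed

lemma pt_leaf_elem:
  assumes "finite S" "pt C n" "pb C n" "pt C F" "pt C e"
  shows "pt C (\<lambda>s. leaf_elem k l (n s) (F s) S (e s))"
  unfolding leaf_elem_def Let_def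
  by (intro ptb_finite_set pt_pow2 ptb_leaf_adj pt_shift_right pt_mod_pow2 pt_code_width pt_rules assms)

text \<open>The matrix can have exponentially many entries, so its index lives in
  \<open>loop0\<close>: an entry is found by shifting and masking the index, in time polynomial in
  the size alone.\<close>

lemma computable_leaf_count:
  assumes P: "\<And>G. G \<in> input_graphs \<Longrightarrow> outputs_within P (encode_graph G) (count_scorpions k l G) (T (num_verts G))"
    and S: "finite S" and n: "pt C n" "pb C n" and F: "pt C F"
  shows "\<exists>e. computable_in False C (\<lambda>s. count_scorpions k l (leaf_graph k l (n s) (F s) S))
     (\<lambda>s. poly_in C e s + 4 ^ (code_width k l (n s) (F s) + k) * (poly_in C e s + 1)
        + T (2 ^ (code_width k l (n s) (F s) + k)))"
proof -
  let ?N = "fst (snd C)" and ?V = "\<lambda>s. 2 ^ (code_width k l (n s) (F s) + k) :: nat"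
  let ?len = "\<lambda>s. Suc (?V s * ?V s)"
  have "pt C (\<lambda>s. Suc (2 ^ ((code_width k l (n s) (F s) + k) + (code_width k l (n s) (F s) + k))))"
    by (intro pt_rules pt_pow2 pt_code_width n F)
  hence "pt C ?len" by (simp add: power_add)
  then obtain e1 where e1: "computable_in True C ?len (\<lambda>s. (?N s + 2) ^ e1)" by (auto simp: pt_def)
  have "pt (loop0 C) (\<lambda>x. leaf_elem k l (n (fst x)) (F (fst x)) S (fst (snd x)))"
    by (intro pt_leaf_elem S pt_loop0 pb_loop0 pt_index n F)
  then obtain e2 where e2: "computable True (\<lambda>x. fst C (fst x)) (map (\<lambda>g x. g (fst x)) (snd (snd C)) @ [\<lambda>x. fst (snd x), \<lambda>x. snd (snd x)]) 
     (\<lambda>x. leaf_elem k l (n (fst x)) (F (fst x)) S (fst (snd x))) (\<lambda>x. (?N (fst x) + 2) ^ e2)" by (auto simp: pt_def loop0_def)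
  have out: "outputs_within P (map (leaf_elem k l (n s) (F s) S) [0..<?len s]) (count_scorpions k l (leaf_graph k l (n s) (F s) S)) (T (?V s))" for s
  proof -
    have "leaf_graph k l (n s) (F s) S \<in> input_graphs"
      unfolding leaf_graph_def by (rule colour_graph_input) (rule leaf_adj_irrefl)
    from P[OF this] show ?thesis by (simp only: encode_leaf_graph) (simp add: leaf_graph_def)
  qed
  have c: "computable_in False C (\<lambda>s. count_scorpions k l (leaf_graph k l (n s) (F s) S))
    (\<lambda>s. (?N s + 2) ^ e1 + (\<Sum>i<?len s. (?N s + 2) ^ e2 + 1) + T (?V s))"
    using computable_call[of P "\<lambda>s. leaf_elem k l (n s) (F s) S", OF out computable_impure[OF e1] e2] by simp
  let ?p = "\<lambda>s. (?N s + 2) ^ (e1 + e2)"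
  have "(?N s + 2) ^ e1 + (\<Sum>i<?len s. (?N s + 2) ^ e2 + 1) + T (?V s) \<le> 3 * ((?p s + 4 ^ (code_width k l (n s) (F s) + k) * (?p s + 1) + T (?V s)) + 1)" for s
  proof -
    have V: "?V s * ?V s = 4 ^ (code_width k l (n s) (F s) + k)"
      by (simp add: power_mult_distrib[symmetric])
    have 1: "(?N s + 2) ^ e1 \<le> ?p s" "(?N s + 2) ^ e2 \<le> ?p s" by (rule power_increasing; simp)+
    have "(\<Sum>i<?len s. (?N s + 2) ^ e2 + 1) = (4 ^ (code_width k l (n s) (F s) + k) + 1) * ((?N s + 2) ^ e2 + 1)" using V by simp
    also have "\<dots> \<le> (4 ^ (code_width k l (n s) (F s) + k) + 1) * (?p s + 1)" using 1 by (intro mult_le_mono) auto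
    finally have 2: "(\<Sum>i<?len s. (?N s + 2) ^ e2 + 1) \<le> 4 ^ (code_width k l (n s) (F s) + k) * (?p s + 1) + ?p s + 1"
      by (simp only: add_mult_distrib mult_1 add.assoc)
    define X where "X = 4 ^ (code_width k l (n s) (F s) + k) * (?p s + 1)"
    define Y where "Y = (\<Sum>i<?len s. (?N s + 2) ^ e2 + 1)"
    have "a + y + t \<le> 3 * ((p + x + t) + (1 :: nat))" if "a \<le> p" "y \<le> x + p + 1" for a y t p x
      using that by arith
    from this[OF 1(1) 2[folded X_def Y_def]] show ?thesis unfolding X_def Y_def .
  qed
  from computable_mono[OF c this] show ?thesis by blast
qed

lemma computable_sum:
  assumes "finite A" "\<And>S. S \<in> A \<Longrightarrow> computable \<pi> inp \<Gamma> (f S) \<tau>"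
  shows "computable \<pi> inp \<Gamma> (\<lambda>s. \<Sum>S\<in>A. f S s) \<tau>"
  using assms
proof (induction A rule: finite_induct)
  case (insert S A)
  thus ?case by (simp add: computable_add)
qed (simp add: computable_const)

lemma computable_neq:
  assumes f: "computable \<pi> inp \<Gamma> f \<tau>" and g: "computable \<pi> inp \<Gamma> g \<tau>"
  shows "computable \<pi> inp \<Gamma> (\<lambda>s. of_bool (f s \<noteq> g s)) \<tau>"
proof -
  have "computable \<pi> inp \<Gamma> (\<lambda>s. 1 - (1 - ((f s - g s) + (g s - f s)))) \<tau>"
    by (intro computable_sub computable_add f g computable_const)
  moreover have "1 - (1 - ((a - b) + (b - a))) = of_bool (a \<noteq> b)" for a b :: nat by auto
  ultimately show ?thesis by simp
qed

text \<open>Since \<open>k\<close> is fixed, the sums over sets of colours are unrolled into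
  \<open>2 ^ k\<close> calls in the program text. The largest of their exponents serves all of
  them.\<close>

lemma computable_leaf_test:
  assumes P: "\<And>G. G \<in> input_graphs \<Longrightarrow> outputs_within P (encode_graph G) (count_scorpions k l G) (T (num_verts G))"
    and n: "pt C n" "pb C n" and F: "pt C F"
  shows "\<exists>e. computable_in False C (\<lambda>s. of_bool (leaf_test k l (n s) (F s)))
     (\<lambda>s. poly_in C e s + 4 ^ (code_width k l (n s) (F s) + k) * (poly_in C e s + 1)
        + T (2 ^ (code_width k l (n s) (F s) + k)))"
proof -
  let ?N = "fst (snd C)"
  let ?\<tau> = "\<lambda>e s. (?N s + 2) ^ e + 4 ^ (code_width k l (n s) (F s) + k) * ((?N s + 2) ^ e + 1)
        + T (2 ^ (code_width k l (n s) (F s) + k))"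
  have "\<forall>S\<in>Pow {..<k}. \<exists>e. computable_in False C (\<lambda>s. count_scorpions k l (leaf_graph k l (n s) (F s) S)) (?\<tau> e)"
  proof
    fix S assume "S \<in> Pow {..<k}"
    hence "finite S" by (auto intro: finite_subset)
    thus "\<exists>e. computable_in False C (\<lambda>s. count_scorpions k l (leaf_graph k l (n s) (F s) S)) (?\<tau> e)"
      by (intro computable_leaf_count[where P = P] P n F)
  qed
  from bchoice[OF this] obtain e where
    "\<forall>S\<in>Pow {..<k}. computable_in False C (\<lambda>s. count_scorpions k l (leaf_graph k l (n s) (F s) S)) (?\<tau> (e S))" ..
  then have e: "computable_in False C (\<lambda>s. count_scorpions k l (leaf_graph k l (n s) (F s) S)) (?\<tau> (e S))"
    if "S \<subseteq> {..<k}" for S by (rule bspec) (simp only: that Pow_iff)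
  define d where "d = Max (e ` Pow {..<k})"
  have le: "a + b + t \<le> 1 * ((a' + b' + t) + (1 :: nat))" if "a \<le> a'" "b \<le> b'" for a b a' b' t
    using that by arith
  have *: "computable_in False C (\<lambda>s. count_scorpions k l (leaf_graph k l (n s) (F s) S)) (?\<tau> d)"
    if "S \<subseteq> {..<k}" for S
  proof (rule computable_mono[OF e[OF that], of 1])
    fix s
    have "e S \<le> d" unfolding d_def by (rule Max_ge) (use that in auto)
    hence 1: "(?N s + 2) ^ e S \<le> (?N s + 2) ^ d" by (intro power_increasing) auto
    hence "4 ^ (code_width k l (n s) (F s) + k) * ((?N s + 2) ^ e S + 1) \<le> 4 ^ (code_width k l (n s) (F s) + k) * ((?N s + 2) ^ d + 1)"
      by (intro mult_le_mono) auto
    with 1 show "?\<tau> (e S) s \<le> 1 * (?\<tau> d s + 1)" by (intro le)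
  qed
  have "computable_in False C (\<lambda>s. of_bool (leaf_test k l (n s) (F s))) (?\<tau> d)"
    unfolding leaf_test_def by (intro computable_neq computable_sum *) (simp_all only: mem_Collect_eq finite_lessThan finite_Collect_conjI finite_Collect_subsets simp_thms)
  thus ?thesis by blast
qed

section \<open>Searching the branching tree\<close>

lemma card_none_before:
  fixes P :: "nat \<Rightarrow> bool" and N :: nat
  defines "m \<equiv> card {i. i < N \<and> (\<forall>j<Suc i. \<not> P j)}"
  shows "m < N \<Longrightarrow> P m \<and> (\<forall>j<m. \<not> P j)" and "N \<le> m \<Longrightarrow> t < N \<Longrightarrow> \<not> P t"
proof -
  have "(m < N \<longrightarrow> P m \<and> (\<forall>j<m. \<not> P j)) \<and> (N \<le> m \<longrightarrow> (\<forall>t<N. \<not> P t))"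
  proof (cases "\<exists>t<N. P t")
    case True
    define r where "r = (LEAST t. P t)"
    from True have r: "P r" "r < N" "\<And>j. j < r \<Longrightarrow> \<not> P j"
      unfolding r_def by (auto intro: LeastI dest: not_less_Least) (meson LeastI Least_le le_less_trans)
    have "{i. i < N \<and> (\<forall>j<Suc i. \<not> P j)} = {..<r}"
    proof (intro set_eqI iffI)
      fix i assume "i \<in> {i. i < N \<and> (\<forall>j<Suc i. \<not> P j)}"
      with r(1) have "\<not> r < Suc i" by blast
      thus "i \<in> {..<r}" by simp
    qed (use r in auto)
    hence "m = r" by (simp add: m_def)
    with r show ?thesis by auto
  next
    case False
    hence "{i. i < N \<and> (\<forall>j<Suc i. \<not> P j)} = {..<N}" by auto
    hence "m = N" by (simp add: m_def)
    with False show ?thesis by auto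
  qed
  thus "m < N \<Longrightarrow> P m \<and> (\<forall>j<m. \<not> P j)" "N \<le> m \<Longrightarrow> t < N \<Longrightarrow> \<not> P t" by auto
qed

context sparsify begin

abbreviation "rule_count \<equiv> 2 * M + M * M"
abbreviation "applies \<equiv> rule_applies d1 d2 d3 M"
abbreviation "first \<equiv> first_rule d1 d2 d3 M"

lemma rule_applies_iff: "applies F t \<longleftrightarrow> branchable (fam M F) (heart M t) (petal_size M t)"
proof (cases "t < M + M * M")
  case True
  hence "petal_size M t = 1" by (simp add: petal_size_def)
  moreover have "card (heart M t) = (if heart_x M t = heart_y M t then 1 else 2)" by simp
  ultimately show ?thesis using True by (simp add: rule_applies_def branchable_def)
next
  case False
  hence "petal_size M t = 2" "heart_y M t = heart_x M t" by (auto simp: petal_size_def heart_x_def heart_y_def)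
  thus ?thesis using False by (simp add: rule_applies_def branchable_def)
qed

lemma branchable_bound:
  assumes "branchable (fam M F) H p" shows "H \<subseteq> {..<M}"
proof -
  have "card (petals (fam M F) H p) \<noteq> 0" using assms d_pos by (auto simp: branchable_def)
  then obtain Y where "Y \<in> petals (fam M F) H p" by fastforce
  from petal_subset[OF family_fam this] show ?thesis by simp
qed

lemma code_single: "x < M \<Longrightarrow> heart M x = {x} \<and> petal_size M x = 1"
  by (simp add: heart_x_def heart_y_def petal_size_def)

lemma code_pair:
  assumes "x < M" "y < M"
  shows "M + (x * M + y) < M + M * M" "heart M (M + (x * M + y)) = {x, y}" "petal_size M (M + (x * M + y)) = 1"
proof -
  have "x * M + y < Suc x * M" using assms by simp
  also have "\<dots> \<le> M * M" using assms by (intro mult_le_mono1) simp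
  finally show *: "M + (x * M + y) < M + M * M" by simp
  show "heart M (M + (x * M + y)) = {x, y}" "petal_size M (M + (x * M + y)) = 1"
    using * assms by (simp_all add: heart_x_def heart_y_def petal_size_def)
qed

lemma code_single2: "heart M (M + M * M + x) = {x} \<and> petal_size M (M + M * M + x) = 2"
  by (simp add: heart_x_def heart_y_def petal_size_def)

lemma first_is_branchable:
  assumes "first F < rule_count"
  shows "first_branchable (fam M F) (heart M (first F)) (petal_size M (first F))"
proof -
  define t where "t = first F"
  from card_none_before(1)[of rule_count "applies F"] assms have
    t: "branchable (fam M F) (heart M t) (petal_size M t)" and
    none: "\<And>j. j < t \<Longrightarrow> \<not> branchable (fam M F) (heart M j) (petal_size M j)"
    unfolding t_def first_rule_def rule_applies_iff by blast+
  have 1: "\<not> branchable (fam M F) {x} 1" if "card (heart M t) = 2 \<or> petal_size M t = 2" for x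
  proof
    assume br: "branchable (fam M F) {x} 1"
    hence x: "x < M" using branchable_bound by auto
    have "M \<le> t" using that code_single[of t] by (cases "t < M") auto
    with none[of x] x br code_single[OF x] show False by simp
  qed
  have 2: "\<not> branchable (fam M F) {x, y} 1" if "petal_size M t = 2" for x y
  proof
    assume br: "branchable (fam M F) {x, y} 1"
    hence x: "x < M" "y < M" using branchable_bound by auto
    have "M + M * M \<le> t" using that by (auto simp: petal_size_def split: if_splits)
    with none[of "M + (x * M + y)"] code_pair[OF x] br show False by simp
  qed
  from t 1 2 show ?thesis unfolding first_branchable_def t_def[symmetric] by blast
qed

lemma none_branchable:
  assumes "\<not> first F < rule_count"
  shows "\<not> branchable (fam M F) H p"
proof
  assume br: "branchable (fam M F) H p"
  have none: "\<not> branchable (fam M F) (heart M t) (petal_size M t)" if "t < rule_count" for t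
    using card_none_before(2)[of rule_count "applies F"] assms that
    unfolding first_rule_def rule_applies_iff by (simp add: not_less)
  from br have "card H = 1 \<and> p = 1 \<or> card H = 2 \<and> p = 1 \<or> card H = 1 \<and> p = 2"
    by (auto simp: branchable_def)
  thus False
  proof (elim disjE conjE)
    assume "card H = 1" "p = 1"
    then obtain x where "H = {x}" "x < M" using branchable_bound[OF br] by (auto simp: card_1_singleton_iff)
    thus False using none[of x] code_single[of x] br \<open>p = 1\<close> by simp
  next
    assume "card H = 2" "p = 1"
    then obtain x y where "H = {x, y}" "x < M" "y < M" using branchable_bound[OF br] by (auto simp: card_2_iff)
    thus False using none[of "M + (x * M + y)"] code_pair[of x y] br \<open>p = 1\<close> by simp
  next
    assume "card H = 1" "p = 2"
    then obtain x where "H = {x}" "x < M" using branchable_bound[OF br] by (auto simp: card_1_singleton_iff)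
    thus False using none[of "M + M * M + x"] code_single2[of x] br \<open>p = 2\<close> by simp
  qed
qed

text \<open>The bound on \<open>F\<close> keeps the blocks of \<open>enc_stack\<close>
  apart.\<close>

definition good :: "nat \<Rightarrow> bool" where
  "good F \<longleftrightarrow> inv (fam M F) \<and> F < 2 ^ (M ^ 3)"

text \<open>A binary tree with \<open>L\<close> leaves has \<open>2 * L - 1\<close> nodes, and
  \<open>2 powr \<Phi>\<close> bounds the leaves of the search tree. So \<open>pot\<close> bounds
  its nodes, which are the steps of the search.\<close>

definition pot :: "nat \<Rightarrow> real" where
  "pot F = 2 * 2 powr \<Phi> (fam M F) - 1"

lemma pot_ge_1: "good F \<Longrightarrow> 1 \<le> pot F"
proof -
  assume "good F"
  hence "2 powr 0 \<le> 2 powr \<Phi> (fam M F)" using \<Phi>_nonneg by (intro powr_mono) (auto simp: good_def)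
  thus ?thesis by (simp add: pot_def)
qed

lemma children:
  assumes F: "good F" and t: "t = first F" "t < rule_count"
  shows "good (child1 M F t)" "good (child2 M F t)" "pot (child1 M F t) + pot (child2 M F t) + 1 \<le> pot F"
    "sat_by \<alpha> (fam M F) \<longleftrightarrow> sat_by \<alpha> (fam M (child1 M F t)) \<or> sat_by \<alpha> (fam M (child2 M F t))"
proof -
  have inv: "inv (fam M F)" using F by (simp add: good_def)
  from first_is_branchable[of F] t have "first_branchable (fam M F) (heart M t) (petal_size M t)" by simp
  note B = branch[OF inv this]
  have f1: "fam M (child1 M F t) = insert (heart M t) (fam M F)"
    unfolding child1_def by (rule fam_mask_of) (use B(1) in \<open>simp add: inv_def\<close>)
  have f2: "fam M (child2 M F t) = fam M F \<union> petals (fam M F) (heart M t) (petal_size M t)"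
    unfolding child2_def by (rule fam_mask_of) (use B(2) in \<open>simp add: inv_def\<close>)
  show "good (child1 M F t)" unfolding good_def f1 using B(1) mask_of_less by (simp add: child1_def)
  show "good (child2 M F t)" unfolding good_def f2 using B(2) mask_of_less by (simp add: child2_def)
  show "pot (child1 M F t) + pot (child2 M F t) + 1 \<le> pot F"
    using B(3) unfolding pot_def f1 f2 by simp
  show "sat_by \<alpha> (fam M F) \<longleftrightarrow> sat_by \<alpha> (fam M (child1 M F t)) \<or> sat_by \<alpha> (fam M (child2 M F t))"
    unfolding f1 f2 by (rule sat_by_branch)
qed

end

text \<open>An empty stack is a fixed point, so surplus iterations do no harm and their number need
  only be an upper bound.\<close>

fun dfs_step :: "nat \<Rightarrow> nat \<Rightarrow> nat \<Rightarrow> nat \<Rightarrow> (nat \<Rightarrow> bool) \<Rightarrow> nat list \<times> bool \<Rightarrow> nat list \<times> bool" where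
  "dfs_step d1 d2 d3 M test ([], b) = ([], b)"
| "dfs_step d1 d2 d3 M test (F # st, b) = (let t = first_rule d1 d2 d3 M F in
     if t < 2 * M + M * M then (child1 M F t # child2 M F t # st, b) else (st, b \<or> test F))"

definition fam_sat :: "nat \<Rightarrow> nat \<Rightarrow> bool" where
  "fam_sat M F \<longleftrightarrow> (\<exists>\<alpha>. sat_by (lit_true \<alpha>) (fam M F))"

context sparsify begin

text \<open>At an inner node the inequality for \<open>pot\<close> in \<open>children\<close> leaves
  1 for the node that is removed; at a leaf the removed potential is itself at least 1.\<close>

lemma dfs_step:
  assumes "\<forall>F\<in>set st. good F" "dfs_step d1 d2 d3 M (fam_sat M) (st, b) = (st', b')"
  shows "\<forall>F\<in>set st'. good F" "b' \<or> (\<exists>F\<in>set st'. fam_sat M F) \<longleftrightarrow> b \<or> (\<exists>F\<in>set st. fam_sat M F)"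
    "st \<noteq> [] \<Longrightarrow> (\<Sum>F\<leftarrow>st'. pot F) + 1 \<le> (\<Sum>F\<leftarrow>st. pot F)"
proof -
  have "(\<forall>F\<in>set st'. good F) \<and> (b' \<or> (\<exists>F\<in>set st'. fam_sat M F) \<longleftrightarrow> b \<or> (\<exists>F\<in>set st. fam_sat M F)) \<and>
    (st \<noteq> [] \<longrightarrow> (\<Sum>F\<leftarrow>st'. pot F) + 1 \<le> (\<Sum>F\<leftarrow>st. pot F))"
  proof (cases st)
    case (Cons F r)
    hence F: "good F" using assms(1) by simp
    show ?thesis
    proof (cases "first F < rule_count")
      case True
      note C = children[OF F refl True]
      have "fam_sat M F \<longleftrightarrow> fam_sat M (child1 M F (first F)) \<or> fam_sat M (child2 M F (first F))"
        unfolding fam_sat_def C(4) by blast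
      with C(1-3) assms Cons True show ?thesis by (auto simp: Let_def)
    next
      case False
      with assms Cons pot_ge_1[OF F] show ?thesis by (auto simp: Let_def)
    qed
  qed (use assms in auto)
  thus "\<forall>F\<in>set st'. good F" "b' \<or> (\<exists>F\<in>set st'. fam_sat M F) \<longleftrightarrow> b \<or> (\<exists>F\<in>set st. fam_sat M F)"
    "st \<noteq> [] \<Longrightarrow> (\<Sum>F\<leftarrow>st'. pot F) + 1 \<le> (\<Sum>F\<leftarrow>st. pot F)" by blast+
qed

lemma dfs_good:
  assumes "\<forall>F\<in>set st. good F" "((dfs_step d1 d2 d3 M (fam_sat M)) ^^ i) (st, b) = (st', b')"
  shows "\<forall>F\<in>set st'. good F"
  using assms(2)
proof (induction i arbitrary: st' b')
  case 0
  thus ?case using assms(1) by simp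
next
  case (Suc i)
  obtain st1 b1 where 1: "((dfs_step d1 d2 d3 M (fam_sat M)) ^^ i) (st, b) = (st1, b1)" by fastforce
  from Suc.prems 1 have "dfs_step d1 d2 d3 M (fam_sat M) (st1, b1) = (st', b')" by simp
  from dfs_step(1)[OF Suc.IH[OF 1] this] show ?case .
qed

lemma dfs_result:
  assumes "\<forall>F\<in>set st. good F" "(\<Sum>F\<leftarrow>st. pot F) \<le> real i"
  shows "((dfs_step d1 d2 d3 M (fam_sat M)) ^^ i) (st, b) = ([], b \<or> (\<exists>F\<in>set st. fam_sat M F))"
  using assms
proof (induction i arbitrary: st b)
  case 0
  have "st = []"
  proof (rule ccontr)
    assume "st \<noteq> []"
    then obtain F r where st: "st = F # r" by (cases st) auto
    have "0 \<le> (\<Sum>F\<leftarrow>r. pot F)" using 0 st pot_ge_1 by (intro sum_list_nonneg) force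
    with 0 st pot_ge_1[of F] show False by simp
  qed
  thus ?case by simp
next
  case (Suc i)
  obtain st1 b1 where 1: "dfs_step d1 d2 d3 M (fam_sat M) (st, b) = (st1, b1)" by fastforce
  note S = dfs_step[OF Suc.prems(1) 1]
  have "(\<Sum>F\<leftarrow>st1. pot F) \<le> real i"
  proof (cases "st = []")
    case True
    with 1 show ?thesis by simp
  next
    case False
    with S(3) Suc.prems(2) show ?thesis by simp
  qed
  from Suc.IH[OF S(1) this, of b1] S(2) show ?case
    by (simp add: funpow_Suc_right 1 del: funpow.simps)
qed

end

text \<open>Every entry is a block of \<open>M ^ 3 + 1\<close> bits whose top bit is set. This
  marker distinguishes an empty family on the stack from the empty stack.\<close>

fun enc_stack :: "nat \<Rightarrow> nat list \<Rightarrow> nat" where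
  "enc_stack M [] = 0"
| "enc_stack M (F # st) = enc_stack M st * 2 ^ (M ^ 3 + 1) + (2 ^ (M ^ 3) + F)"

fun enc_state :: "nat \<Rightarrow> nat list \<times> bool \<Rightarrow> nat" where
  "enc_state M (st, b) = 2 * enc_stack M st + of_bool b"

definition top_code :: "nat \<Rightarrow> nat \<Rightarrow> nat" where
  "top_code M z = z div 2 mod 2 ^ (M ^ 3)"

definition at_leaf :: "nat \<Rightarrow> nat \<Rightarrow> nat \<Rightarrow> nat \<Rightarrow> nat \<Rightarrow> bool" where
  "at_leaf d1 d2 d3 M z \<longleftrightarrow> z div 2 \<noteq> 0 \<and> \<not> first_rule d1 d2 d3 M (top_code M z) < 2 * M + M * M"

text \<open>The outer test separates leaves from everything else, so the expensive
  \<open>test\<close> sits in one branch of one conditional. The nested truncated subtraction is a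
  disjunction of bits.\<close>

definition num_step :: "nat \<Rightarrow> nat \<Rightarrow> nat \<Rightarrow> nat \<Rightarrow> (nat \<Rightarrow> bool) \<Rightarrow> nat \<Rightarrow> nat" where
  "num_step d1 d2 d3 M test z = (let F = top_code M z; t = first_rule d1 d2 d3 M F; r = z div 2 div 2 ^ (M ^ 3 + 1) in
     if \<not> at_leaf d1 d2 d3 M z then
       (if z div 2 = 0 then z
        else 2 * ((r * 2 ^ (M ^ 3 + 1) + (2 ^ (M ^ 3) + child2 M F t)) * 2 ^ (M ^ 3 + 1) + (2 ^ (M ^ 3) + child1 M F t)) + z mod 2)
     else 2 * r + (1 - (1 - (z mod 2 + of_bool (test F)))))"

lemma enc_stack_Cons:
  assumes "F < 2 ^ (M ^ 3)"
  shows "enc_state M (F # st, b) div 2 \<noteq> 0" "top_code M (enc_state M (F # st, b)) = F"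
    "enc_state M (F # st, b) div 2 div 2 ^ (M ^ 3 + 1) = enc_stack M st"
proof -
  have 1: "enc_state M (F # st, b) div 2 = enc_stack M (F # st)" by simp
  show "enc_state M (F # st, b) div 2 \<noteq> 0" unfolding 1 by simp
  have "enc_stack M (F # st) = (enc_stack M st * 2 + 1) * 2 ^ (M ^ 3) + F" by (simp add: algebra_simps)
  hence "enc_stack M (F # st) mod 2 ^ (M ^ 3) = F" by (simp only: mod_mult_self3 mod_less[OF assms])
  thus "top_code M (enc_state M (F # st, b)) = F" unfolding top_code_def 1 .
  have "2 ^ (M ^ 3) + F < 2 ^ (M ^ 3 + 1)" using assms by simp
  thus "enc_state M (F # st, b) div 2 div 2 ^ (M ^ 3 + 1) = enc_stack M st" unfolding 1 enc_stack.simps by simp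
qed

lemma num_step_enc:
  assumes "\<forall>F\<in>set st. F < 2 ^ (M ^ 3)"
  shows "num_step d1 d2 d3 M test (enc_state M (st, b)) = enc_state M (dfs_step d1 d2 d3 M test (st, b))"
proof (cases st)
  case Nil
  thus ?thesis by (simp add: num_step_def at_leaf_def Let_def)
next
  case (Cons F r)
  hence F: "F < 2 ^ (M ^ 3)" using assms by simp
  have "(2 * x + of_bool b) mod 2 = (of_bool b :: nat)" for x by (cases b) simp_all
  hence m: "enc_state M (F # r, b) mod 2 = of_bool b" unfolding enc_state.simps .
  note E = enc_stack_Cons[OF F]
  show ?thesis unfolding Cons
  proof (cases "first_rule d1 d2 d3 M F < 2 * M + M * M")
    case True
    thus "num_step d1 d2 d3 M test (enc_state M (F # r, b)) = enc_state M (dfs_step d1 d2 d3 M test (F # r, b))"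
      unfolding num_step_def at_leaf_def Let_def E m using E(1)[of r b] by (simp add: Let_def)
  next
    case False
    thus "num_step d1 d2 d3 M test (enc_state M (F # r, b)) = enc_state M (dfs_step d1 d2 d3 M test (F # r, b))"
      unfolding num_step_def at_leaf_def Let_def E m using E(1)[of r b] by (auto simp: Let_def)
  qed
qed

lemma pt_top_code:
  assumes "pt C M" "pb C M" "pt C z"
  shows "pt C (\<lambda>s. top_code (M s) (z s))"
  unfolding top_code_def by (intro pt_mod_pow2 pt_half pt_rules assms)

lemma ptb_at_leaf:
  assumes "pt C M" "pb C M" "pt C z"
  shows "ptb C (\<lambda>s. at_leaf d1 d2 d3 (M s) (z s))"
  unfolding at_leaf_def by (intro ptb_conj ptb_not ptb_eq ptb_less pt_half pt_top_code pt_first_rule pt_rules assms)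

lemma computable_If:
  assumes "ptb C P" "pt C f" "computable_in False C g \<tau>"
  shows "\<exists>e. computable_in False C (\<lambda>s. if P s then f s else g s)
     (\<lambda>s. poly_in C e s + (if P s then 0 else \<tau> s))"
proof -
  let ?N = "fst (snd C)"
  obtain e where 
    1: "computable_in True C (\<lambda>s. of_bool (P s)) (\<lambda>s. (?N s + 2) ^ e)"
    "computable_in True C f (\<lambda>s. (?N s + 2) ^ e)"
    by (rule pt_computable2[OF assms(1)[unfolded ptb_def] assms(2)])
  have "computable_in False C (\<lambda>s. if P s then f s else g s)
     (\<lambda>s. (?N s + 2) ^ e + (if P s then (?N s + 2) ^ e else \<tau> s))"
    by (rule computable_if[OF 1[THEN computable_impure] assms(3)])
  hence "computable_in False C (\<lambda>s. if P s then f s else g s)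
     (\<lambda>s. (?N s + 2) ^ e + (if P s then 0 else \<tau> s))"
    by (rule computable_mono[of _ _ _ _ _ 2]) auto
  thus ?thesis by blast
qed

definition leaf_time :: "nat \<Rightarrow> nat \<Rightarrow> (nat \<Rightarrow> nat) \<Rightarrow> nat \<Rightarrow> nat \<Rightarrow> nat \<Rightarrow> nat" where
  "leaf_time k l T p n F = p + 4 ^ (code_width k l n F + k) * (p + 1) + T (2 ^ (code_width k l n F + k))"

lemma leaf_time_mono: "p \<le> p' \<Longrightarrow> leaf_time k l T p n F \<le> leaf_time k l T p' n F"
  unfolding leaf_time_def by (intro add_mono mult_le_mono) auto

lemma computable_num_step:
  assumes P: "\<And>G. G \<in> input_graphs \<Longrightarrow> outputs_within P (encode_graph G) (count_scorpions k l G) (T (num_verts G))"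
    and n: "pt C n" "pb C n" and z: "pt C z"
  shows "\<exists>e. computable_in False C (\<lambda>s. num_step d1 d2 d3 (2 * n s) (leaf_test k l (n s)) (z s))
     (\<lambda>s. poly_in C e s + (if at_leaf d1 d2 d3 (2 * n s) (z s) then leaf_time k l T (poly_in C e s) (n s) (top_code (2 * n s) (z s)) else 0))"
proof -
  let ?N = "fst (snd C)" and ?M = "\<lambda>s. 2 * n s" and ?F = "\<lambda>s. top_code (2 * n s) (z s)"
  let ?leaf = "\<lambda>s. at_leaf d1 d2 d3 (?M s) (z s)" and ?r = "\<lambda>s. z s div 2 div 2 ^ (?M s ^ 3 + 1)"
  let ?t = "\<lambda>s. first_rule d1 d2 d3 (?M s) (?F s)"
  have M: "pt C ?M" "pb C ?M" by (intro pt_rules n)+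
  have F: "pt C ?F" by (intro pt_top_code M z)
  have B: "pt C (\<lambda>s. 2 ^ (?M s ^ 3))" by (intro pt_pow2 pt_rules M n)
  have r: "pt C ?r" by (intro pt_shift_right pt_half pt_rules M n z)
  have t: "pt C ?t" "pb C ?t" by (intro pt_first_rule pb_first_rule M F)+
  from computable_leaf_test[of P k l T, OF P n F] obtain e where
    test: "computable_in False C (\<lambda>s. of_bool (leaf_test k l (n s) (?F s))) (\<lambda>s. leaf_time k l T ((?N s + 2) ^ e) (n s) (?F s))"
    unfolding leaf_time_def by blast
  have "pt C (\<lambda>s. z s mod 2 ^ 1)" by (intro pt_mod_pow2 pt_rules z)
  hence zm: "pt C (\<lambda>s. z s mod 2)" by simp
  have "pt C (\<lambda>s. ?r s + ?r s)" by (intro pt_add r)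
  hence "pt C (\<lambda>s. 2 * ?r s)" by (simp add: mult_2)
  then obtain e2 where r2: "computable_in True C (\<lambda>s. 2 * ?r s) (\<lambda>s. (?N s + 2) ^ e2)" "computable_in True C (\<lambda>s. z s mod 2) (\<lambda>s. (?N s + 2) ^ e2)"
    by (rule pt_computable2[OF _ zm])
  define e1 where "e1 = e + e2"
  have le: "(?N s + 2) ^ e \<le> (?N s + 2) ^ e1" "(?N s + 2) ^ e2 \<le> (?N s + 2) ^ e1" for s
    unfolding e1_def by (rule power_increasing; simp)+
  let ?lt = "\<lambda>s. leaf_time k l T ((?N s + 2) ^ e1) (n s) (?F s)"
  have lt: "(?N s + 2) ^ e1 \<le> ?lt s" for s by (simp add: leaf_time_def)
  have test': "computable_in False C (\<lambda>s. of_bool (leaf_test k l (n s) (?F s))) ?lt"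
    by (rule computable_mono[OF test, of 1]) (use leaf_time_mono[OF le(1), of k l T] in \<open>simp add: le_Suc_eq\<close>)
  have le': "(?N s + 2) ^ e2 \<le> 1 * (?lt s + 1)" for s
    unfolding mult_1 by (rule trans_le_add1[OF order_trans[OF le(2) lt]])
  have "computable_in False C (\<lambda>s. 2 * ?r s + (1 - (1 - (z s mod 2 + of_bool (leaf_test k l (n s) (?F s)))))) ?lt"
    by (intro computable_add computable_sub computable_const test' 
       computable_mono[OF computable_impure[OF r2(1)] le'] computable_mono[OF computable_impure[OF r2(2)] le'])
  moreover have "pt C (\<lambda>s. 2 * ((?r s * 2 ^ (?M s ^ 3 + 1) + (2 ^ (?M s ^ 3) + child2 (?M s) (?F s) (?t s))) * 2 ^ (?M s ^ 3 + 1) + (2 ^ (?M s ^ 3) + child1 (?M s) (?F s) (?t s))) + z s mod 2)"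
    unfolding mult_2[of "_ + _"]
    by (intro pt_add pt_shift_left pt_child1 pt_child2 B r zm M F t pt_rules n)
  hence "pt C (\<lambda>s. if z s div 2 = 0 then z s else 2 * ((?r s * 2 ^ (?M s ^ 3 + 1) + (2 ^ (?M s ^ 3) + child2 (?M s) (?F s) (?t s))) * 2 ^ (?M s ^ 3 + 1) + (2 ^ (?M s ^ 3) + child1 (?M s) (?F s) (?t s))) + z s mod 2)"
    by (intro pt_If ptb_eq pt_half z pt_const)
  ultimately obtain e3 where "computable_in False C (\<lambda>s. num_step d1 d2 d3 (2 * n s) (leaf_test k l (n s)) (z s))
    (\<lambda>s. (?N s + 2) ^ e3 + (if \<not> ?leaf s then 0 else ?lt s))"
    using computable_If[OF ptb_not[OF ptb_at_leaf[OF M z]]] unfolding num_step_def Let_def by blast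
  moreover have "(?N s + 2) ^ e3 + (if \<not> ?leaf s then 0 else ?lt s) \<le> 1 * (((?N s + 2) ^ (e1 + e3) +
    (if ?leaf s then leaf_time k l T ((?N s + 2) ^ (e1 + e3)) (n s) (?F s) else 0)) + 1)" for s
  proof -
    have "(?N s + 2) ^ e3 \<le> (?N s + 2) ^ (e1 + e3)" "(?N s + 2) ^ e1 \<le> (?N s + 2) ^ (e1 + e3)"
      by (rule power_increasing; simp)+
    moreover from leaf_time_mono[OF this(2)] have "?lt s \<le> leaf_time k l T ((?N s + 2) ^ (e1 + e3)) (n s) (?F s)" .
    moreover have "a + (if \<not> Q then 0 else b) \<le> 1 * ((a' + (if Q then b' else 0)) + 1)" if "a \<le> a'" "b \<le> b'" for a b a' b' :: nat and Q
      using that by auto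
    ultimately show ?thesis by blast
  qed
  ultimately have "computable_in False C (\<lambda>s. num_step d1 d2 d3 (2 * n s) (leaf_test k l (n s)) (z s))
    (\<lambda>s. (?N s + 2) ^ (e1 + e3) + (if ?leaf s then leaf_time k l T ((?N s + 2) ^ (e1 + e3)) (n s) (?F s) else 0))"
    by (rule computable_mono)
  thus ?thesis by blast
qed

section \<open>Reading the input formula and iterating the search\<close>

definition cnf_ctx :: "cnf ctx" where
  "cnf_ctx = (encode_cnf, \<lambda>\<phi>. fst \<phi> + length (snd \<phi>), [])"

lemma cnf_ctx_simps: "fst cnf_ctx = encode_cnf" "fst (snd cnf_ctx) = (\<lambda>\<phi>. fst \<phi> + length (snd \<phi>))" "snd (snd cnf_ctx) = []"
  by (simp_all add: cnf_ctx_def)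

lemma loop_simps: "fst (loop C) = (\<lambda>x. fst C (fst x))" "fst (loop0 C) = (\<lambda>x. fst C (fst x))"
  "fst (snd (loop0 C)) = (\<lambda>x. fst (snd C) (fst x))"
  "snd (snd (loop0 C)) = map (\<lambda>g x. g (fst x)) (snd (snd C)) @ [\<lambda>x. fst (snd x), \<lambda>x. snd (snd x)]"
  by (simp_all add: loop_def loop0_def)

definition input_at :: "cnf \<Rightarrow> nat \<Rightarrow> nat" where
  "input_at \<phi> i = (if i < length (encode_cnf \<phi>) then encode_cnf \<phi> ! i else 0)"

definition init_code :: "cnf \<Rightarrow> nat" where
  "init_code \<phi> = mask_of ((2 * fst \<phi>) ^ 3) (\<lambda>e. \<exists>p<length (snd \<phi>).
     {input_at \<phi> (2 + 3 * p), input_at \<phi> (3 + 3 * p), input_at \<phi> (4 + 3 * p)} = clause (2 * fst \<phi>) e)"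

lemma init_code_less: "init_code \<phi> < 2 ^ ((2 * fst \<phi>) ^ 3)"
  unfolding init_code_def by (rule mask_of_less)

lemma encode_clauses_nth:
  assumes "p < length cs" "j < 3"
  shows "concat (map encode_clause cs) ! (3 * p + j) = encode_clause (cs ! p) ! j"
  using assms
proof (induction cs arbitrary: p)
  case (Cons c cs)
  have len: "length (encode_clause c) = 3" by (cases c) simp
  show ?case
  proof (cases p)
    case 0
    thus ?thesis using Cons.prems len by (simp add: nth_append)
  next
    case (Suc p')
    thus ?thesis using Cons.prems Cons.IH[of p'] len by (simp add: nth_append)
  qed
qed simp

lemma input_at_header: "input_at \<phi> 0 = fst \<phi>" "input_at \<phi> 1 = length (snd \<phi>)"
  by (cases \<phi>; simp add: input_at_def)+

lemma input_at_clause: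
  assumes "p < length (snd \<phi>)" "snd \<phi> ! p = (a, b, c)"
  shows "input_at \<phi> (2 + 3 * p) = encode_literal a" "input_at \<phi> (3 + 3 * p) = encode_literal b"
    "input_at \<phi> (4 + 3 * p) = encode_literal c"
proof -
  obtain n cs where \<phi>: "\<phi> = (n, cs)" by fastforce
  have "input_at \<phi> (2 + (3 * p + j)) = encode_clause (a, b, c) ! j" if "j < 3" for j
  proof -
    have "3 * p + j < 3 * length cs" using assms that by (simp add: \<phi>)
    thus ?thesis using encode_clauses_nth[of p cs j] assms that
      unfolding input_at_def length_encode_cnf by (simp add: \<phi> nth_Cons')
  qed
  from this[of 0] this[of 1] this[of 2] show "input_at \<phi> (2 + 3 * p) = encode_literal a" "input_at \<phi> (3 + 3 * p) = encode_literal b"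
    "input_at \<phi> (4 + 3 * p) = encode_literal c" by (simp_all add: numeral_eq_Suc)
qed

lemma fam_init_code:
  assumes "\<phi> \<in> cnf3"
  shows "fam (2 * fst \<phi>) (init_code \<phi>) = (\<lambda>c. encode_literal ` lits c) ` set (snd \<phi>)"
proof -
  let ?M = "2 * fst \<phi>" and ?G = "(\<lambda>c. encode_literal ` lits c) ` set (snd \<phi>)"
  have cl: "{input_at \<phi> (2 + 3 * p), input_at \<phi> (3 + 3 * p), input_at \<phi> (4 + 3 * p)} = encode_literal ` lits (snd \<phi> ! p)"
    if "p < length (snd \<phi>)" for p
  proof -
    obtain a b c where "snd \<phi> ! p = (a, b, c)" by (metis prod_cases3)
    with input_at_clause[OF that this] show ?thesis by simp
  qed
  have "family ?M ?G"
    unfolding family_def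
  proof
    fix S assume "S \<in> ?G"
    then obtain c where c: "c \<in> set (snd \<phi>)" "S = encode_literal ` lits c" by auto
    obtain x y z where xyz: "c = (x, y, z)" by (metis prod_cases3)
    have "fst v < fst \<phi>" if "v \<in> lits c" for v
      using assms c(1) that by (cases \<phi>) (fastforce simp: cnf3_def)
    hence "encode_literal v < ?M" if "v \<in> lits c" for v
      using that by (cases v) (force simp: of_bool_def)
    thus "S \<subseteq> {..<?M} \<and> S \<noteq> {} \<and> card S \<le> 3" using c xyz by (auto simp: card_insert_if)
  qed
  from fam_mask_of[OF this] have "fam ?M (mask_of (?M ^ 3) (\<lambda>e. clause ?M e \<in> ?G)) = ?G" .
  moreover have "(\<exists>p<length (snd \<phi>). {input_at \<phi> (2 + 3 * p), input_at \<phi> (3 + 3 * p), input_at \<phi> (4 + 3 * p)} = clause ?M e)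
     \<longleftrightarrow> clause ?M e \<in> ?G" for e
  proof -
    have "set (snd \<phi>) = (\<lambda>p. snd \<phi> ! p) ` {..<length (snd \<phi>)}" by (auto simp: set_conv_nth)
    hence G: "?G = (\<lambda>p. encode_literal ` lits (snd \<phi> ! p)) ` {..<length (snd \<phi>)}" by (simp only: image_image)
    show ?thesis unfolding G image_iff Bex_def lessThan_iff using cl by metis
  qed
  ultimately show ?thesis unfolding init_code_def by simp
qed

lemma satisfiable_iff:
  assumes "\<phi> \<in> cnf3"
  shows "satisfiable \<phi> \<longleftrightarrow> fam_sat (2 * fst \<phi>) (init_code \<phi>)"
proof -
  have "lit_true \<alpha> (encode_literal v) \<longleftrightarrow> (case v of (x, b) \<Rightarrow> \<alpha> x = b)" for \<alpha> v
    by (cases v) (auto simp: lit_true_def)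
  thus ?thesis
    unfolding satisfiable_def fam_sat_def fam_init_code[OF assms] sat_by_def by auto
qed

text \<open>The clauses are distinct triples over \<open>2 * n\<close> literals. Hence bounds
  polynomial in the input size are polynomial in the number \<open>n\<close> of variables.\<close>

lemma length_cnf3:
  assumes "\<phi> \<in> cnf3" shows "length (snd \<phi>) \<le> (2 * fst \<phi>) ^ 3"
proof -
  let ?L = "{..<fst \<phi>} \<times> (UNIV :: bool set)"
  have "set (snd \<phi>) \<subseteq> ?L \<times> ?L \<times> ?L"
  proof
    fix c assume c: "c \<in> set (snd \<phi>)"
    obtain x y z where xyz: "c = (x, y, z)" by (metis prod_cases3)
    have "fst v < fst \<phi>" if "v \<in> lits c" for v
      using assms c that by (cases \<phi>) (fastforce simp: cnf3_def)
    thus "c \<in> ?L \<times> ?L \<times> ?L" by (auto simp: xyz mem_Times_iff)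
  qed
  hence "card (set (snd \<phi>)) \<le> card (?L \<times> ?L \<times> ?L)" by (intro card_mono) auto
  also have "\<dots> = (2 * fst \<phi>) ^ 3" by (simp add: card_cartesian_product power3_eq_cube)
  finally show ?thesis using assms by (cases \<phi>) (simp add: cnf3_def distinct_card)
qed

text \<open>The encoded state with the input family alone on the stack and the flag cleared.\<close>

definition start :: "cnf \<Rightarrow> nat" where
  "start \<phi> = 2 * (2 ^ ((2 * fst \<phi>) ^ 3) + init_code \<phi>)"

text \<open>A power of two above \<open>2 * 2 powr (A * M)\<close> with \<open>A = 1 / q\<close> and
  \<open>M = 2 * n\<close>, which bounds the initial \<open>pot\<close>. Taking \<open>A\<close> as
  the inverse of an integer makes the exponent computable.\<close>

definition iterations :: "nat \<Rightarrow> nat \<Rightarrow> nat" where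
  "iterations q n = 2 ^ (2 * n div q + 2)"

lemma pt_input_at: "pt cnf_ctx i \<Longrightarrow> pt cnf_ctx (\<lambda>\<phi>. input_at \<phi> (i \<phi>))"
  using pt_input[of cnf_ctx i] unfolding input_at_def cnf_ctx_simps .

lemma pt_input_at_loop:
  assumes "pt (loop (loop cnf_ctx)) i"
  shows "pt (loop (loop cnf_ctx)) (\<lambda>x. input_at (fst (fst x)) (i x))"
  using pt_input[OF assms] unfolding input_at_def loop_simps cnf_ctx_simps .

lemma pt_size: "pt cnf_ctx fst" "pb cnf_ctx fst" "pt cnf_ctx (\<lambda>\<phi>. length (snd \<phi>))" "pb cnf_ctx (\<lambda>\<phi>. length (snd \<phi>))"
proof -
  show "pt cnf_ctx fst" using pt_input_at[OF pt_const[of cnf_ctx 0]] by (simp add: input_at_header)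
  show "pt cnf_ctx (\<lambda>\<phi>. length (snd \<phi>))" using pt_input_at[OF pt_const[of cnf_ctx 1]] input_at_header by simp
  show "pb cnf_ctx fst" "pb cnf_ctx (\<lambda>\<phi>. length (snd \<phi>))"
    by (rule pb_mono[OF pb_self]; simp add: cnf_ctx_def)+
qed

lemma pt_start: "pt cnf_ctx start"
proof -
  have M: "pt cnf_ctx (\<lambda>\<phi>. 2 * fst \<phi>)" "pb cnf_ctx (\<lambda>\<phi>. 2 * fst \<phi>)" by (intro pt_rules pt_size)+
  have init: "pt cnf_ctx init_code"
    unfolding init_code_def clause_def
    by (intro pt_mask_of ptb_bex ptb_eq3 pt_input_at_loop pt_lit pt_size M pt_rules)
  have "pt cnf_ctx (\<lambda>\<phi>. 2 ^ ((2 * fst \<phi>) ^ 3) + init_code \<phi> + (2 ^ ((2 * fst \<phi>) ^ 3) + init_code \<phi>))"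
    by (intro pt_add init pt_pow2 pt_rules M pt_size)
  thus ?thesis by (rule pt_cong) (simp add: start_def)
qed

lemma pt_iterations: "pt cnf_ctx (\<lambda>\<phi>. iterations q (fst \<phi>))"
  unfolding iterations_def by (intro pt_pow2 pt_rules pt_size)

definition states :: "nat \<Rightarrow> nat \<Rightarrow> nat \<Rightarrow> nat \<Rightarrow> nat \<Rightarrow> cnf \<Rightarrow> nat \<Rightarrow> nat" where
  "states d1 d2 d3 k l \<phi> i = ((num_step d1 d2 d3 (2 * fst \<phi>) (leaf_test k l (fst \<phi>))) ^^ i) (start \<phi>)"

text \<open>The number of rounds is exponential, so the step is used in \<open>loop0\<close>. The
  cost of a round stays tied to the state reached in it, because a small code width is known only
  for leaves that the search visits.\<close>

lemma computable_states:
  assumes P: "\<And>G. G \<in> input_graphs \<Longrightarrow> outputs_within P (encode_graph G) (count_scorpions k l G) (T (num_verts G))"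
  shows "\<exists>e. computable False encode_cnf [] (\<lambda>\<phi>. states d1 d2 d3 k l \<phi> (iterations q (fst \<phi>)) mod 2)
     (\<lambda>\<phi>. (fst \<phi> + length (snd \<phi>) + 2) ^ e + (\<Sum>i<iterations q (fst \<phi>). (fst \<phi> + length (snd \<phi>) + 2) ^ e +
        (if at_leaf d1 d2 d3 (2 * fst \<phi>) (states d1 d2 d3 k l \<phi> i)
         then leaf_time k l T ((fst \<phi> + length (snd \<phi>) + 2) ^ e) (fst \<phi>) (top_code (2 * fst \<phi>) (states d1 d2 d3 k l \<phi> i)) else 0) + 1))"
proof -
  let ?N = "\<lambda>\<phi> :: cnf. fst \<phi> + length (snd \<phi>)"
  let ?step = "\<lambda>\<phi> (i :: nat) z. num_step d1 d2 d3 (2 * fst \<phi>) (leaf_test k l (fst \<phi>)) z"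
  obtain e1 where 1: "computable True encode_cnf [] (\<lambda>\<phi>. iterations q (fst \<phi>)) (\<lambda>\<phi>. (?N \<phi> + 2) ^ e1)"
    "computable True encode_cnf [] start (\<lambda>\<phi>. (?N \<phi> + 2) ^ e1)"
    by (rule pt_computable2[OF pt_iterations[of q] pt_start]) (simp add: cnf_ctx_def)
  obtain e2 where 2: "computable False (\<lambda>x. encode_cnf (fst x)) [\<lambda>x. fst (snd x), \<lambda>x. snd (snd x)]
     (\<lambda>x. ?step (fst x) (fst (snd x)) (snd (snd x)))
     (\<lambda>x. (?N (fst x) + 2) ^ e2 + (if at_leaf d1 d2 d3 (2 * fst (fst x)) (snd (snd x)) then leaf_time k l T ((?N (fst x) + 2) ^ e2) (fst (fst x)) (top_code (2 * fst (fst x)) (snd (snd x))) else 0))"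
  proof -
    have "\<exists>e. computable False (fst (loop0 cnf_ctx)) (snd (snd (loop0 cnf_ctx))) (\<lambda>x. ?step (fst x) (fst (snd x)) (snd (snd x)))
     (\<lambda>x. (fst (snd (loop0 cnf_ctx)) x + 2) ^ e + (if at_leaf d1 d2 d3 (2 * fst (fst x)) (snd (snd x)) 
       then leaf_time k l T ((fst (snd (loop0 cnf_ctx)) x + 2) ^ e) (fst (fst x)) (top_code (2 * fst (fst x)) (snd (snd x))) else 0))"
      by (rule computable_num_step[where P = P]) (rule P pt_loop0[OF pt_size(1)] pb_loop0[OF pt_size(2)] pt_acc(2), assumption?)+
    thus thesis unfolding loop_simps cnf_ctx_simps list.map append_Nil by (elim exE) (rule that)
  qed
  have rec: "rec_nat a (\<lambda>_. f) m = (f ^^ m) a" for a m and f :: "nat \<Rightarrow> nat" by (induction m) auto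
  let ?lt = "\<lambda>e \<phi> i. if at_leaf d1 d2 d3 (2 * fst \<phi>) (states d1 d2 d3 k l \<phi> i)
         then leaf_time k l T ((?N \<phi> + 2) ^ e) (fst \<phi>) (top_code (2 * fst \<phi>) (states d1 d2 d3 k l \<phi> i)) else 0"
  have 3: "computable False encode_cnf [] (\<lambda>\<phi>. states d1 d2 d3 k l \<phi> (iterations q (fst \<phi>)))
     (\<lambda>\<phi>. (?N \<phi> + 2) ^ e1 + (\<Sum>i<iterations q (fst \<phi>). (?N \<phi> + 2) ^ e2 + ?lt e2 \<phi> i + 1))"
    using computable_iter[OF 1[THEN computable_impure], of ?step, unfolded list.map append_Nil, OF 2]
    unfolding rec states_def fst_conv snd_conv .
  define e where "e = e1 + e2"
  have "(?N \<phi> + 2) ^ e1 + (\<Sum>i<iterations q (fst \<phi>). (?N \<phi> + 2) ^ e2 + ?lt e2 \<phi> i + 1)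
    \<le> 1 * (((?N \<phi> + 2) ^ e + (\<Sum>i<iterations q (fst \<phi>). (?N \<phi> + 2) ^ e + ?lt e \<phi> i + 1)) + 1)" for \<phi>
  proof -
    have 4: "(?N \<phi> + 2) ^ e1 \<le> (?N \<phi> + 2) ^ e" "(?N \<phi> + 2) ^ e2 \<le> (?N \<phi> + 2) ^ e"
      unfolding e_def by (rule power_increasing; simp)+
    from leaf_time_mono[OF 4(2)] have "?lt e2 \<phi> i \<le> ?lt e \<phi> i" for i by simp
    with 4 have "(?N \<phi> + 2) ^ e1 + (\<Sum>i<iterations q (fst \<phi>). (?N \<phi> + 2) ^ e2 + ?lt e2 \<phi> i + 1)
      \<le> (?N \<phi> + 2) ^ e + (\<Sum>i<iterations q (fst \<phi>). (?N \<phi> + 2) ^ e + ?lt e \<phi> i + 1)"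
      by (intro add_mono sum_mono order_refl)
    thus ?thesis unfolding mult_1 by (rule trans_le_add1)
  qed
  from computable_mono[OF 3 this] have 5: "computable False encode_cnf [] (\<lambda>\<phi>. states d1 d2 d3 k l \<phi> (iterations q (fst \<phi>)))
     (\<lambda>\<phi>. (?N \<phi> + 2) ^ e + (\<Sum>i<iterations q (fst \<phi>). (?N \<phi> + 2) ^ e + ?lt e \<phi> i + 1))" .
  have "computable False encode_cnf [] (\<lambda>\<phi>. states d1 d2 d3 k l \<phi> (iterations q (fst \<phi>)) - 
     (states d1 d2 d3 k l \<phi> (iterations q (fst \<phi>)) div 2 + states d1 d2 d3 k l \<phi> (iterations q (fst \<phi>)) div 2))
     (\<lambda>\<phi>. (?N \<phi> + 2) ^ e + (\<Sum>i<iterations q (fst \<phi>). (?N \<phi> + 2) ^ e + ?lt e \<phi> i + 1))"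
    by (intro computable_sub computable_add computable_half 5)
  moreover have "x - (x div 2 + x div 2) = x mod 2" for x :: nat by presburger
  ultimately show ?thesis by auto
qed

text \<open>A clause with at most three literals has at most \<open>3 ^ 3\<close> codes as a triple
  of its own literals.\<close>

lemma card_act_codes_le: "card (act_codes M F) \<le> 27 * card (mins (fam M F))"
proof -
  have fin: "finite (mins (fam M F))" by (rule finite_subset[OF mins_subset family_finite[OF family_fam]])
  have "card {e. e < M ^ 3 \<and> clause M e = S} \<le> 27" if "S \<in> mins (fam M F)" for S
  proof -
    have "S \<in> fam M F" using that mins_subset by (rule subsetD[rotated])
    with family_fam[of M F] have S: "finite S" "card S \<le> 3"
      by (auto simp: family_def intro: family_finite_member[OF family_fam])
    have "inj_on (\<lambda>e. (lit M e 0, lit M e 1, lit M e 2)) {e. e < M ^ 3 \<and> clause M e = S}"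
    proof (rule inj_onI)
      fix e e' assume "(lit M e 0, lit M e 1, lit M e 2) = (lit M e' 0, lit M e' 1, lit M e' 2)"
      hence eq: "e div (M * M) = e' div (M * M)" "e div M mod M = e' div M mod M" "e mod M = e' mod M"
        by (auto simp: lit_def)
      have "e div M div M = e' div M div M" using eq(1) by (simp add: div_mult2_eq)
      with eq(2) have "e div M = e' div M" by (metis div_mult_mod_eq)
      with eq(3) show "e = e'" by (metis div_mult_mod_eq)
    qed
    moreover have "(\<lambda>e. (lit M e 0, lit M e 1, lit M e 2)) ` {e. e < M ^ 3 \<and> clause M e = S} \<subseteq> S \<times> S \<times> S"
      by (auto simp: clause_def)
    ultimately have "card {e. e < M ^ 3 \<and> clause M e = S} \<le> card (S \<times> S \<times> S)"
      by (rule card_inj_on_le) (use S in auto)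
    also have "\<dots> = card S ^ 3" by (simp add: card_cartesian_product power3_eq_cube)
    also have "\<dots> \<le> 3 ^ 3" by (rule power_mono) (use S in auto)
    finally show ?thesis by simp
  qed
  hence "(\<Sum>S\<in>mins (fam M F). card {e. e < M ^ 3 \<and> clause M e = S}) \<le> (\<Sum>S\<in>mins (fam M F). 27)"
    by (intro sum_mono)
  moreover have "card (\<Union>S\<in>mins (fam M F). {e. e < M ^ 3 \<and> clause M e = S}) \<le> (\<Sum>S\<in>mins (fam M F). card {e. e < M ^ 3 \<and> clause M e = S})"
    by (rule card_UN_le[OF fin])
  moreover have "act_codes M F = (\<Union>S\<in>mins (fam M F). {e. e < M ^ 3 \<and> clause M e = S})"
    by (auto simp: act_codes_def)
  ultimately show ?thesis by simp
qed

text \<open>The branching constants depend on \<open>q\<close> only and not on the formula, as one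
  program has to treat all formulas.\<close>

locale parameters =
  fixes d1 d2 d3 q :: nat and B :: real
  assumes q: "0 < q" and params: "\<And>M F0. family M F0 \<Longrightarrow> sparsify M F0 d1 d2 d3 (1 / q) B"
begin

lemma states_enc:
  fixes i :: nat
  assumes \<phi>: "\<phi> \<in> cnf3" and kl: "0 < l" "2 * l + 4 \<le> k"
  defines "M \<equiv> 2 * fst \<phi>"
  shows "states d1 d2 d3 k l \<phi> i = enc_state M (((dfs_step d1 d2 d3 M (fam_sat M)) ^^ i) ([init_code \<phi>], False))" (is ?A)
    and "\<forall>F\<in>set (fst (((dfs_step d1 d2 d3 M (fam_sat M)) ^^ i) ([init_code \<phi>], False))). sparsify.good M (fam M (init_code \<phi>)) d1 d2 F" (is ?B)
proof -
  interpret sparsify M "fam M (init_code \<phi>)" d1 d2 d3 "1 / q" B by (rule params[OF family_fam])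
  have test: "leaf_test k l (fst \<phi>) = fam_sat M"
    using leaf_test_iff[OF kl, of "fst \<phi>"] by (auto simp: fam_sat_def M_def)
  have g0: "\<forall>F\<in>set [init_code \<phi>]. good F"
    using inv_F0 init_code_less[of \<phi>, folded M_def] by (simp add: good_def)
  have B: "\<forall>F\<in>set (fst (((dfs_step d1 d2 d3 M (fam_sat M)) ^^ i) ([init_code \<phi>], False))). good F" for i
    using dfs_good[OF g0, of i False] by (metis prod.collapse)
  from B[of i] show ?B .
  show ?A
  proof (induction i)
    case 0
    show ?case by (simp add: states_def start_def M_def)
  next
    case (Suc i)
    obtain st b where st: "((dfs_step d1 d2 d3 M (fam_sat M)) ^^ i) ([init_code \<phi>], False) = (st, b)" by fastforce
    have "\<forall>F\<in>set st. F < 2 ^ (M ^ 3)" using B[of i] st by (simp add: good_def)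
    from num_step_enc[OF this, of d1 d2 d3 "fam_sat M" b] Suc st show ?case
      by (simp add: states_def test M_def)
  qed
qed

lemma iterations_enough: "2 * 2 powr (1 / q * real (2 * n)) \<le> real (iterations q n)"
proof -
  have "real (2 * n) / q < real (2 * n div q) + 1"
    using q floor_divide_of_nat_eq[of "2 * n" q, where ?'a = real] real_of_int_floor_add_one_gt[of "real (2 * n) / q"]
    by (metis of_int_of_nat_eq)
  hence "2 * 2 powr (1 / q * real (2 * n)) \<le> 2 * 2 powr (real (2 * n div q) + 1)" by simp
  also have "\<dots> = 2 powr (real (2 * n div q + 2))" by (simp add: powr_add)
  also have "\<dots> = real (iterations q n)" by (simp only: powr_realpow[of 2] iterations_def) simp
  finally show ?thesis .
qed

lemma states_result:
  assumes \<phi>: "\<phi> \<in> cnf3" and kl: "0 < l" "2 * l + 4 \<le> k"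
  shows "states d1 d2 d3 k l \<phi> (iterations q (fst \<phi>)) mod 2 = of_bool (satisfiable \<phi>)"
proof -
  define M where "M = 2 * fst \<phi>"
  interpret sparsify M "fam M (init_code \<phi>)" d1 d2 d3 "1 / q" B by (rule params[OF family_fam])
  have g0: "\<forall>F\<in>set [init_code \<phi>]. good F"
    using inv_F0 init_code_less[of \<phi>, folded M_def] by (simp add: good_def)
  have "2 powr \<Phi> (fam M (init_code \<phi>)) \<le> 2 powr (1 / q * M)" using \<Phi>_F0 by (intro powr_mono) auto
  hence "pot (init_code \<phi>) \<le> 2 * 2 powr (1 / q * M)" unfolding pot_def by linarith
  hence "(\<Sum>F\<leftarrow>[init_code \<phi>]. pot F) \<le> real (iterations q (fst \<phi>))"
    using iterations_enough[of "fst \<phi>"] by (simp add: M_def)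
  from dfs_result[OF g0 this, of False] states_enc(1)[OF \<phi> kl, of "iterations q (fst \<phi>)"] show ?thesis
    using satisfiable_iff[OF \<phi>] by (simp add: M_def)
qed

text \<open>A leaf has at most \<open>27 * (2 * n) * (1 + d1 + d3)\<close> active codes, and two
  bits for each give the factor 108. The number \<open>k - l - 2\<close> of groups is at least
  \<open>l\<close>.\<close>

lemma leaf_width:
  assumes \<phi>: "\<phi> \<in> cnf3" and kl: "0 < l" "2 * l + 4 \<le> k"
    and leaf: "at_leaf d1 d2 d3 (2 * fst \<phi>) (states d1 d2 d3 k l \<phi> i)"
  shows "real (code_width k l (fst \<phi>) (top_code (2 * fst \<phi>) (states d1 d2 d3 k l \<phi> i))) \<le>
    real (1 + 108 * (1 + d1 + d3)) * real (fst \<phi>) / real l + 3"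
proof -
  define n where "n = fst \<phi>"
  define M where "M = 2 * n"
  interpret sparsify M "fam M (init_code \<phi>)" d1 d2 d3 "1 / q" B by (rule params[OF family_fam])
  obtain st b where st: "((dfs_step d1 d2 d3 M (fam_sat M)) ^^ i) ([init_code \<phi>], False) = (st, b)" by fastforce
  have S: "states d1 d2 d3 k l \<phi> i = enc_state M (st, b)" using states_enc(1)[OF \<phi> kl, of i] st by (simp add: M_def n_def)
  have G: "\<forall>F\<in>set st. good F" using states_enc(2)[OF \<phi> kl, of i] st by (simp add: M_def n_def)
  have "st \<noteq> []" using leaf unfolding S at_leaf_def by auto
  then obtain F r where Fr: "st = F # r" by (cases st) auto
  have F: "good F" using G Fr by simp
  have top: "top_code M (states d1 d2 d3 k l \<phi> i) = F" unfolding S Fr by (rule enc_stack_Cons) (use F in \<open>simp add: good_def\<close>)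
  have nl: "\<not> first F < rule_count" using leaf top unfolding at_leaf_def by (simp add: M_def n_def)
  have "card (mins (fam M F)) \<le> M * (1 + d1 + d3)"
    by (rule leaf_card[OF family_fam none_branchable[OF nl]])
  define m where "m = rank M F (M ^ 3)"
  have "m \<le> 27 * card (mins (fam M F))" using card_act_codes_le[of M F] by (simp add: m_def card_act_codes)
  also have "\<dots> \<le> 27 * (M * (1 + d1 + d3))" by (intro mult_le_mono2) fact
  finally have m: "m \<le> 54 * (1 + d1 + d3) * n" by (simp add: M_def algebra_simps)
  have cw: "code_width k l n F = n div (l + 1) + 1 + 2 * (m div (k - l - 2) + 1)"
    by (simp add: code_width_def m_def M_def)
  have "n div (l + 1) \<le> n div l" by (rule div_le_mono2) (use kl in auto)
  moreover have "m div (k - l - 2) \<le> m div l" by (rule div_le_mono2) (use kl in auto)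
  moreover have "real (n div l) \<le> real n / real l" "real (m div l) \<le> real m / real l"
    by (rule of_nat_div_le_of_nat)+
  ultimately have "real (code_width k l n F) \<le> real n / real l + 1 + 2 * (real m / real l + 1)"
    unfolding cw by simp
  also have "real m / real l \<le> real (54 * (1 + d1 + d3) * n) / real l"
    using m by (intro divide_right_mono) (simp_all only: of_nat_le_iff of_nat_0_le_iff)
  finally have "real (code_width k l n F) \<le> real n / real l + 1 + 2 * (real (54 * (1 + d1 + d3) * n) / real l + 1)" by simp
  also have "\<dots> = real (1 + 108 * (1 + d1 + d3)) * real n / real l + 3"
    by (simp add: add_divide_distrib algebra_simps)
  finally show ?thesis using top by (simp add: M_def n_def)
qed

end

section \<open>Running time of the reduction\<close>

text \<open>The additive constant takes care of the finitely many exceptions, among them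
  \<open>n = 0\<close>, where \<open>powr\<close> yields 0.\<close>

lemma bigo_powr_bound:
  fixes T :: "nat \<Rightarrow> nat"
  assumes "(\<lambda>n. real (T n)) \<in> O(\<lambda>n. real n powr \<beta>)"
  shows "\<exists>C>0. \<forall>n. real (T n) \<le> C * real n powr \<beta> + C"
proof -
  from assms obtain c where c: "c > 0" "eventually (\<lambda>n. norm (real (T n)) \<le> c * norm (real n powr \<beta>)) at_top"
    by (auto elim: landau_o.bigE)
  then obtain n0 where n0: "\<And>n. n \<ge> n0 \<Longrightarrow> real (T n) \<le> c * real n powr \<beta>"
    by (auto simp: eventually_at_top_linorder)
  define C where "C = c + (\<Sum>n<n0. real (T n))"
  have C: "c \<le> C" "0 < C" using c(1) sum_nonneg[of "{..<n0}" "\<lambda>n. real (T n)"] by (auto simp: C_def)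
  have "real (T n) \<le> C * real n powr \<beta> + C" for n
  proof (cases "n < n0")
    case True
    have "real (T n) \<le> (\<Sum>n<n0. real (T n))" by (rule member_le_sum) (use True in auto)
    also have "\<dots> \<le> C" using c(1) by (simp add: C_def)
    also have "\<dots> \<le> C * real n powr \<beta> + C" using C by simp
    finally show ?thesis .
  next
    case False
    hence "real (T n) \<le> c * real n powr \<beta>" using n0 by simp
    also have "\<dots> \<le> C * real n powr \<beta>" using C by (intro mult_right_mono) auto
    also have "\<dots> \<le> C * real n powr \<beta> + C" using C by simp
    finally show ?thesis .
  qed
  with C show ?thesis by blast
qed

lemma outputs_within_mono: "outputs_within p xs y T \<Longrightarrow> T \<le> T' \<Longrightarrow> outputs_within p xs y T'"
  unfolding outputs_within_def using order_trans by blast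

lemma poly_le_exp:
  fixes \<epsilon> :: real
  assumes "0 < \<epsilon>"
  shows "\<exists>K>0. \<forall>n. real ((n + (2 * n) ^ 3 + 2) ^ e) \<le> K * 2 powr (\<epsilon> * real n)"
proof -
  have "(\<lambda>n. real n + (2 * real n) ^ 3 + 2) \<in> O(\<lambda>n. real n ^ 3)" by real_asymp
  hence "(\<lambda>n. (real n + (2 * real n) ^ 3 + 2) ^ e) \<in> O(\<lambda>n. (real n ^ 3) ^ e)" by (rule landau_o.big_power)
  also have "(\<lambda>n. (real n ^ 3) ^ e) \<in> O(\<lambda>n. 2 powr (\<epsilon> * real n))"
    using assms unfolding power_mult[symmetric] by real_asymp
  finally obtain c where c: "c > 0" "eventually (\<lambda>n. norm ((real n + (2 * real n) ^ 3 + 2) ^ e) \<le> c * norm (2 powr (\<epsilon> * real n))) at_top"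
    by (auto elim: landau_o.bigE)
  then obtain n0 where n0: "\<And>n. n \<ge> n0 \<Longrightarrow> real ((n + (2 * n) ^ 3 + 2) ^ e) \<le> c * 2 powr (\<epsilon> * real n)"
    by (auto simp: eventually_at_top_linorder add_ac)
  define K where "K = c + (\<Sum>n<n0. real ((n + (2 * n) ^ 3 + 2) ^ e))"
  have K: "c \<le> K" "0 < K" using c(1) sum_nonneg[of "{..<n0}" "\<lambda>n. real ((n + (2 * n) ^ 3 + 2) ^ e)"] by (auto simp: K_def)
  have "real ((n + (2 * n) ^ 3 + 2) ^ e) \<le> K * 2 powr (\<epsilon> * real n)" for n
  proof (cases "n < n0")
    case True
    have "real ((n + (2 * n) ^ 3 + 2) ^ e) \<le> (\<Sum>n<n0. real ((n + (2 * n) ^ 3 + 2) ^ e))" by (rule member_le_sum) (use True in auto)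
    also have "\<dots> \<le> K" using c(1) by (simp add: K_def)
    also have "\<dots> \<le> K * 2 powr (\<epsilon> * real n)" using K assms by (simp add: ge_one_powr_ge_zero)
    finally show ?thesis .
  next
    case False
    hence "real ((n + (2 * n) ^ 3 + 2) ^ e) \<le> c * 2 powr (\<epsilon> * real n)" using n0 by simp
    also have "\<dots> \<le> K * 2 powr (\<epsilon> * real n)" using K by (intro mult_right_mono) auto
    finally show ?thesis .
  qed
  with K show ?thesis by blast
qed

text \<open>With \<open>k\<close> fixed, \<open>n div k\<close> grows linearly and finally exceeds
  every multiple of the square root of \<open>n\<close>.\<close>

lemma sublinear_not_solvable:
  assumes kl: "0 < l" "2 * l + 4 \<le> k" and \<beta>: "\<beta> \<le> 1 / 2"
  shows "\<not> solvable_in_time input_graphs num_verts encode_graph (count_scorpions k l) (\<lambda>n. real n powr \<beta>)"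
proof
  assume "solvable_in_time input_graphs num_verts encode_graph (count_scorpions k l) (\<lambda>n. real n powr \<beta>)"
  then obtain P T where T: "(\<lambda>n. real (T n)) \<in> O(\<lambda>n. real n powr \<beta>)"
    and P: "\<And>G. G \<in> input_graphs \<Longrightarrow> outputs_within P (encode_graph G) (count_scorpions k l G) (T (num_verts G))"
    unfolding solvable_in_time_def by blast
  from bigo_powr_bound[OF T] obtain C where C: "0 < C" "\<And>n. real (T n) \<le> C * real n powr \<beta> + C" by blast
  have k: "0 < real k" using kl by simp
  have "eventually (\<lambda>n :: nat. C * real n powr (1 / 2) + C < real n / real k - 1) at_top"
    using C(1) k by real_asymp
  hence "eventually (\<lambda>n :: nat. C * real n powr (1 / 2) + C < real n / real k - 1 \<and> 1 \<le> n) at_top"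
    by (intro eventually_conj eventually_ge_at_top)
  from eventually_happens'[OF _ this] obtain n :: nat where n: "C * real n powr (1 / 2) + C < real n / real k - 1" "1 \<le> n" by auto
  have "real n / real k < real (n div k) + 1"
    using floor_divide_of_nat_eq[of n k, where ?'a = real] real_of_int_floor_add_one_gt[of "real n / real k"]
    by (metis of_int_of_nat_eq)
  also have "real (n div k) \<le> real (T n)" using sublinear_impossible[OF kl P, of n] by simp
  also have "real (T n) \<le> C * real n powr \<beta> + C" by (rule C)
  also have "real n powr \<beta> \<le> real n powr (1 / 2)" using \<beta> n by (intro powr_mono) auto
  finally show False using n C(1) by (simp add: mult_left_mono)
qed

lemma ex_parameters:
  assumes "0 < q"
  shows "\<exists>d1 d2 d3 B. parameters d1 d2 d3 q B"
proof -
  have "0 < 1 / real q" using assms by simp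
  from sparsify_parameters[OF this] obtain d1 d2 d3 B where "0 < d1" "0 < d2" "0 < d3" "0 < B" "0 < 1 / real q - B * real (d1 + d2)"
    "2 powr (- (1 / real q - B * real (d1 + d2))) + 2 powr (- ((1 / real q - B * real (d1 + d2)) * real d1)) \<le> 1"
    "2 powr (- B) + 2 powr (- ((1 / real q - B * real (d1 + d2)) * real d2)) \<le> 1"
    "2 powr (- (1 / real q - B * real (d1 + d2))) + 2 powr (- (B * real d3)) \<le> 1" by blast
  hence "parameters d1 d2 d3 q B"
    using assms by unfold_locales
  thus ?thesis by blast
qed

section \<open>From a counting program to a decision procedure for satisfiability\<close>

context parameters begin

abbreviation width_const :: real where
  "width_const \<equiv> real (1 + 108 * (1 + d1 + d3))"

text \<open>The exponent \<open>\<delta> * l\<close> times the width is about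
  \<open>\<delta> * width_const * n\<close>, free of \<open>l\<close>. In the square, one factor
  pays for the size of the matrix and the other for computing an entry; the call of the counting
  program fits into a single factor.\<close>

lemma leaf_time_bound:
  assumes w: "real (code_width k l n F) \<le> width_const * real n / real l + 3"
    and l: "0 < l" "2 * width_const / real l \<le> \<epsilon> / 4" and \<delta>: "0 < \<delta>" "\<delta> * width_const \<le> \<epsilon> / 4"
    and T: "\<And>n. real (T n) \<le> C * real n powr (\<delta> * real l) + C" "0 < C"
    and p: "real p \<le> K * 2 powr (\<epsilon> / 4 * real n)" "0 < K"
  shows "real (leaf_time k l T p n F) \<le>
    (K + 2 powr (2 * (3 + real k)) * (K + 1) + C * 2 powr (\<delta> * real l * (3 + real k)) + C) * (2 powr (\<epsilon> / 4 * real n))\<^sup>2"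
proof -
  define E where "E = 2 powr (\<epsilon> / 4 * real n)"
  define w where "w = code_width k l n F + k"
  have \<epsilon>: "0 \<le> \<epsilon> / 4" using \<delta> by (smt (verit) mult_nonneg_nonneg of_nat_0_le_iff)
  have E: "1 \<le> E" unfolding E_def using \<epsilon> by (intro ge_one_powr_ge_zero) auto
  have w_le: "real w \<le> width_const * real n / real l + (3 + real k)" using assms(1) by (simp add: w_def)
  have "2 * real w \<le> 2 * (width_const * real n / real l + (3 + real k))" using w_le by simp
  also have "\<dots> = 2 * width_const / real l * real n + 2 * (3 + real k)" by (simp add: algebra_simps)
  also have "\<dots> \<le> \<epsilon> / 4 * real n + 2 * (3 + real k)" using l by (intro add_right_mono mult_right_mono) auto
  finally have "2 powr (2 * real w) \<le> 2 powr (\<epsilon> / 4 * real n + 2 * (3 + real k))" by (intro powr_mono) auto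
  moreover have "real (4 ^ w) = 2 powr (2 * real w)"
  proof -
    have "real (4 ^ w) = 2 ^ (2 * w)" by (simp add: power_mult)
    also have "\<dots> = 2 powr real (2 * w)" by (rule powr_realpow[symmetric]) simp
    finally show ?thesis by simp
  qed
  ultimately have four: "real (4 ^ w) \<le> 2 powr (2 * (3 + real k)) * E" by (simp add: E_def powr_add mult.commute)
  have "\<delta> * real l * real w \<le> \<delta> * real l * (width_const * real n / real l + (3 + real k))"
    using w_le \<delta> by (intro mult_left_mono) auto
  also have "\<dots> = \<delta> * width_const * real n + \<delta> * real l * (3 + real k)" using l(1) by (simp add: field_simps)
  also have "\<dots> \<le> \<epsilon> / 4 * real n + \<delta> * real l * (3 + real k)" using \<delta> by (intro add_right_mono mult_right_mono) auto
  finally have "2 powr (\<delta> * real l * real w) \<le> 2 powr (\<epsilon> / 4 * real n + \<delta> * real l * (3 + real k))" by (intro powr_mono) auto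
  moreover have "real (2 ^ w) powr (\<delta> * real l) = 2 powr (\<delta> * real l * real w)"
  proof -
    have "real (2 ^ w) = 2 powr real w" by (simp add: powr_realpow)
    thus ?thesis by (simp add: powr_powr mult.commute)
  qed
  ultimately have "real (2 ^ w) powr (\<delta> * real l) \<le> 2 powr (\<delta> * real l * (3 + real k)) * E" by (simp add: E_def powr_add mult.commute)
  hence "C * real (2 ^ w) powr (\<delta> * real l) + C \<le> C * (2 powr (\<delta> * real l * (3 + real k)) * E) + C"
    using T(2) by (intro add_right_mono mult_left_mono) auto
  with T(1)[of "2 ^ w"] have T': "real (T (2 ^ w)) \<le> C * (2 powr (\<delta> * real l * (3 + real k)) * E) + C" by linarith
  have p': "real (p + 1) \<le> (K + 1) * E" using p E by (simp add: E_def distrib_right)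
  have E2: "E \<le> E\<^sup>2" "1 \<le> E\<^sup>2" using power_increasing[of 1 2 E] one_le_power[of E 2] E by simp_all
  have "real (leaf_time k l T p n F) = real p + real (4 ^ w) * real (p + 1) + real (T (2 ^ w))"
    by (simp add: leaf_time_def w_def distrib_left)
  also have "\<dots> \<le> K * E + (2 powr (2 * (3 + real k)) * E) * ((K + 1) * E) + (C * (2 powr (\<delta> * real l * (3 + real k)) * E) + C)"
    using p four p' T' E by (intro add_mono mult_mono) (auto simp: E_def)
  also have "\<dots> \<le> K * E\<^sup>2 + (2 powr (2 * (3 + real k)) * (K + 1)) * E\<^sup>2 + (C * 2 powr (\<delta> * real l * (3 + real k)) * E\<^sup>2 + C * E\<^sup>2)"
  proof (intro add_mono)
    show "K * E \<le> K * E\<^sup>2" using E2 p(2) by (intro mult_left_mono) auto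
    show "2 powr (2 * (3 + real k)) * E * ((K + 1) * E) \<le> 2 powr (2 * (3 + real k)) * (K + 1) * E\<^sup>2"
      by (simp add: power2_eq_square mult_ac)
    have "C * 2 powr (\<delta> * real l * (3 + real k)) * E \<le> C * 2 powr (\<delta> * real l * (3 + real k)) * E\<^sup>2"
      using E2 T(2) by (intro mult_left_mono) auto
    thus "C * (2 powr (\<delta> * real l * (3 + real k)) * E) \<le> C * 2 powr (\<delta> * real l * (3 + real k)) * E\<^sup>2" by (simp add: mult.assoc)
    show "C \<le> C * E\<^sup>2" using E2 T(2) by simp
  qed
  also have "\<dots> = (K + 2 powr (2 * (3 + real k)) * (K + 1) + C * 2 powr (\<delta> * real l * (3 + real k)) + C) * E\<^sup>2"
    by (simp add: algebra_simps)
  finally show ?thesis unfolding E_def .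
qed

theorem reduction:
  assumes kl: "0 < l" "2 * l + 4 \<le> k" and l: "2 * width_const / real l \<le> \<epsilon> / 4" and \<delta>: "0 < \<delta>" "\<delta> * width_const \<le> \<epsilon> / 4"
    and q_large: "2 / real q \<le> \<epsilon> / 4" and \<epsilon>: "0 < \<epsilon>"
    and solvable: "solvable_in_time input_graphs num_verts encode_graph (count_scorpions k l) (\<lambda>n. real n powr (\<delta> * real l))"
  shows "solvable_in_time cnf3 fst encode_cnf (\<lambda>\<phi>. of_bool (satisfiable \<phi>)) (\<lambda>n. 2 powr (\<epsilon> * real n))"
proof -
  from solvable obtain P T where T: "(\<lambda>n. real (T n)) \<in> O(\<lambda>n. real n powr (\<delta> * real l))"
    and P: "\<And>G. G \<in> input_graphs \<Longrightarrow> outputs_within P (encode_graph G) (count_scorpions k l G) (T (num_verts G))"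
    unfolding solvable_in_time_def by blast
  from bigo_powr_bound[OF T] obtain C where C: "0 < C" "\<And>n. real (T n) \<le> C * real n powr (\<delta> * real l) + C" by blast
  let ?p = "\<lambda>e \<phi>. (fst \<phi> + length (snd \<phi>) + 2) ^ e"
  let ?lt = "\<lambda>e \<phi> i. if at_leaf d1 d2 d3 (2 * fst \<phi>) (states d1 d2 d3 k l \<phi> i)
         then leaf_time k l T (?p e \<phi>) (fst \<phi>) (top_code (2 * fst \<phi>) (states d1 d2 d3 k l \<phi> i)) else 0"
  let ?\<tau> = "\<lambda>e \<phi>. ?p e \<phi> + (\<Sum>i<iterations q (fst \<phi>). ?p e \<phi> + ?lt e \<phi> i + 1)"
  from computable_states[of P k l T d1 d2 d3 q, OF P] obtain e where
    "computable False encode_cnf [] (\<lambda>\<phi>. states d1 d2 d3 k l \<phi> (iterations q (fst \<phi>)) mod 2) (?\<tau> e)"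
    by blast
  from outputs_computable[OF this] obtain R c where
    R: "\<And>\<phi>. outputs_within R (encode_cnf \<phi>) (states d1 d2 d3 k l \<phi> (iterations q (fst \<phi>)) mod 2) (c * (?\<tau> e \<phi> + 1))" by blast
  from poly_le_exp[of "\<epsilon> / 4" e] \<epsilon> obtain K where K: "0 < K" "\<And>n. real ((n + (2 * n) ^ 3 + 2) ^ e) \<le> K * 2 powr (\<epsilon> / 4 * real n)" by auto
  define D where "D = K + 2 powr (2 * (3 + real k)) * (K + 1) + C * 2 powr (\<delta> * real l * (3 + real k)) + C"
  have D: "0 \<le> D" using K C by (simp add: D_def)
  \<comment> \<open>With \<open>E = 2 powr (\<epsilon> / 4 * n)\<close> there are at most
    \<open>4 * E\<close> rounds at \<open>(K + D + 1) * E ^ 2\<close> each. The total of order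
    \<open>E ^ 3\<close> is below \<open>E ^ 4 = 2 powr (\<epsilon> * n)\<close>.\<close>
  define Z where "Z = real c * (K + 4 * (K + D + 1) + 1)"
  have bound: "real (c * (?\<tau> e \<phi> + 1)) \<le> Z * 2 powr (\<epsilon> * real (fst \<phi>))" if \<phi>: "\<phi> \<in> cnf3" for \<phi>
  proof -
    define n where "n = fst \<phi>"
    define E where "E = 2 powr (\<epsilon> / 4 * real n)"
    have E: "1 \<le> E" unfolding E_def using \<epsilon> by (intro ge_one_powr_ge_zero) auto
    have "?p e \<phi> \<le> (n + (2 * n) ^ 3 + 2) ^ e"
      using length_cnf3[OF \<phi>] by (intro power_mono) (auto simp: n_def)
    hence p: "real (?p e \<phi>) \<le> K * E" using K(2)[of n] unfolding E_def by (meson of_nat_le_iff order_trans)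
    have lt: "real (?lt e \<phi> i) \<le> D * E\<^sup>2" for i
    proof (cases "at_leaf d1 d2 d3 (2 * fst \<phi>) (states d1 d2 d3 k l \<phi> i)")
      case True
      from leaf_time_bound[OF leaf_width[OF \<phi> kl True] kl(1) l \<delta> C(2,1) p[unfolded E_def n_def] K(1)] True
      show ?thesis by (simp add: D_def E_def n_def)
    qed (use D in simp)
    have E3: "E \<le> E ^ 3" "1 \<le> E\<^sup>2" "E \<le> E\<^sup>2" "E ^ 3 \<le> E ^ 4" "1 \<le> E ^ 4" "E ^ 3 = E * E\<^sup>2"
      using E power_increasing[of 1 3 E] power_increasing[of 0 2 E] power_increasing[of 1 2 E] power_increasing[of 3 4 E] 
        power_increasing[of 0 4 E] by (auto simp: power_numeral_reduce)
    have "real (iterations q n) \<le> 4 * E"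
    proof -
      have "real (iterations q n) = 2 powr (real (2 * n div q) + 2)"
        unfolding iterations_def by (simp add: powr_add powr_realpow)
      also have "\<dots> \<le> 2 powr (\<epsilon> / 4 * real n + 2)"
      proof (rule powr_mono)
        have "real (2 * n div q) \<le> real (2 * n) / real q" by (rule of_nat_div_le_of_nat)
        also have "\<dots> = 2 / real q * real n" by simp
        also have "\<dots> \<le> \<epsilon> / 4 * real n" using q_large by (intro mult_right_mono) auto
        finally show "real (2 * n div q) + 2 \<le> \<epsilon> / 4 * real n + 2" by simp
      qed simp
      finally show ?thesis by (simp add: E_def powr_add)
    qed
    moreover have "real (\<Sum>i<iterations q n. ?p e \<phi> + ?lt e \<phi> i + 1) \<le> real (iterations q n) * ((K + D + 1) * E\<^sup>2)"
    proof -
      have "real (?p e \<phi> + ?lt e \<phi> i + 1) \<le> (K + D + 1) * E\<^sup>2" for i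
      proof -
        have "K * E \<le> K * E\<^sup>2" using K(1) E3 by (intro mult_left_mono) auto
        with p lt[of i] E3(2) have "real (?p e \<phi>) + real (?lt e \<phi> i) + 1 \<le> K * E\<^sup>2 + D * E\<^sup>2 + E\<^sup>2" by linarith
        thus ?thesis by (simp add: algebra_simps)
      qed
      hence "(\<Sum>i<iterations q n. real (?p e \<phi> + ?lt e \<phi> i + 1)) \<le> (\<Sum>i<iterations q n. (K + D + 1) * E\<^sup>2)"
        by (intro sum_mono)
      thus ?thesis by simp
    qed
    moreover have "real (iterations q n) * ((K + D + 1) * E\<^sup>2) \<le> 4 * E * ((K + D + 1) * E\<^sup>2)"
      using calculation(1) K D by (intro mult_right_mono) auto
    ultimately have "real (?\<tau> e \<phi> + 1) \<le> K * E + 4 * E * ((K + D + 1) * E\<^sup>2) + 1"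
      using p by (simp add: n_def)
    also have "\<dots> = K * E + 4 * (K + D + 1) * E ^ 3 + 1" by (simp add: E3(6) mult_ac)
    also have "\<dots> \<le> K * E ^ 4 + 4 * (K + D + 1) * E ^ 4 + E ^ 4"
      using E3 K D by (intro add_mono mult_left_mono) auto
    also have "\<dots> = (K + 4 * (K + D + 1) + 1) * E ^ 4" by (simp add: algebra_simps)
    also have "E ^ 4 = 2 powr (\<epsilon> * real n)" by (simp add: E_def powr_power)
    finally have "real c * real (?\<tau> e \<phi> + 1) \<le> real c * ((K + 4 * (K + D + 1) + 1) * 2 powr (\<epsilon> * real n))"
      by (intro mult_left_mono) auto
    thus ?thesis unfolding Z_def n_def of_nat_mult by (simp add: mult.assoc)
  qed
  \<comment> \<open>A natural number that depends on \<open>n\<close> alone, as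
    \<open>solvable_in_time\<close> demands.\<close>
  define T' where "T' n = nat \<lfloor>Z * 2 powr (\<epsilon> * real n)\<rfloor>" for n
  have Z: "0 \<le> Z" using K D by (simp add: Z_def)
  have "real (T' n) \<le> (Z + 1) * 2 powr (\<epsilon> * real n)" for n
  proof -
    have "real (T' n) \<le> Z * 2 powr (\<epsilon> * real n)" using Z by (simp add: T'_def)
    also have "\<dots> \<le> (Z + 1) * 2 powr (\<epsilon> * real n)" by (intro mult_right_mono) auto
    finally show ?thesis .
  qed
  hence "(\<lambda>n. real (T' n)) \<in> O(\<lambda>n. 2 powr (\<epsilon> * real n))"
    using Z by (intro landau_o.bigI[of "Z + 1"]) (auto intro!: always_eventually)
  moreover have "outputs_within R (encode_cnf \<phi>) (of_bool (satisfiable \<phi>)) (T' (fst \<phi>))" if "\<phi> \<in> cnf3" for \<phi>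
  proof -
    have "c * (?\<tau> e \<phi> + 1) \<le> T' (fst \<phi>)" unfolding T'_def using bound[OF that] by (simp only: le_nat_floor)
    from outputs_within_mono[OF R[of \<phi>] this] show ?thesis unfolding states_result[OF that kl] .
  qed
  ultimately show ?thesis unfolding solvable_in_time_def by blast
qed

end

theorem corollary3p5:
  assumes ETH
  shows "\<exists>(N\<^sub>0 :: nat) (\<delta> :: real). N\<^sub>0 > 0 \<and> \<delta> > 0 \<and>
    (\<forall>k l :: nat. k \<ge> N\<^sub>0 \<and> 0 < l \<and> real l \<le> (real k - 4) / 2 \<longrightarrow>
       \<not> solvable_in_time input_graphs num_verts encode_graph (count_scorpions k l)
           (\<lambda>n. real n powr (\<delta> * real l)))"
proof -
  from assms obtain \<epsilon> where \<epsilon>: "0 < \<epsilon>" and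
    hard: "\<not> solvable_in_time cnf3 fst encode_cnf (\<lambda>\<phi>. of_bool (satisfiable \<phi>)) (\<lambda>n. 2 powr (\<epsilon> * real n))"
    unfolding ETH_def by blast
  \<comment> \<open>Equivalent to \<open>2 / q < \<epsilon> / 4\<close>; the 2 comes from the
    \<open>2 * n\<close> literals.\<close>
  obtain q :: nat where q_eps: "8 / \<epsilon> < real q" using reals_Archimedean2 by blast
  have q0: "0 < q" using q_eps \<epsilon> by (metis divide_pos_pos gr0I less_asym of_nat_0 zero_less_numeral)
  from ex_parameters[OF q0] obtain d1 d2 d3 B where "parameters d1 d2 d3 q B" by blast
  then interpret parameters d1 d2 d3 q B .
  have q_large: "2 / real q \<le> \<epsilon> / 4"
  proof -
    have "8 < real q * \<epsilon>" using q_eps \<epsilon> by (simp add: pos_divide_less_eq)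
    thus ?thesis using q0 by (simp add: field_simps)
  qed
  define c where "c = width_const"
  have c: "0 < c" by (simp add: c_def)
  \<comment> \<open>From \<open>l0\<close> on, the matrix of a leaf graph has at most
    \<open>2 powr (\<epsilon> / 4 * n)\<close> entries up to a constant factor.\<close>
  obtain l0 :: nat where l0: "8 * c / \<epsilon> < real l0" using reals_Archimedean2 by blast
  have l0_pos: "0 < real l0" using l0 c \<epsilon> by (meson divide_pos_pos less_trans mult_pos_pos zero_less_numeral)
  \<comment> \<open>The first bound pays for the counting program on leaf graphs when
    \<open>l0 \<le> l\<close>; the second gives exponents of at most \<open>1 / 2\<close> when
    \<open>l < l0\<close>.\<close>
  define \<delta> where "\<delta> = min (\<epsilon> / (4 * c)) (1 / (2 * real l0))"
  have \<delta>: "0 < \<delta>" "\<delta> * c \<le> \<epsilon> / 4" "\<delta> * real l0 \<le> 1 / 2"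
  proof -
    show "0 < \<delta>" using \<epsilon> c l0_pos by (simp add: \<delta>_def)
    have "\<delta> * c \<le> \<epsilon> / (4 * c) * c" using c by (intro mult_right_mono) (auto simp: \<delta>_def)
    thus "\<delta> * c \<le> \<epsilon> / 4" using c by simp
    have "\<delta> * real l0 \<le> 1 / (2 * real l0) * real l0" using l0_pos by (intro mult_right_mono) (auto simp: \<delta>_def)
    thus "\<delta> * real l0 \<le> 1 / 2" using l0_pos by simp
  qed
  have "\<not> solvable_in_time input_graphs num_verts encode_graph (count_scorpions k l) (\<lambda>n. real n powr (\<delta> * real l))"
    if l: "0 < l" "real l \<le> (real k - 4) / 2" for k l
  proof -
    have "real (2 * l + 4) \<le> real k" using l(2) by simp
    hence kl: "2 * l + 4 \<le> k" by (simp only: of_nat_le_iff)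
    show ?thesis
    proof (cases "l < l0")
      case True
      hence "\<delta> * real l \<le> \<delta> * real l0" using \<delta>(1) by (intro mult_left_mono) auto
      with \<delta>(3) show ?thesis by (intro sublinear_not_solvable[OF l(1) kl]) simp
    next
      case False
      hence "8 * c / \<epsilon> < real l" using l0 by linarith
      hence "2 * c / real l \<le> \<epsilon> / 4" using l(1) \<epsilon> by (simp add: field_simps)
      with reduction[OF l(1) kl _ \<delta>(1) \<delta>(2)[unfolded c_def] q_large \<epsilon>] hard show ?thesis unfolding c_def by blast
    qed
  qed
  \<comment> \<open>Since \<open>0 < l\<close> and \<open>l \<le> (k - 4) / 2\<close> give
    \<open>6 \<le> k\<close>, the threshold 1 suffices.\<close>
  with \<delta>(1) show ?thesis by (intro exI[of _ 1] exI[of _ \<delta>]) auto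
qed

end
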